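(* (Master formula) For arbitrary $m,n\in\mathbb Z$, $$\langle\varepsilon_n(x)\,\varepsilon_m(x)\,\widehat{\gamma_-}\,\mu_k^0(x)\rangle=q^{\frac{m^2+n^2+2k(|m|+|n|)}4}\,\varepsilon_m(n_\#)\,\langle\widehat{\gamma_-}\,\mu_k^0(x)\rangle,$$ $$\langle\varepsilon_n(x)\,\overline{\varepsilon_m}(x)\,\widehat{\gamma_-}\,\mu_k^0(x)\rangle=q^{\frac{m^2+n^2+2k(|m|+|n|)}4}\,\overline{\varepsilon_m}(n_\#)\,\langle\widehat{\gamma_-}\,\mu_k^0(x)\rangle.$$
   Context: Let $q,t$ (with the fractional powers that occur) be formal (generic) parameters, $t=q^k$, $X=q^x$; $q^{k/2}=t^{1/2}$. The constant term of a Laurent series in $X$ is denoted $\langle\cdot\rangle$. Put $$\mu_k(x)=\prod_{j\ge0}\frac{(1-q^{j}X^2)(1-q^{j+1}X^{-2})}{(1-tq^{j}X^2)(1-tq^{j+1}X^{-2})},\qquad \mu_k^0=\mu_k/\langle\mu_k\rangle,\qquad \widehat{\gamma_-}=\sum_{n=-\infty}^\infty q^{n^2/4}X^n .$$ The function $\mu_k$ is expanded as a Laurent series in $X$ with coefficients which are power series in $q,t$; the coefficients of $\mu_k^0$ are rational functions of $q,t$, and constant terms of products with $\widehat{\gamma_-}$ are understood as convergent series in (fractional) powers of $q$. For $n\in\mathbb Z$, $n_\#=(n+\mathrm{sgn}(n)k)/2$ with $\mathrm{sgn}(0)=-1$; the value of a Laurent polynomial at $n_\#$ is its value at $X=q^{n_\#}=q^{n/2}t^{\mathrm{sgn}(n)/2}$.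 Order: $X^m\prec X^n$ if $|m|<|n|$ or $m=-n>0$. The nonsymmetric polynomials $e_n$ (Laurent polynomials in $X$ with coefficients rational in $q,t$) are determined by $e_n=X^n+(\text{terms lower with respect to }\prec)$ and $\langle e_nX^{-m}\mu_k^0\rangle=0$ whenever $X^m\prec X^n$; $\varepsilon_n=e_n/e_n(-k/2)$, where $e_n(-k/2)$ is the value at $X=t^{-1/2}$. The bar is the ring involution $\bar X=X^{-1}$, $\overline{q^{1/2}}=q^{-1/2}$, $\overline{t^{1/2}}=t^{-1/2}$ of Laurent polynomials. *)

theory Defs
  imports
    "HOL-Analysis.Analysis"
    "HOL-Computational_Algebra.Computational_Algebra"
    "HOL-Library.Poly_Mapping"
begin

text \<open>
  The formal parameters are $u = q^{1/4}$ and $v = t^{1/2}$, with $t = q^k$.  The type \<open>ratfun\<close> is the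
  field $\mathbb{Q}(u,v)$, where the outer polynomial variable is $u$ and the inner one is $v$; it
  contains $\mathbb{Q}(q^{1/2},t^{1/2})$ and all the powers $q^{(a + bk)/4}$ ($a, b$ integers, $b$
  even) that are needed.

  Series are taken in the iterated field $\mathbb{Q}(v)((X))((u))$, the type \<open>series\<close>.  Both the
  expansion of $\mu_k$ (all denominators expanded in nonnegative powers of $t$ and $q$) and the
  two-sided Gaussian series live there: modulo any power of $u$ only finitely many negative powers
  of $X$ occur.  Convergence in the metric of the outer Laurent series is convergence in powers of
  $u = q^{1/4}$.
\<close>

type_synonym ratfun = "int poly poly fract"
type_synonym laurent = "int \<Rightarrow>\<^sub>0 ratfun"
type_synonym series = "int poly fract fls fls"

definition q_quarter :: ratfun where "q_quarter = to_fract [:0, 1:]"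
definition t_half :: ratfun where "t_half = to_fract [:[:0, 1:]:]"

definition q_quarter_series :: series where "q_quarter_series = fls_X"
definition X_series :: series where "X_series = fls_const fls_X"
definition t_half_series :: series where "t_half_series = fls_const (fls_const (to_fract [:0, 1:]))"

text \<open>
  Substitution of $q^{1/4} = x$, $t^{1/2} = y$ in a rational function written in lowest terms.
  It is used only for algebraically independent \<open>x\<close>, \<open>y\<close>, where it is a field homomorphism.
\<close>

definition eval_int_poly2 :: "'a::field \<Rightarrow> 'a \<Rightarrow> int poly poly \<Rightarrow> 'a" where
  "eval_int_poly2 x y p = poly (map_poly (\<lambda>c. poly (map_poly of_int c) y) p) x"

definition eval_ratfun :: "'a::field \<Rightarrow> 'a \<Rightarrow> ratfun \<Rightarrow> 'a" where
  "eval_ratfun x y r =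
     (case quot_of_fract r of (a, b) \<Rightarrow> eval_int_poly2 x y a / eval_int_poly2 x y b)"

definition to_series :: "ratfun \<Rightarrow> series" where
  "to_series = eval_ratfun q_quarter_series t_half_series"

definition ratfun_bar :: "ratfun \<Rightarrow> ratfun" where
  "ratfun_bar = eval_ratfun (inverse q_quarter) (inverse t_half)"

text \<open>Laurent polynomials in $X$ are finitely supported functions of the exponent.\<close>

definition laurent_series :: "laurent \<Rightarrow> series" where
  "laurent_series p =
     (\<Sum>n\<in>Poly_Mapping.keys p. to_series (Poly_Mapping.lookup p n) * X_series powi n)"

definition laurent_eval :: "laurent \<Rightarrow> ratfun \<Rightarrow> ratfun" where
  "laurent_eval p x = (\<Sum>n\<in>Poly_Mapping.keys p. Poly_Mapping.lookup p n * x powi n)"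

definition laurent_bar :: "laurent \<Rightarrow> laurent" where
  "laurent_bar p =
     (\<Sum>n\<in>Poly_Mapping.keys p. Poly_Mapping.single (- n) (ratfun_bar (Poly_Mapping.lookup p n)))"

text \<open>The constant term in $X$, regarded again as a series (not involving $X$).\<close>

lift_definition const_term :: "'a::zero fls fls \<Rightarrow> 'a fls fls" is
  "\<lambda>f i. fls_const (fls_nth (f i) 0)"
  by (auto elim: eventually_mono)

definition mu :: series where
  "mu = (let q = q_quarter_series ^ 4; t = t_half_series ^ 2; X = X_series in
     prodinf (\<lambda>j. ((1 - q ^ j * X powi 2) * (1 - q ^ (j + 1) * X powi (- 2))) /
          ((1 - t * q ^ j * X powi 2) * (1 - t * q ^ (j + 1) * X powi (- 2)))))"

definition mu0 :: series where
  "mu0 = mu / const_term mu"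

definition gauss :: series where
  "gauss = (\<Sum>\<^sub>\<infinity>n\<in>(UNIV :: int set). q_quarter_series powi (n\<^sup>2) * X_series powi n)"

definition mon_less :: "int \<Rightarrow> int \<Rightarrow> bool" where
  "mon_less m n \<longleftrightarrow> \<bar>m\<bar> < \<bar>n\<bar> \<or> (m = - n \<and> m > 0)"

definition is_nonsym_poly :: "int \<Rightarrow> laurent \<Rightarrow> bool" where
  "is_nonsym_poly n e \<longleftrightarrow>
     Poly_Mapping.lookup e n = 1 \<and>
     (\<forall>m. Poly_Mapping.lookup e m \<noteq> 0 \<longrightarrow> m = n \<or> mon_less m n) \<and>
     (\<forall>m. mon_less m n \<longrightarrow> const_term (laurent_series e * X_series powi (- m) * mu0) = 0)"

definition nonsym_poly :: "int \<Rightarrow> laurent" where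
  "nonsym_poly n = (THE e. is_nonsym_poly n e)"

text \<open>$\varepsilon_n$: normalised by the value of $e_n$ at $X = q^{-k/2} = t^{-1/2}$.\<close>

definition spherical_poly :: "int \<Rightarrow> laurent" where
  "spherical_poly n =
     Poly_Mapping.single 0 (inverse (laurent_eval (nonsym_poly n) (inverse t_half))) * nonsym_poly n"

text \<open>The value of $X$ at $n_\#$, i.e. $q^{n/2} t^{\mathrm{sgn}(n)/2}$ with $\mathrm{sgn}(0) = -1$.\<close>

definition q_sharp :: "int \<Rightarrow> ratfun" where
  "q_sharp n = q_quarter powi (2 * n) * t_half powi (if n > 0 then 1 else - 1)"

end

theory Submission
  imports Defs
begin

text \<open>
  Write $u = q^{1/4}$, $v = t^{1/2}$. On Laurent polynomials let $\pi X^n = u^{2n} X^{-n}$, let $T$ be the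
  Demazure--Lusztig operator and $\Pi = X \pi$; then $T X T = X^{-1}$ and $\pi^2 = 1$.  Applying $\Pi$ and $T$ alternately to
  $1$ produces eigenvectors of $\pi T$ that are triangular and orthogonal with respect to $\mu_k$, that is, the $e_n$.
  The weight $\mu_k$ is invariant under $\pi$ and $T$ is self-adjoint for it; the same two symmetries
  survive after multiplication by the Gaussian, except that $\pi$ picks up the factor $u^{-1} X$.
  Therefore $F(f) = \langle e_n f \widehat{\gamma_-} \mu_k \rangle$ satisfies
  $F(T \Pi f) = u \kappa_n F(f)$, where $\kappa_n = q^{-n_\#}$ is the eigenvalue of $e_n$.  On the other hand
  $X^{-1} e_m = T X T e_m = \kappa_m T \Pi e_m$.  Comparing the two relations, $F(e_m)$ and
  $q^{m^2/4} t^{|m|/2} e_m(n_\#)$ obey the same recursion in $m$, so they are proportional.  Taking $m = 0$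
  and exchanging the roles of $m$ and $n$ gives the constant.  The bar involution preserves the span of $e_m$ and
  $e_{-m}$, on which the Gaussian factor is constant, and this yields the second formula.
\<close>

section \<open>Linear extension from monomials\<close>

text \<open>The substitution X -> X^{-1} does not act on the field of series: 1/(1 - t X^2) is
  expanded in positive powers of X, and its image would be a series in X^{-1}. The symmetries of mu
  are therefore stated for coefficients, and the inversion is used only in the form that (X^{-1} - t
  X) mu is antisymmetric, where the offending denominator has cancelled. In coefficients, this and
  the invariance under pi are two linear relations. Together with the vanishing of the odd
  coefficients they determine mu_k^0 from its constant term, and they have a solution in Q(u, v);
  this is how the coefficients become rational functions. So T, pi and the e_n are studied over an
  abstract field, with <f mu_k^0> replaced by an explicit functional, and series enter only as
  sequences satisfying the same relations. The evaluation formula is proved for every f of bounded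
  degree that is orthogonal to lower degrees (\<open>level\<close>), not just for e_m: both formulas
  of the theorem are then the same statement for two such f.\<close>

locale ring_homomorphism =
  fixes hom :: "'a::comm_ring_1 \<Rightarrow> 'b::comm_ring_1"
  assumes hom_add: "hom (x + y) = hom x + hom y"
    and hom_mult: "hom (x * y) = hom x * hom y"
    and hom_one: "hom 1 = 1"
begin

lemma hom_zero: "hom 0 = 0"
  using hom_add[of 0 0] by simp

lemma hom_uminus: "hom (- x) = - hom x"
  using hom_add[of x "- x"] hom_zero by (simp add: eq_neg_iff_add_eq_0 add.commute)

lemma hom_diff: "hom (x - y) = hom x - hom y"
  using hom_add[of x "- y"] by (simp add: hom_uminus)

lemma hom_power: "hom (x ^ n) = hom x ^ n"
  by (induction n) (simp_all add: hom_one hom_mult)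

lemma hom_sum: "hom (sum f A) = (\<Sum>x\<in>A. hom (f x))"
  by (induction A rule: infinite_finite_induct) (simp_all add: hom_zero hom_add)

end

locale field_homomorphism = ring_homomorphism hom
  for hom :: "'a::field \<Rightarrow> 'b::field"
begin

lemma hom_inverse: "hom (inverse x) = inverse (hom x)"
proof (cases "x = 0")
  case False
  then have "hom x * hom (inverse x) = 1"
    by (simp add: hom_one flip: hom_mult)
  then show ?thesis
    by (metis inverse_unique)
qed (simp add: hom_zero)

lemma hom_divide: "hom (x / y) = hom x / hom y"
  by (simp add: divide_inverse hom_mult hom_inverse)

lemma hom_powi: "hom (x powi n) = hom x powi n"
  by (simp add: power_int_def hom_power hom_inverse)

lemma hom_eq_0_iff: "hom x = 0 \<longleftrightarrow> x = 0"
proof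
  assume "hom x = 0"
  then have "hom (x * inverse x) = 0"
    by (simp add: hom_mult)
  then show "x = 0"
    by (metis hom_one right_inverse zero_neq_one)
qed (simp add: hom_zero)

end

lemma single_zero_homomorphism: "ring_homomorphism (Poly_Mapping.single (0::'k::comm_monoid_add))"
  by unfold_locales (simp_all add: single_add mult_single)

lemma id_homomorphism: "ring_homomorphism (\<lambda>x. x)"
  by unfold_locales simp_all

text \<open>The choice of \<iota> covers all maps needed later: \<open>C\<close> gives operators on
  Laurent polynomials, the identity gives functionals and evaluations, \<open>to_series\<close>
  gives series-valued functionals, and bar followed by \<open>C\<close> gives the bar
  involution.\<close>

definition lext :: "('a::zero \<Rightarrow> 'b) \<Rightarrow> ('k \<Rightarrow> 'b) \<Rightarrow> ('k \<Rightarrow>\<^sub>0 'a) \<Rightarrow> 'b::comm_ring_1" where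
  "lext \<iota> h f = (\<Sum>n\<in>Poly_Mapping.keys f. \<iota> (Poly_Mapping.lookup f n) * h n)"

lemma poly_mapping_eq_sum_single:
  fixes f :: "'k \<Rightarrow>\<^sub>0 'a::comm_monoid_add"
  shows "f = (\<Sum>k\<in>Poly_Mapping.keys f. Poly_Mapping.single k (Poly_Mapping.lookup f k))"
  by (rule poly_mapping_eqI)
    (auto simp: lookup_sum lookup_single when_def in_keys_iff sum.delta)

lemma poly_mapping_single_induct [case_names single add]:
  fixes P :: "('k \<Rightarrow>\<^sub>0 'a::comm_monoid_add) \<Rightarrow> bool"
  assumes single: "\<And>k c. P (Poly_Mapping.single k c)"
    and add: "\<And>f g. P f \<Longrightarrow> P g \<Longrightarrow> P (f + g)"
  shows "P f"
proof -
  have "P (\<Sum>k\<in>A. Poly_Mapping.single k (Poly_Mapping.lookup f k))" for A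
  proof (induction A rule: infinite_finite_induct)
    case (insert x A)
    then show ?case
      by (simp add: single add)
  \<comment> \<open>The empty sum is a monomial with coefficient zero, at an arbitrary
    exponent.\<close>
  qed (use single[of undefined 0] in simp_all)
  then show ?thesis
    by (subst poly_mapping_eq_sum_single)
qed

context ring_homomorphism
begin

lemma lext_superset:
  assumes "finite A" "Poly_Mapping.keys f \<subseteq> A"
  shows "lext hom h f = (\<Sum>n\<in>A. hom (Poly_Mapping.lookup f n) * h n)"
  unfolding lext_def using assms
  by (intro sum.mono_neutral_left) (auto simp: in_keys_iff hom_zero)

lemma lext_zero: "lext hom h 0 = 0"
  by (simp add: lext_def)

lemma lext_add: "lext hom h (f + g) = lext hom h f + lext hom h g"
proof -
  let ?A = "Poly_Mapping.keys f \<union> Poly_Mapping.keys g"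
  have "Poly_Mapping.keys (f + g) \<subseteq> ?A"
    by (rule keys_add)
  then show ?thesis
    by (simp add: lext_superset[where A = ?A] lookup_add hom_add distrib_right sum.distrib)
qed

lemma lext_single: "lext hom h (Poly_Mapping.single n c) = hom c * h n"
  by (subst lext_superset[where A = "{n}"]) auto

lemma lext_scale:
  "lext hom h (Poly_Mapping.single (0::'k::comm_monoid_add) c * f) = hom c * lext hom h f"
  by (induction f rule: poly_mapping_single_induct)
    (simp_all add: mult_single lext_single hom_mult lext_add distrib_left mult.assoc)

lemma lext_diff:
  fixes f g :: "'k::comm_monoid_add \<Rightarrow>\<^sub>0 'a"
  shows "lext hom h (f - g) = lext hom h f - lext hom h g"
  using lext_add[of h "f - g" g] by simp

lemma lext_uminus:
  fixes f :: "'k::comm_monoid_add \<Rightarrow>\<^sub>0 'a"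
  shows "lext hom h (- f) = - lext hom h f"
  using lext_diff[of h 0 f] by (simp add: lext_zero)

lemma lext_sum: "lext hom h (sum F A) = (\<Sum>x\<in>A. lext hom h (F x))"
  by (induction A rule: infinite_finite_induct) (simp_all add: lext_zero lext_add)

lemma lext_mult:
  assumes h: "\<And>m n. h (m + n) = h m * h n"
  shows "lext hom h (f * g) = lext hom h f * lext hom h (g :: 'k::comm_monoid_add \<Rightarrow>\<^sub>0 'a)"
proof (induction f rule: poly_mapping_single_induct)
  case (single k c)
  show ?case
    by (induction g rule: poly_mapping_single_induct)
      (simp_all add: mult_single lext_single hom_mult h lext_add algebra_simps)
qed (simp add: distrib_right lext_add)

end

lemma lookup_lext_single:
  "Poly_Mapping.lookup (lext (Poly_Mapping.single 0) h f) k =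
     (\<Sum>n\<in>Poly_Mapping.keys f. Poly_Mapping.lookup f n * Poly_Mapping.lookup (h n) (k::'k::comm_monoid_add))"
proof -
  have "Poly_Mapping.lookup (Poly_Mapping.single 0 c * g) k = c * Poly_Mapping.lookup g k"
    for c :: 'a and g :: "'k \<Rightarrow>\<^sub>0 'a"
    by (simp add: mult_map_scale_conv_mult[symmetric] map.rep_eq when_def)
  then show ?thesis
    by (simp add: lext_def lookup_sum)
qed

lemma lookup_scale:
  "Poly_Mapping.lookup (Poly_Mapping.single 0 c * g) k =
    (c::'a::comm_ring_1) * Poly_Mapping.lookup g (k::'k::comm_monoid_add)"
  by (simp add: mult_map_scale_conv_mult[symmetric] map.rep_eq when_def)

lemma lookup_single_mult:
  "Poly_Mapping.lookup (Poly_Mapping.single j c * g) k =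
    (c::'a::comm_ring_1) * Poly_Mapping.lookup g (k - j::int)"
proof (induction g rule: poly_mapping_single_induct)
  case (single i d)
  then show ?case
    by (auto simp: mult_single lookup_single when_def)
qed (simp add: distrib_left lookup_add)

section \<open>Operators on Laurent polynomials\<close>

abbreviation X :: "int \<Rightarrow> int \<Rightarrow>\<^sub>0 'k::comm_ring_1" where "X n \<equiv> Poly_Mapping.single n 1"
abbreviation C :: "'k \<Rightarrow> int \<Rightarrow>\<^sub>0 'k::comm_ring_1" where "C c \<equiv> Poly_Mapping.single 0 c"

interpretation C: ring_homomorphism C
  by (rule single_zero_homomorphism)

interpretation id: ring_homomorphism "\<lambda>x. x"
  by (rule id_homomorphism)

section \<open>Inversion of X, divided differences and their supports\<close>

definition reflect :: "(int \<Rightarrow>\<^sub>0 'k::comm_ring_1) \<Rightarrow> int \<Rightarrow>\<^sub>0 'k" where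
  "reflect = lext C (\<lambda>n. X (- n))"

lemma reflect_add: "reflect (f + g) = reflect f + reflect g"
  by (simp add: reflect_def C.lext_add)

lemma reflect_diff: "reflect (f - g) = reflect f - reflect g"
  by (simp add: reflect_def C.lext_diff)

lemma reflect_single: "reflect (Poly_Mapping.single n c) = Poly_Mapping.single (- n) c"
  by (simp add: reflect_def C.lext_single mult_single)

lemma reflect_mult: "reflect (f * g) = reflect f * reflect g"
  unfolding reflect_def by (rule C.lext_mult) (simp add: mult_single)

lemma reflect_reflect: "reflect (reflect f) = f"
  by (induction f rule: poly_mapping_single_induct) (simp_all add: reflect_single reflect_add)

lemma lookup_reflect: "Poly_Mapping.lookup (reflect f) n = Poly_Mapping.lookup f (- n)"
  by (induction f rule: poly_mapping_single_induct)
    (auto simp: reflect_single reflect_add lookup_add lookup_single when_def)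

definition geometric :: "int \<Rightarrow> nat \<Rightarrow> int \<Rightarrow>\<^sub>0 'k::comm_ring_1" where
  "geometric a k = (\<Sum>i<k. X (2 * int i + a))"

lemma geometric_mult:
  "(X 2 - 1 :: int \<Rightarrow>\<^sub>0 'k::comm_ring_1) * geometric a k = X (2 * int k + a) - X a"
proof (induction k)
  case (Suc k)
  have "(X 2 - 1 :: int \<Rightarrow>\<^sub>0 'k) * X (2 * int k + a) = X (2 * int (Suc k) + a) - X (2 * int k + a)"
    by (simp add: left_diff_distrib mult_single algebra_simps)
  with Suc show ?case
    by (simp add: geometric_def distrib_left)
qed (simp add: geometric_def)

lemma lookup_geometric_nonzero:
  assumes "Poly_Mapping.lookup (geometric a k :: int \<Rightarrow>\<^sub>0 'k::comm_ring_1) j \<noteq> 0"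
  shows "a \<le> j \<and> j \<le> a + 2 * int k - 2 \<and> even (j - a)"
proof -
  from assms have "(\<Sum>i<k. Poly_Mapping.lookup (X (2 * int i + a) :: int \<Rightarrow>\<^sub>0 'k) j) \<noteq> 0"
    by (simp only: geometric_def lookup_sum not_False_eq_True)
  then obtain i where "i < k" "Poly_Mapping.lookup (X (2 * int i + a) :: int \<Rightarrow>\<^sub>0 'k) j \<noteq> 0"
    by (rule sum.not_neutral_contains_not_neutral) simp
  then show ?thesis
    by (auto simp: lookup_single when_def split: if_splits)
qed

text \<open>The quotient (X^{-n} - X^n)/(X^2 - 1), written out as a geometric sum so that no
  division of Laurent polynomials is involved.\<close>

definition divided_difference_X :: "int \<Rightarrow> int \<Rightarrow>\<^sub>0 'k::comm_ring_1" where
  "divided_difference_X n = (if n \<ge> 0 then - geometric (- n) (nat n) else geometric n (nat (- n)))"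

definition divided_difference :: "(int \<Rightarrow>\<^sub>0 'k::comm_ring_1) \<Rightarrow> int \<Rightarrow>\<^sub>0 'k" where
  "divided_difference = lext C divided_difference_X"

lemma divided_difference_mult:
  "(X 2 - 1) * divided_difference f = reflect f - (f :: int \<Rightarrow>\<^sub>0 'k::comm_ring_1)"
proof (induction f rule: poly_mapping_single_induct)
  case (single n c)
  have "(X 2 - 1 :: int \<Rightarrow>\<^sub>0 'k) * divided_difference_X n = X (- n) - X n"
    by (simp add: divided_difference_X_def geometric_mult)
  then have "(X 2 - 1) * divided_difference (Poly_Mapping.single n c) = C c * (X (- n) - X n)"
    by (simp add: divided_difference_def C.lext_single mult.left_commute)
  then show ?case
    by (simp add: reflect_single right_diff_distrib mult_single)
qed (simp add: divided_difference_def C.lext_add reflect_add distrib_left)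

text \<open>The parity is part of the condition because mu has only even powers of X: in
  \<open>orthogonal_Pi_op\<close> one pairing lies outside the reach of orthogonality and vanishes
  by parity alone.\<close>

definition deg_le :: "int \<Rightarrow> (int \<Rightarrow>\<^sub>0 'k::zero) \<Rightarrow> bool" where
  "deg_le N f \<longleftrightarrow> (\<forall>m. Poly_Mapping.lookup f m \<noteq> 0 \<longrightarrow> \<bar>m\<bar> \<le> N \<and> even (m - N))"

lemma deg_le_lookup_eq_0: "deg_le N f \<Longrightarrow> \<bar>m\<bar> > N \<Longrightarrow> Poly_Mapping.lookup f m = 0"
  unfolding deg_le_def using not_less by blast

lemma deg_le_add:
  assumes "deg_le N f" "deg_le N g"
  shows "deg_le N (f + g)"
  unfolding deg_le_def
proof (intro allI impI)
  fix m
  assume "Poly_Mapping.lookup (f + g) m \<noteq> 0"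
  then have "Poly_Mapping.lookup f m \<noteq> 0 \<or> Poly_Mapping.lookup g m \<noteq> 0"
    by (auto simp: lookup_add)
  then show "\<bar>m\<bar> \<le> N \<and> even (m - N)"
    using assms unfolding deg_le_def by blast
qed

lemma deg_le_C_mult: "deg_le N f \<Longrightarrow> deg_le N (C c * f)"
  unfolding deg_le_def lookup_scale by (metis mult_zero_right)

lemma deg_le_reflect: "deg_le N f \<Longrightarrow> deg_le N (reflect f)"
  unfolding deg_le_def lookup_reflect
proof (intro allI impI)
  fix m
  assume "\<forall>m. Poly_Mapping.lookup f m \<noteq> 0 \<longrightarrow> \<bar>m\<bar> \<le> N \<and> even (m - N)"
    and "Poly_Mapping.lookup f (- m) \<noteq> 0"
  then have "\<bar>- m\<bar> \<le> N \<and> even (- m - N)"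
    by blast
  then show "\<bar>m\<bar> \<le> N \<and> even (m - N)"
    by presburger
qed

text \<open>The quotient reaches down to -|n| but stays below |n|. This asymmetry makes T compatible
  with an order in which X^n precedes X^{-n} for n > 0.\<close>

lemma divided_difference_X_nonzero:
  assumes "Poly_Mapping.lookup (divided_difference_X n :: int \<Rightarrow>\<^sub>0 'k::comm_ring_1) j \<noteq> 0"
  shows "- \<bar>n\<bar> \<le> j \<and> j < \<bar>n\<bar> \<and> even (j - n)"
proof -
  have "Poly_Mapping.lookup (geometric (- \<bar>n\<bar>) (nat \<bar>n\<bar>) :: int \<Rightarrow>\<^sub>0 'k) j \<noteq> 0"
    using assms by (cases "n \<ge> 0") (simp_all add: divided_difference_X_def)
  from lookup_geometric_nonzero[OF this]
  have "- \<bar>n\<bar> \<le> j \<and> j \<le> - \<bar>n\<bar> + 2 * \<bar>n\<bar> - 2 \<and> even (j + \<bar>n\<bar>)"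
    by simp
  then show ?thesis
    by presburger
qed

lemma divided_difference_nonzero:
  fixes f :: "int \<Rightarrow>\<^sub>0 'k::comm_ring_1"
  assumes "deg_le N f" "Poly_Mapping.lookup (divided_difference f) j \<noteq> 0"
  shows "- N \<le> j \<and> j < N \<and> even (j - N)"
proof -
  from assms(2) have "(\<Sum>n\<in>Poly_Mapping.keys f. Poly_Mapping.lookup f n *
      Poly_Mapping.lookup (divided_difference_X n :: int \<Rightarrow>\<^sub>0 'k) j) \<noteq> 0"
    by (simp add: divided_difference_def lookup_lext_single)
  then obtain n where "Poly_Mapping.lookup f n *
      Poly_Mapping.lookup (divided_difference_X n :: int \<Rightarrow>\<^sub>0 'k) j \<noteq> 0"
    by (rule sum.not_neutral_contains_not_neutral)
  then have "Poly_Mapping.lookup f n \<noteq> 0"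
    "Poly_Mapping.lookup (divided_difference_X n :: int \<Rightarrow>\<^sub>0 'k) j \<noteq> 0"
    by auto
  then have "\<bar>n\<bar> \<le> N \<and> even (n - N)" "- \<bar>n\<bar> \<le> j \<and> j < \<bar>n\<bar> \<and> even (j - n)"
    using assms(1) divided_difference_X_nonzero unfolding deg_le_def by blast+
  then show ?thesis
    by presburger
qed

lemma deg_le_divided_difference: "deg_le N f \<Longrightarrow> deg_le N (divided_difference f)"
  unfolding deg_le_def[of N "divided_difference f"]
  using divided_difference_nonzero by (metis abs_le_iff less_imp_le minus_le_iff)

lemma lookup_divided_difference_top:
  "deg_le N f \<Longrightarrow> Poly_Mapping.lookup (divided_difference f) N = 0"
  using divided_difference_nonzero[of N f N] by blast

text \<open>Compare the coefficients of X^{-N} in \<open>divided_difference_mult\<close>; the term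
  shifted by X^2 would come from an exponent below the support.\<close>

lemma lookup_divided_difference_bottom:
  assumes "deg_le N f"
  shows "Poly_Mapping.lookup (divided_difference f) (- N) =
    Poly_Mapping.lookup f (- N) - Poly_Mapping.lookup f N"
proof -
  have "Poly_Mapping.lookup (divided_difference f) (- N - 2) = 0"
    using divided_difference_nonzero[OF assms, of "- N - 2"] by auto
  moreover have "Poly_Mapping.lookup ((X 2 - 1) * divided_difference f) (- N) =
      Poly_Mapping.lookup f N - Poly_Mapping.lookup f (- N)"
    by (simp add: divided_difference_mult lookup_minus lookup_reflect)
  moreover have "Poly_Mapping.lookup ((X 2 - 1) * divided_difference f) (- N) =
      Poly_Mapping.lookup (divided_difference f) (- N - 2) - Poly_Mapping.lookup (divided_difference f) (- N)"
    by (simp add: left_diff_distrib lookup_minus lookup_single_mult)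
  ultimately show ?thesis
    by (metis minus_diff_eq minus_minus diff_0)
qed

text \<open>Independence of monomials suffices, since every quantity that has to be nonzero is, up
  to sign and units, of the form u^a v^b - 1. The condition on 2 allows the conclusion that a value
  equal to its own negative is zero, in \<open>T_adjoint\<close>.\<close>

locale generic_parameters =
  fixes u v :: "'k::field"
  assumes independent: "u powi i * v powi j = 1 \<Longrightarrow> i = 0 \<and> j = 0"
    and u_nonzero: "u \<noteq> 0" and v_nonzero: "v \<noteq> 0"
    and two_nonzero: "(2::'k) \<noteq> 0"
begin

definition T :: "(int \<Rightarrow>\<^sub>0 'k) \<Rightarrow> int \<Rightarrow>\<^sub>0 'k" where
  "T f = C v * reflect f + C (v - inverse v) * divided_difference f"

lemma X2_minus_1_nonzero: "(X 2 - 1 :: int \<Rightarrow>\<^sub>0 'k) \<noteq> 0"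
proof
  assume "(X 2 - 1 :: int \<Rightarrow>\<^sub>0 'k) = 0"
  then have "Poly_Mapping.lookup (X 2 - 1 :: int \<Rightarrow>\<^sub>0 'k) 2 = 0"
    by simp
  then show False
    by (simp add: lookup_minus lookup_single lookup_one)
qed

text \<open>Clearing the denominator X^2 - 1 turns relations between operators into polynomial
  identities in X, f and \<open>reflect f\<close>. Laurent polynomials form a domain, so the factor
  can be cancelled at the end.\<close>

lemma T_mult:
  "(X 2 - 1) * T f = (C v * X 2 - C (inverse v)) * reflect f - (C v - C (inverse v)) * f"
proof -
  have "(X 2 - 1) * T f =
      C v * (X 2 - 1) * reflect f + (C v - C (inverse v)) * ((X 2 - 1) * divided_difference f)"
    by (simp add: T_def C.hom_diff algebra_simps)
  then show ?thesis
    unfolding divided_difference_mult by (simp add: algebra_simps)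
qed

lemma T_add: "T (f + g) = T f + T g"
  by (simp add: T_def reflect_add divided_difference_def C.lext_add algebra_simps)

lemma T_C_mult: "T (C c * f) = C c * T f"
  unfolding T_def reflect_def divided_difference_def C.lext_scale by (simp add: algebra_simps)

lemma C_v_inverse: "C v * C (inverse v) = 1"
  using v_nonzero by (simp add: mult_single)

lemma reflect_T_mult:
  "(X 2 - 1) * reflect (T f) =
    (C v - C (inverse v)) * X 2 * reflect f - (C v - C (inverse v) * X 2) * f"
proof -
  \<comment> \<open>Here a and b stand for X^2 and X^{-2} as independent unknowns. The relation a b
    = 1 enters only through an explicit multiple of a b - 1, which is removed afterwards.\<close>
  have ring: "(a - 1) * R = (a * b - 1) * R - a * ((b - 1) * R)"
      "(a * b - 1) * R - a * ((p * b - r) * f - (p - r) * s) =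
        (p - r) * a * s - (p - r * a) * f + (a * b - 1) * (R - p * f)"
    for a b p r s f R :: "int \<Rightarrow>\<^sub>0 'k"
    by (simp_all add: algebra_simps)
  have ab: "X 2 * X (- 2) = (1 :: int \<Rightarrow>\<^sub>0 'k)"
    by (simp add: mult_single)
  have "reflect ((X 2 - 1) * T f) =
      reflect ((C v * X 2 - C (inverse v)) * reflect f - (C v - C (inverse v)) * f)"
    by (simp only: T_mult)
  then have eq: "(X (- 2) - 1) * reflect (T f) =
      (C v * X (- 2) - C (inverse v)) * f - (C v - C (inverse v)) * reflect f"
    by (simp only: reflect_mult reflect_diff reflect_single reflect_reflect minus_zero
        single_one[symmetric])
  show ?thesis
    unfolding ring(1)[of "X 2" "reflect (T f)" "X (- 2)"] eq ring(2)
    by (simp only: ab diff_self mult_zero_left add_0_right)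
qed

text \<open>The Hecke relation (T - v)(T + v^{-1}) = 0, checked after multiplication by (X^2 -
  1)^2.\<close>

lemma T_T: "T (T f) = C (v - inverse v) * T f + f"
proof -
  have ring: "(p * a - r) * ((p - r) * a * s - (p - r * a) * f) - (p - r) * ((p * a - r) * s - (p - r) * f)
      = (a - 1) * ((p - r) * ((p * a - r) * s - (p - r) * f) + (a - 1) * f) + (p * r - 1) * ((a - 1) * (a - 1) * f)"
    for a p r s f :: "int \<Rightarrow>\<^sub>0 'k"
    by (simp add: algebra_simps)
  define p where "p = C v"
  define r where "r = C (inverse v)"
  define a where "a = (X 2 :: int \<Rightarrow>\<^sub>0 'k)"
  have "(a - 1) * ((a - 1) * T (T f)) =
      (p * a - r) * ((a - 1) * reflect (T f)) - (p - r) * ((a - 1) * T f)"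
    unfolding a_def T_mult[of "T f"] p_def r_def by (simp only: algebra_simps)
  also have "\<dots> = (a - 1) * ((p - r) * ((a - 1) * T f) + (a - 1) * f)"
    unfolding a_def T_mult[of f] reflect_T_mult p_def r_def
    by (subst ring) (simp only: C_v_inverse diff_self mult_zero_left add_0_right)
  finally have "(a - 1) * ((a - 1) * T (T f)) = (a - 1) * ((a - 1) * ((p - r) * T f + f))"
    by (simp only: algebra_simps)
  then show ?thesis
    using X2_minus_1_nonzero by (simp add: C.hom_diff p_def r_def a_def)
qed

lemma T_X_T: "T (X 1 * T f) = X (- 1) * f"
proof -
  \<comment> \<open>An identity in independent unknowns; the correction terms carry the factors p r
    - 1 and x y - 1, which vanish for p = v, r = v^{-1}, y = x^{-1}.\<close>
  have ring: "(p * (x * x) - r) * (y * ((p - r) * (x * x) * s - (p - r * (x * x)) * f))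
        - (p - r) * (x * ((p * (x * x) - r) * s - (p - r) * f))
      = (x * x - 1) * ((x * x - 1) * (y * f)) + (p * r - 1) * ((x * x - 1) * ((x * x - 1) * (y * f)))
        + (x * y - 1) * ((p - r) * (p * (x * x) - r) * x * s - (p - r) * (p - r) * (x * f))"
    for x y p r s f :: "int \<Rightarrow>\<^sub>0 'k"
    by (simp add: algebra_simps)
  define p where "p = C v"
  define r where "r = C (inverse v)"
  define x where "x = (X 1 :: int \<Rightarrow>\<^sub>0 'k)"
  define y where "y = (X (- 1) :: int \<Rightarrow>\<^sub>0 'k)"
  have xy: "x * y = 1" and x2: "X 2 = x * x"
    by (simp_all add: mult_single x_def y_def)
  have "(x * x - 1) * ((x * x - 1) * T (x * T f)) =
      (p * (x * x) - r) * (y * ((x * x - 1) * reflect (T f))) - (p - r) * (x * ((x * x - 1) * T f))"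
    unfolding x2[symmetric] T_mult[of "x * T f"]
    by (simp add: p_def r_def reflect_mult x_def reflect_single y_def algebra_simps)
  also have "\<dots> = (x * x - 1) * ((x * x - 1) * (y * f))"
    unfolding x2[symmetric] T_mult[of f] reflect_T_mult unfolding x2 p_def r_def
    by (subst ring) (simp only: C_v_inverse xy diff_self mult_zero_left add_0_right)
  finally show ?thesis
    using X2_minus_1_nonzero by (simp add: x_def[symmetric] y_def[symmetric] x2)
qed

lemma deg_le_T: "deg_le N f \<Longrightarrow> deg_le N (T f)"
  by (simp add: T_def deg_le_add deg_le_C_mult deg_le_reflect deg_le_divided_difference)

lemma lookup_T_top:
  "deg_le N f \<Longrightarrow> Poly_Mapping.lookup (T f) N = v * Poly_Mapping.lookup f (- N)"
  by (simp add: T_def lookup_add lookup_scale lookup_reflect lookup_divided_difference_top)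

lemma lookup_T_bottom:
  "deg_le N f \<Longrightarrow> Poly_Mapping.lookup (T f) (- N) =
     inverse v * Poly_Mapping.lookup f N + (v - inverse v) * Poly_Mapping.lookup f (- N)"
  by (simp add: T_def lookup_add lookup_scale lookup_reflect lookup_divided_difference_bottom)
    (simp add: algebra_simps)

text \<open>The substitution $x \mapsto 1/2 - x$.\<close>

definition flip :: "(int \<Rightarrow>\<^sub>0 'k) \<Rightarrow> int \<Rightarrow>\<^sub>0 'k" where
  "flip = lext C (\<lambda>n. Poly_Mapping.single (- n) (u powi (2 * n)))"

lemma flip_add: "flip (f + g) = flip f + flip g"
  by (simp add: flip_def C.lext_add)

lemma flip_C_mult: "flip (C c * f) = C c * flip f"
  by (simp add: flip_def C.lext_scale)

lemma flip_single: "flip (Poly_Mapping.single n c) = Poly_Mapping.single (- n) (c * u powi (2 * n))"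
  by (simp add: flip_def C.lext_single mult_single)

lemma flip_mult: "flip (f * g) = flip f * flip g"
  unfolding flip_def
  by (rule C.lext_mult) (simp add: mult_single power_int_add u_nonzero distrib_left)

lemma flip_one: "flip 1 = 1"
  using flip_single[of 0 1] by simp

lemma flip_flip: "flip (flip f) = f"
  by (induction f rule: poly_mapping_single_induct)
    (simp_all add: flip_single flip_add power_int_minus u_nonzero mult.assoc)

lemma lookup_flip:
  "Poly_Mapping.lookup (flip f) n = u powi (- 2 * n) * Poly_Mapping.lookup f (- n)"
  by (induction f rule: poly_mapping_single_induct)
    (auto simp: flip_single flip_add lookup_add lookup_single when_def algebra_simps)

definition Pi_op :: "(int \<Rightarrow>\<^sub>0 'k) \<Rightarrow> int \<Rightarrow>\<^sub>0 'k" where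
  "Pi_op f = X 1 * flip f"

lemma flip_Pi_op: "flip (Pi_op f) = C (u\<^sup>2) * (X (- 1) * f)"
  by (simp add: Pi_op_def flip_mult flip_single flip_flip mult_single flip: mult.assoc)

text \<open>Moving pi past X turns X into u^2 X^{-1}, which cancels the other X. Later this leads
  from E_{k+1} back to E_{-k}.\<close>

lemma Pi_op_Pi_op: "Pi_op (Pi_op f) = C (u\<^sup>2) * f"
  by (simp add: Pi_op_def[of "Pi_op f"] flip_Pi_op mult_single flip: mult.assoc)

lemma Pi_op_C_mult: "Pi_op (C c * f) = C c * Pi_op f"
  by (simp add: Pi_op_def flip_C_mult mult.left_commute)

lemma lookup_Pi_op:
  "Poly_Mapping.lookup (Pi_op f) n = u powi (2 - 2 * n) * Poly_Mapping.lookup f (1 - n)"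
  by (simp add: Pi_op_def lookup_single_mult lookup_flip)

lemma deg_le_Pi_op: "deg_le N f \<Longrightarrow> deg_le (N + 1) (Pi_op f)"
  unfolding deg_le_def lookup_Pi_op
proof (intro allI impI)
  fix m
  assume "\<forall>m. Poly_Mapping.lookup f m \<noteq> 0 \<longrightarrow> \<bar>m\<bar> \<le> N \<and> even (m - N)"
    and "u powi (2 - 2 * m) * Poly_Mapping.lookup f (1 - m) \<noteq> 0"
  then have "\<bar>1 - m\<bar> \<le> N \<and> even (1 - m - N)"
    by auto
  then show "\<bar>m\<bar> \<le> N + 1 \<and> even (m - (N + 1))"
    by presburger
qed

subsection \<open>The nonsymmetric polynomials\<close>

text \<open>The coefficient a for which T e + a e is again an eigenvector, when e = E_n with n > 0;
  the denominator is \<kappa>^{-2} - 1 for the eigenvalue \<kappa> = u^{-2n} v^{-1} of E_n.\<close>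

definition raising_coeff :: "nat \<Rightarrow> 'k" where
  "raising_coeff n = (v - inverse v) / (u ^ (4 * n) * v\<^sup>2 - 1)"

text \<open>The pair is (E_k, E_{-k}), and the recursion climbs the order 0, 1, -1, 2, -2, ... one
  step at a time. The factors u^{2k} and v make the leading coefficients equal to 1.\<close>

primrec E_pair :: "nat \<Rightarrow> (int \<Rightarrow>\<^sub>0 'k) \<times> (int \<Rightarrow>\<^sub>0 'k)" where
  "E_pair 0 = (1, 1)"
| "E_pair (Suc k) = (let e = C (u ^ (2 * k)) * Pi_op (snd (E_pair k))
     in (e, C v * (T e + C (raising_coeff (Suc k)) * e)))"

definition E :: "int \<Rightarrow> int \<Rightarrow>\<^sub>0 'k" where
  "E n = (if n > 0 then fst (E_pair (nat n)) else snd (E_pair (nat (- n))))"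

lemma E_0: "E 0 = 1"
  by (simp add: E_def)

lemma E_pos: "E (int (Suc k)) = C (u ^ (2 * k)) * Pi_op (E (- int k))"
  by (simp add: E_def Let_def del: of_nat_Suc)

lemma E_neg:
  "E (- int (Suc k)) = C v * (T (E (int (Suc k))) + C (raising_coeff (Suc k)) * E (int (Suc k)))"
  by (simp add: E_def Let_def del: of_nat_Suc)

definition eigenvalue :: "int \<Rightarrow> 'k" where
  "eigenvalue n = u powi (- 2 * n) * v powi (if n > 0 then - 1 else 1)"

lemma eigenvalue_nonzero: "eigenvalue n \<noteq> 0"
  by (simp add: eigenvalue_def u_nonzero v_nonzero power_int_not_zero)

lemma u_v_power_neq_1: "m \<noteq> 0 \<or> n \<noteq> 0 \<Longrightarrow> u ^ m * v ^ n \<noteq> 1"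
  using independent[of "int m" "int n"] by auto

lemma v_power_neq_1: "n \<noteq> 0 \<Longrightarrow> v ^ n \<noteq> 1"
  using u_v_power_neq_1[of 0 n] by simp

lemma u_power_neq_1: "n \<noteq> 0 \<Longrightarrow> u ^ n \<noteq> 1"
  using u_v_power_neq_1[of n 0] by simp

text \<open>Since pi^2 = 1, the hypothesis says pi T e = \<kappa> e. Apply T X T = X^{-1} to e and
  note that X^{-1} e is, up to the factor u^2, the image of Pi e under pi.\<close>

lemma eigen_Pi_op:
  assumes "T e = C \<kappa> * flip e" "\<kappa> \<noteq> 0"
  shows "T (Pi_op e) = C (inverse (u\<^sup>2 * \<kappa>)) * flip (Pi_op e)"
proof -
  have "C \<kappa> * T (Pi_op e) = T (X 1 * T e)"
    by (simp add: assms Pi_op_def mult.left_commute flip: T_C_mult)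
  also have "\<dots> = X (- 1) * e"
    by (rule T_X_T)
  finally have "C (inverse \<kappa>) * (C \<kappa> * T (Pi_op e)) = C (inverse \<kappa>) * (X (- 1) * e)"
    by simp
  then have "T (Pi_op e) = C (inverse \<kappa>) * (X (- 1) * e)"
    using assms(2) by (simp add: mult_single flip: mult.assoc)
  moreover have "inverse (u\<^sup>2 * \<kappa>) * u\<^sup>2 = inverse \<kappa>"
    using u_nonzero by (simp add: field_simps)
  then have "C (inverse (u\<^sup>2 * \<kappa>)) * (C (u\<^sup>2) * (X (- 1) * e)) = C (inverse \<kappa>) * (X (- 1) * e)"
    by (simp only: mult_single mult.assoc[symmetric] add_0)
  ultimately show ?thesis
    by (simp only: flip_Pi_op)
qed

text \<open>T and pi both preserve the span of e and T e: pi T e = \<kappa> e and pi e =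
  \<kappa>^{-1} T e. In the equation for T e + a e the coefficients of e agree, and those of T e
  require v - v^{-1} + a = a \<kappa>^{-2}.\<close>

lemma eigen_T:
  assumes e: "T e = C \<kappa> * flip e" and \<kappa>: "\<kappa> \<noteq> 0" "inverse \<kappa> * inverse \<kappa> \<noteq> 1"
    and a: "a = (v - inverse v) / (inverse \<kappa> * inverse \<kappa> - 1)"
  shows "T (T e + C a * e) = C (inverse \<kappa>) * flip (T e + C a * e)"
proof -
  define w where "w = inverse \<kappa> * inverse \<kappa>"
  have "a * (w - 1) = v - inverse v"
    using \<kappa>(2) unfolding a w_def[symmetric] by simp
  moreover have "a * w = a * (w - 1) + a"
    by (simp add: algebra_simps)
  ultimately have a': "v - inverse v + a = a * w"
    by simp
  have "flip (C (inverse \<kappa>) * T e) = flip (flip e)"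
    using \<kappa>(1) by (simp add: e mult_single flip: mult.assoc)
  then have 1: "C (inverse \<kappa>) * flip (T e) = e"
    by (simp add: flip_C_mult flip_flip)
  have 2: "flip e = C (inverse \<kappa>) * T e"
    using \<kappa>(1) by (simp add: e mult_single flip: mult.assoc)
  have w: "inverse \<kappa> * a * inverse \<kappa> = a * w"
    by (simp add: w_def)
  have "C (inverse \<kappa>) * flip (T e + C a * e) = e + C (a * w) * T e"
    unfolding flip_add flip_C_mult distrib_left 1 2
    by (simp only: mult.assoc[symmetric] mult_single add_0 w)
  also have "\<dots> = T (T e + C a * e)"
    unfolding a'[symmetric] T_add T_T T_C_mult C.hom_add by (simp add: algebra_simps)
  finally show ?thesis
    by simp
qed

text \<open>The last clause expresses triangularity: for n > 0 the monomial X^{-n} comes after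
  X^n.\<close>

definition monic :: "int \<Rightarrow> (int \<Rightarrow>\<^sub>0 'k) \<Rightarrow> bool" where
  "monic n e \<longleftrightarrow> deg_le \<bar>n\<bar> e \<and> Poly_Mapping.lookup e n = 1 \<and>
     (n > 0 \<longrightarrow> Poly_Mapping.lookup e (- n) = 0)"

lemma eigenvalue_of_nat: "eigenvalue (int (Suc k)) = inverse (u ^ (2 * Suc k)) * inverse v"
proof -
  have "- 2 * int (Suc k) = - int (2 * Suc k)"
    by simp
  then show ?thesis
    unfolding eigenvalue_def by (simp only: power_int_minus power_int_of_nat) (simp add: power_int_minus)
qed

lemma eigenvalue_uminus_of_nat: "eigenvalue (- int k) = u ^ (2 * k) * v"
  using power_int_of_nat[of u "2 * k"] by (simp add: eigenvalue_def)

lemma E_main: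
  "monic (int k) (E (int k)) \<and> monic (- int k) (E (- int k)) \<and>
   T (E (int k)) = C (eigenvalue (int k)) * flip (E (int k)) \<and>
   T (E (- int k)) = C (eigenvalue (- int k)) * flip (E (- int k))"
proof (induction k)
  case 0
  have "T 1 = C v"
    using reflect_single[of 0 "1::'k"] C.lext_single[of divided_difference_X 0 "1::'k"]
    by (simp add: T_def divided_difference_def divided_difference_X_def geometric_def)
  moreover have "monic 0 1"
    by (simp add: monic_def deg_le_def lookup_one when_def)
  ultimately show ?case
    by (simp add: E_0 eigenvalue_def flip_one)
next
  case (Suc k)
  let ?n = "int (Suc k)"
  define e where "e = E (- int k)"
  define f where "f = E ?n"
  have f: "f = C (u ^ (2 * k)) * Pi_op e"
    by (simp only: f_def e_def E_pos)
  have e: "deg_le (int k) e" "Poly_Mapping.lookup e (- int k) = 1"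
    "T e = C (eigenvalue (- int k)) * flip e"
    using Suc by (simp_all add: e_def monic_def)
  have deg_f: "deg_le ?n f"
    using deg_le_Pi_op[OF e(1)] by (simp add: f deg_le_C_mult add.commute)
  have "u powi (2 - 2 * ?n) = inverse (u ^ (2 * k))"
    using power_int_minus[of u "2 * int k"] power_int_of_nat[of u "2 * k"] by simp
  then have lead_f: "Poly_Mapping.lookup f ?n = 1"
    using e(2) u_nonzero unfolding f lookup_scale lookup_Pi_op by simp
  \<comment> \<open>The coefficient of X^{-(k+1)} in Pi e comes from that of X^{k+2} in e, which is
    beyond its degree.\<close>
  have low_f: "Poly_Mapping.lookup f (- ?n) = 0"
    unfolding f lookup_scale lookup_Pi_op using deg_le_lookup_eq_0[OF e(1), of "1 + ?n"] by simp
  have "inverse (u\<^sup>2 * eigenvalue (- int k)) = eigenvalue ?n"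
    unfolding eigenvalue_of_nat eigenvalue_uminus_of_nat by (simp add: power2_eq_square)
  with eigen_Pi_op[OF e(3) eigenvalue_nonzero] have eig_f: "T f = C (eigenvalue ?n) * flip f"
    by (simp only: f T_C_mult flip_C_mult mult.left_commute)
  define g where "g = E (- ?n)"
  define a where "a = raising_coeff (Suc k)"
  have g: "g = C v * (T f + C a * f)"
    by (simp only: g_def f_def a_def E_neg)
  have deg_g: "deg_le ?n g"
    unfolding g by (intro deg_le_C_mult deg_le_add deg_le_T deg_f)
  have lead_g: "Poly_Mapping.lookup g (- ?n) = 1"
    using lead_f low_f v_nonzero unfolding g lookup_scale lookup_add lookup_T_bottom[OF deg_f]
    by simp
  have inv: "inverse (eigenvalue ?n) * inverse (eigenvalue ?n) = u ^ (4 * Suc k) * v\<^sup>2"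
  proof -
    have "4 * Suc k = 2 * Suc k + 2 * Suc k"
      by simp
    then show ?thesis
      unfolding eigenvalue_of_nat by (simp only: power_add) (simp add: power2_eq_square mult_ac)
  qed
  have "u ^ (4 * Suc k) * v\<^sup>2 \<noteq> 1"
    by (rule u_v_power_neq_1) simp
  then have "T (T f + C a * f) = C (inverse (eigenvalue ?n)) * flip (T f + C a * f)"
    by (intro eigen_T eig_f eigenvalue_nonzero) (simp_all only: inv a_def raising_coeff_def not_False_eq_True)
  moreover have "inverse (eigenvalue ?n) = eigenvalue (- ?n)"
    unfolding eigenvalue_of_nat eigenvalue_uminus_of_nat by simp
  ultimately have "T g = C (eigenvalue (- ?n)) * flip g"
    by (simp only: g T_C_mult flip_C_mult mult.left_commute)
  moreover have "monic ?n f"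
    unfolding monic_def abs_of_nat using deg_f lead_f low_f by (simp del: of_nat_Suc)
  moreover have "monic (- ?n) g"
    unfolding monic_def abs_minus_cancel abs_of_nat using deg_g lead_g by (simp del: of_nat_Suc)
  ultimately show ?case
    using eig_f by (simp only: f_def g_def simp_thms)
qed

lemma int_cases_abs: "(\<And>k. P (int k) \<and> P (- int k)) \<Longrightarrow> P n"
  by (metis int_cases2)

lemma monic_E: "monic n (E n)"
  using E_main by (intro int_cases_abs[where P = "\<lambda>n. monic n (E n)"]) blast

lemma T_E: "T (E n) = C (eigenvalue n) * flip (E n)"
  using E_main by (intro int_cases_abs[where P = "\<lambda>n. T (E n) = C (eigenvalue n) * flip (E n)"]) blast

lemma deg_le_E: "deg_le \<bar>n\<bar> (E n)"
  using monic_E by (simp add: monic_def)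

lemma lookup_E: "Poly_Mapping.lookup (E n) n = 1"
  using monic_E by (simp add: monic_def)

lemma lookup_E_uminus: "n > 0 \<Longrightarrow> Poly_Mapping.lookup (E n) (- n) = 0"
  using monic_E by (simp add: monic_def)

lemma E_triangular:
  assumes "Poly_Mapping.lookup (E n) m \<noteq> 0"
  shows "m = n \<or> mon_less m n"
proof -
  have "\<bar>m\<bar> \<le> \<bar>n\<bar>"
    using deg_le_E assms by (auto simp: deg_le_def)
  moreover have "\<not> (n > 0 \<and> m = - n)"
    using lookup_E_uminus assms by auto
  ultimately show ?thesis
    by (auto simp: mon_less_def)
qed

subsection \<open>Orthogonality\<close>

text \<open>With q = u^4 and t = v^2 this is the product of (t - q^i)/(1 - t q^{i+1}). Only its
  symmetries are used in this part; that the expansion of mu_k^0 has these coefficients is proved in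
  \<open>mu0_coeff_eq_weight\<close>.\<close>

definition weight_nat :: "nat \<Rightarrow> 'k" where
  "weight_nat m = (\<Prod>i<m. (v\<^sup>2 - u ^ (4 * i)) / (1 - v\<^sup>2 * u ^ (4 * Suc i)))"

text \<open>The coefficient of $X^n$ in $\mu_k^0$.\<close>

definition weight :: "int \<Rightarrow> 'k" where
  "weight n = (if odd n then 0 else if n \<ge> 0 then weight_nat (nat (n div 2))
     else u powi (- 2 * n) * weight_nat (nat (- n div 2)))"

lemma weight_even: "weight (2 * int m) = weight_nat m"
  by (simp add: weight_def)

lemma weight_even_uminus: "weight (- (2 * int m)) = u ^ (4 * m) * weight_nat m"
  using power_int_of_nat[of u "4 * m"] by (cases "m = 0") (simp_all add: weight_def)

lemma weight_odd: "odd n \<Longrightarrow> weight n = 0"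
  by (simp add: weight_def)

lemma even_int_cases:
  assumes "even (n::int)"
  obtains m where "n = 2 * int m" | m where "n = - (2 * int m)"
  using assms by (metis evenE int_cases2 mult_minus_right)

text \<open>The coefficient form of invariance under pi, that is, under X -> q^{1/2} X^{-1}.\<close>

lemma weight_uminus: "weight (- n) = u powi (2 * n) * weight n"
proof (cases "even n")
  case True
  then show ?thesis
  proof (cases rule: even_int_cases)
    case (1 m)
    then show ?thesis
      using weight_even_uminus[of m] power_int_of_nat[of u "4 * m"] by (simp add: weight_even)
  next
    case (2 m)
    then show ?thesis
      using weight_even_uminus[of m] power_int_of_nat[of u "4 * m"] power_int_minus[of u "4 * int m"] u_nonzero
      by (simp add: weight_even)
  qed
qed (simp add: weight_odd)

lemma weight_nat_Suc:
  "(1 - v\<^sup>2 * u ^ (4 * Suc i)) * weight_nat (Suc i) = (v\<^sup>2 - u ^ (4 * i)) * weight_nat i"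
proof -
  have "1 - v\<^sup>2 * u ^ (4 * Suc i) \<noteq> 0"
    using u_v_power_neq_1[of "4 * Suc i" 2] by (simp add: mult.commute)
  then show ?thesis
    by (simp add: weight_nat_def)
qed

text \<open>The coefficient form of the antisymmetry of (X^{-1} - t X) mu_k^0 under X -> X^{-1},
  read off at the exponents n + 1 and -(n + 1).\<close>

lemma weight_symmetry:
  "weight (- n) - v\<^sup>2 * weight n = v\<^sup>2 * weight (- n - 2) - weight (n + 2)"
proof (cases "even n")
  case True
  then show ?thesis
  proof (cases rule: even_int_cases)
    case (1 m)
    then have n: "- n - 2 = - (2 * int (Suc m))" "n + 2 = 2 * int (Suc m)" "- n = - (2 * int m)"
      by simp_all
    show ?thesis
      unfolding n(1,2) unfolding n(3) using weight_nat_Suc[of m] unfolding 1 weight_even weight_even_uminus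
      by (simp add: algebra_simps)
  next
    case (2 m)
    show ?thesis
    proof (cases m)
      case 0
      with 2 show ?thesis
        using weight_nat_Suc[of 0] weight_even_uminus[of 1] weight_even[of 1] weight_even[of 0] by (simp add: algebra_simps)
    next
      case (Suc i)
      with 2 have n: "- n - 2 = 2 * int i" "n + 2 = - (2 * int i)" "- n = 2 * int (Suc i)"
        "n = - (2 * int (Suc i))"
        by simp_all
      show ?thesis
        unfolding n(1,2) unfolding n(3) unfolding n(4) using weight_nat_Suc[of i]
        unfolding weight_even weight_even_uminus by (simp add: algebra_simps)
    qed
  qed
qed (simp add: weight_odd)

text \<open>The functional f -> <f mu_k^0>, with values in the coefficient field and without
  reference to series: X^n picks out the coefficient of X^{-n}.\<close>

definition M :: "(int \<Rightarrow>\<^sub>0 'k) \<Rightarrow> 'k" where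
  "M = lext (\<lambda>x. x) (\<lambda>n. weight (- n))"

lemma M_add: "M (f + g) = M f + M g"
  by (simp add: M_def id.lext_add)

lemma M_diff: "M (f - g) = M f - M g"
  by (simp add: M_def id.lext_diff)

lemma M_C_mult: "M (C c * f) = c * M f"
  by (simp add: M_def id.lext_scale)

lemma M_X: "M (X n) = weight (- n)"
  by (simp add: M_def id.lext_single)

lemma M_flip: "M (flip f) = M f"
  by (induction f rule: poly_mapping_single_induct)
    (simp_all add: flip_add M_add, simp add: M_def flip_single id.lext_single, simp add: weight_uminus)

text \<open>With D the divided difference and h = (D f) g - f (D g), one finds T f g - f T g =
  -v^{-1} (1 - t X^2) h and X^{-2} s(h) = h, where s is the inversion of X; the symmetry of \<phi>
  annihilates exactly such expressions. The general \<iota> and \<phi> allow the same proof for the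
  weight with and without the Gaussian.\<close>

lemma T_adjoint:
  fixes \<iota> :: "'k \<Rightarrow> 'r::field" and \<phi> :: "int \<Rightarrow> 'r"
  assumes "field_homomorphism \<iota>"
    and sym: "\<And>n. \<phi> n - \<iota> (v\<^sup>2) * \<phi> (- n) = \<iota> (v\<^sup>2) * \<phi> (n + 2) - \<phi> (- n - 2)"
  shows "lext \<iota> \<phi> (T f * g) = lext \<iota> \<phi> (f * T g)"
proof -
  interpret \<iota>: field_homomorphism \<iota> by fact
  define \<Phi> where "\<Phi> = lext \<iota> \<phi>"
  have \<Phi>: "\<Phi> (f + g) = \<Phi> f + \<Phi> g" "\<Phi> (f - g) = \<Phi> f - \<Phi> g" "\<Phi> (C c * f) = \<iota> c * \<Phi> f"
    "\<Phi> (Poly_Mapping.single n c) = \<iota> c * \<phi> n" for f g :: "int \<Rightarrow>\<^sub>0 'k" and c n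
    by (simp_all add: \<Phi>_def \<iota>.lext_add \<iota>.lext_diff \<iota>.lext_scale \<iota>.lext_single)
  \<comment> \<open>The bracket is X^{-1} times the symmetrization of X h, so this is an
    antisymmetric weight, (X^{-1} - t X) mu, paired with a symmetric polynomial.\<close>
  have antisym: "\<Phi> ((1 - C (v\<^sup>2) * X 2) * (h + X (- 2) * reflect h)) = 0" for h
  proof (induction h rule: poly_mapping_single_induct)
    case (single n c)
    have eq: "(1 - C (v\<^sup>2) * X 2) * (Poly_Mapping.single n c + X (- 2) * reflect (Poly_Mapping.single n c)) =
        Poly_Mapping.single n c + Poly_Mapping.single (- n - 2) c
        - (Poly_Mapping.single (n + 2) (v\<^sup>2 * c) + Poly_Mapping.single (- n) (v\<^sup>2 * c))"
      by (simp add: reflect_single mult_single distrib_left left_diff_distrib add.commute)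
    have "\<iota> c * (\<phi> n + \<phi> (- n - 2) - (\<iota> (v\<^sup>2) * \<phi> (n + 2) + \<iota> (v\<^sup>2) * \<phi> (- n))) = 0"
      using sym[of n] by (simp add: algebra_simps)
    then show ?case
      unfolding eq \<Phi> \<iota>.hom_mult by (simp add: algebra_simps)
  next
    case (add f g)
    have "(1 - C (v\<^sup>2) * X 2) * (f + g + X (- 2) * reflect (f + g)) =
        (1 - C (v\<^sup>2) * X 2) * (f + X (- 2) * reflect f) +
        (1 - C (v\<^sup>2) * X 2) * (g + X (- 2) * reflect g)"
      by (simp only: reflect_add distrib_left) (simp only: ac_simps)
    with add show ?case
      by (simp only: \<Phi> add_0_right)
  qed
  define h where "h = divided_difference f * g - f * divided_difference g"
  have h: "(X 2 - 1) * h = reflect f * g - f * reflect g"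
  proof -
    have "(X 2 - 1) * h = ((X 2 - 1) * divided_difference f) * g - f * ((X 2 - 1) * divided_difference g)"
      by (simp add: h_def algebra_simps)
    then show ?thesis
      unfolding divided_difference_mult by (simp add: algebra_simps)
  qed
  have "(X 2 - 1) * (X (- 2) * reflect h) = - reflect ((X 2 - 1) * h)"
    by (simp add: reflect_mult reflect_diff reflect_single left_diff_distrib mult_single
        flip: single_one mult.assoc)
  also have "\<dots> = (X 2 - 1) * h"
    unfolding h by (simp add: reflect_diff reflect_mult reflect_reflect mult.commute)
  finally have h': "X (- 2) * reflect h = h"
    using X2_minus_1_nonzero by simp
  have "T f * g - f * T g = C v * (reflect f * g - f * reflect g) + C (v - inverse v) * h"
    by (simp add: T_def h_def algebra_simps)
  also have "\<dots> = - (C (inverse v) * ((1 - C (v\<^sup>2) * X 2) * h))"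
  proof -
    have "inverse v * v\<^sup>2 = v"
      using v_nonzero by (simp add: power2_eq_square flip: mult.assoc)
    then have v: "C (inverse v) * C (v\<^sup>2) = C v"
      by (simp add: mult_single)
    have "C (inverse v) * ((1 - C (v\<^sup>2) * X 2) * h) =
        C (inverse v) * h - C (inverse v) * C (v\<^sup>2) * (X 2 * h)"
      by (simp add: algebra_simps)
    moreover have "C v * ((X 2 - 1) * h) = C v * (X 2 * h) - C v * h"
      by (simp add: algebra_simps)
    ultimately show ?thesis
      unfolding h[symmetric] v C.hom_diff by (simp add: left_diff_distrib)
  qed
  finally have 1: "T f * g - f * T g = - (C (inverse v) * ((1 - C (v\<^sup>2) * X 2) * h))" .
  \<comment> \<open>Because X^{-2} s(h) = h, the symmetrized expression is twice the wanted
    one.\<close>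
  have "\<Phi> ((1 - C (v\<^sup>2) * X 2) * h) + \<Phi> ((1 - C (v\<^sup>2) * X 2) * h) = 0"
    using antisym[of h] unfolding h' distrib_left \<Phi>(1) .
  then have "\<iota> 2 * \<Phi> ((1 - C (v\<^sup>2) * X 2) * h) = 0"
    by (metis \<iota>.hom_add \<iota>.hom_one mult_2 one_add_one)
  then have "\<Phi> ((1 - C (v\<^sup>2) * X 2) * h) = 0"
    using two_nonzero by (simp add: \<iota>.hom_eq_0_iff)
  then have "\<Phi> (C (inverse v) * ((1 - C (v\<^sup>2) * X 2) * h)) = 0"
    by (simp only: \<Phi> mult_zero_right)
  then have "\<Phi> (T f * g - f * T g) = 0"
    unfolding 1 \<Phi>_def \<iota>.lext_uminus by simp
  then show ?thesis
    by (simp add: \<Phi>(2) flip: \<Phi>_def)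
qed

lemma M_T: "M (T f * g) = M (f * T g)"
  unfolding M_def
proof (rule T_adjoint)
  show "field_homomorphism (\<lambda>x. x::'k)"
    by unfold_locales
  show "weight (- n) - v\<^sup>2 * weight (- (- n)) = v\<^sup>2 * weight (- (n + 2)) - weight (- (- n - 2))" for n
    using weight_symmetry[of n] by (simp only: minus_minus minus_add_distrib minus_diff_eq add_uminus_conv_diff diff_minus_eq_add add.commute[of 2 n])
qed

lemma M_odd:
  assumes "\<And>m. Poly_Mapping.lookup f m \<noteq> 0 \<Longrightarrow> odd m"
  shows "M f = 0"
  unfolding M_def lext_def using assms by (intro sum.neutral) (auto simp: in_keys_iff weight_odd)

lemma M_mult_eq_sum:
  "M (e * f) = (\<Sum>n\<in>Poly_Mapping.keys f. Poly_Mapping.lookup f n * M (e * X n))"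
proof -
  have f: "(\<Sum>n\<in>Poly_Mapping.keys f. C (Poly_Mapping.lookup f n) * X n) = f"
    by (simp add: mult_single poly_mapping_eq_sum_single[symmetric])
  have "(\<Sum>n\<in>Poly_Mapping.keys f. C (Poly_Mapping.lookup f n) * (e * X n)) =
      e * (\<Sum>n\<in>Poly_Mapping.keys f. C (Poly_Mapping.lookup f n) * X n)"
    by (simp only: sum_distrib_left mult.left_commute)
  then have "e * f = (\<Sum>n\<in>Poly_Mapping.keys f. C (Poly_Mapping.lookup f n) * (e * X n))"
    by (simp only: f)
  then have "M (e * f) = M (\<Sum>n\<in>Poly_Mapping.keys f. C (Poly_Mapping.lookup f n) * (e * X n))"
    by (rule arg_cong)
  then show ?thesis
    by (simp only: M_def id.lext_sum id.lext_scale)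
qed

lemma M_mult_eq_0:
  assumes "\<And>n. Poly_Mapping.lookup f n \<noteq> 0 \<Longrightarrow> M (e * X n) = 0"
  shows "M (e * f) = 0"
  by (subst M_mult_eq_sum) (rule sum.neutral, use assms in \<open>auto simp: in_keys_iff\<close>)

definition orthogonal :: "int \<Rightarrow> (int \<Rightarrow>\<^sub>0 'k) \<Rightarrow> bool" where
  "orthogonal n e \<longleftrightarrow> (\<forall>m. mon_less m n \<longrightarrow> M (e * X (- m)) = 0)"

text \<open>Invariance of the weight under pi converts the pairing of Pi e with X^{-m} into a
  multiple of the pairing of e with X^{m-1}.\<close>

lemma orthogonal_Pi_op:
  fixes k :: nat
  assumes e: "orthogonal (- int k) e" "deg_le (int k) e"
  shows "orthogonal (int (Suc k)) (Pi_op e)"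
    and "M (Pi_op e * X (- int (Suc k))) = inverse (u ^ (2 * k)) * M (e * X (int k))"
proof -
  have shift: "M (Pi_op e * X (- m)) = u powi (2 - 2 * m) * M (e * X (m - 1))" for m
  proof -
    have "Pi_op e * X (- m) = flip e * X (1 - m)"
      by (simp add: Pi_op_def mult_ac) (simp add: mult_single flip: mult.assoc)
    also have "flip (flip e * X (1 - m)) = C (u powi (2 - 2 * m)) * (e * X (m - 1))"
      by (simp add: flip_mult flip_flip flip_single mult.left_commute mult_single)
    finally show ?thesis
      by (metis M_flip M_C_mult)
  qed
  show "orthogonal (int (Suc k)) (Pi_op e)"
    unfolding orthogonal_def
  proof (intro allI impI)
    fix m assume m: "mon_less m (int (Suc k))"
    then have m': "\<bar>m\<bar> \<le> int k"
      by (auto simp: mon_less_def)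
    have "M (e * X (m - 1)) = 0"
    \<comment> \<open>For m = -k the pairing is with X^{-k-1}, which the orthogonality of e does not
      cover; there the product has only odd exponents. For all other m the monomial X^{1-m} precedes
      X^{-k}.\<close>
    proof (cases "m = - int k")
      case True
      show ?thesis
      proof (rule M_odd)
        fix j assume "Poly_Mapping.lookup (e * X (m - 1)) j \<noteq> 0"
        then have "Poly_Mapping.lookup e (j - (m - 1)) \<noteq> 0"
          by (simp add: mult.commute[of e] lookup_single_mult)
        then have "even (j - (m - 1) - int k)"
          using e(2) unfolding deg_le_def by blast
        with True show "odd j"
          by presburger
      qed
    next
      case False
      with m' have "mon_less (1 - m) (- int k)"
        by (auto simp: mon_less_def)
      with e(1) have "M (e * X (- (1 - m))) = 0"
        by (simp only: orthogonal_def)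
      then show ?thesis
        by simp
    qed
    then show "M (Pi_op e * X (- m)) = 0"
      by (simp add: shift)
  qed
  have "u powi (2 - 2 * int (Suc k)) = inverse (u ^ (2 * k))"
    using power_int_minus[of u "2 * int k"] power_int_of_nat[of u "2 * k"] by simp
  then show "M (Pi_op e * X (- int (Suc k))) = inverse (u ^ (2 * k)) * M (e * X (int k))"
    unfolding shift[of "int (Suc k)"] by simp
qed

lemma orthogonal_C_mult: "orthogonal n e \<Longrightarrow> orthogonal n (C c * e)"
  by (simp add: orthogonal_def M_C_mult mult.assoc)

text \<open>Since e is orthogonal to all degrees below n, pairing it with T X^{n} or T X^{-n}
  involves only P = \<open>M (e * X (int n))\<close> and the norm N. The eigenvalue equation
  expresses P through N, and everything becomes a computation with D = w v^2 - 1, w = q^n. The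
  factor in the second claim is what keeps the norms nonzero.\<close>

lemma orthogonal_T:
  fixes n :: nat and e
  assumes n: "n > 0" and e: "orthogonal (int n) e"
    and eig: "T e = C (eigenvalue (int n)) * flip e"
  defines "g \<equiv> C v * (T e + C (raising_coeff n) * e)" and "N \<equiv> M (e * X (- int n))"
    and "w \<equiv> u ^ (4 * n)"
  shows "orthogonal (- int n) g"
    and "M (g * X (int n)) = N * ((w - 1) * (w * v ^ 4 - 1) / (w * v\<^sup>2 - 1)\<^sup>2)"
proof -
  have low: "M (e * f) = 0" if "\<And>j. Poly_Mapping.lookup f j \<noteq> 0 \<Longrightarrow> \<bar>j\<bar> < int n" for f
  proof (rule M_mult_eq_0)
    fix j assume "Poly_Mapping.lookup f j \<noteq> 0"
    then have "mon_less (- j) (int n)"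
      using that by (auto simp: mon_less_def)
    then have "M (e * X (- (- j))) = 0"
      using e unfolding orthogonal_def by blast
    then show "M (e * X j) = 0"
      by simp
  qed
  define P where "P = M (e * X (int n))"
  have T_split: "M (e * T f) = Poly_Mapping.lookup (T f) (int n) * P + Poly_Mapping.lookup (T f) (- int n) * N"
    if f: "deg_le (int n) f" for f
  proof -
    define r where "r = T f - C (Poly_Mapping.lookup (T f) (int n)) * X (int n)
        - C (Poly_Mapping.lookup (T f) (- int n)) * X (- int n)"
    have "M (e * r) = 0"
    proof (rule low)
      fix j assume j: "Poly_Mapping.lookup r j \<noteq> 0"
      have "j \<noteq> int n" "j \<noteq> - int n"
        using j n by (auto simp: r_def lookup_minus lookup_scale lookup_single when_def)
      moreover from this have "Poly_Mapping.lookup (T f) j \<noteq> 0"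
        using j by (simp add: r_def lookup_minus lookup_scale lookup_single)
      then have "\<bar>j\<bar> \<le> int n"
        using deg_le_T[OF f] by (simp add: deg_le_def)
      ultimately show "\<bar>j\<bar> < int n"
        by linarith
    qed
    moreover have "e * r = e * T f - C (Poly_Mapping.lookup (T f) (int n)) * (e * X (int n))
        - C (Poly_Mapping.lookup (T f) (- int n)) * (e * X (- int n))"
      by (simp add: r_def right_diff_distrib mult.left_commute)
    ultimately show ?thesis
      by (simp add: M_diff M_C_mult P_def N_def diff_eq_eq add.commute)
  qed
  have deg: "deg_le (int n) (X (int n) :: int \<Rightarrow>\<^sub>0 'k)" "deg_le (int n) (X (- int n) :: int \<Rightarrow>\<^sub>0 'k)"
    by (auto simp: deg_le_def lookup_single when_def)
  have T_plus: "M (e * T (X (int n))) = inverse v * N"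
    unfolding T_split[OF deg(1)] lookup_T_top[OF deg(1)] lookup_T_bottom[OF deg(1)]
    using n by (simp add: lookup_single when_def)
  have T_minus: "M (e * T (X (- int n))) = v * P + (v - inverse v) * N"
    unfolding T_split[OF deg(2)] lookup_T_top[OF deg(2)] lookup_T_bottom[OF deg(2)]
    using n by (simp add: lookup_single when_def)
  have w0: "w \<noteq> 0" and w2: "w * v\<^sup>2 - 1 \<noteq> 0"
    using u_nonzero u_v_power_neq_1[of "4 * n" 2] by (simp_all add: w_def)
  define \<kappa> where "\<kappa> = eigenvalue (int n)"
  have \<kappa>: "\<kappa> * u powi (- 2 * int n) = inverse (w * v)"
  proof -
    have "eigenvalue (int n) = inverse (u ^ (2 * n)) * inverse v"
      using n eigenvalue_of_nat[of "n - 1"] by simp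
    moreover have "u powi (- 2 * int n) = inverse (u ^ (2 * n))"
      using power_int_minus[of u "2 * int n"] power_int_of_nat[of u "2 * n"] by simp
    moreover have "w = u ^ (2 * n) * u ^ (2 * n)"
      by (simp add: w_def flip: power_add)
    ultimately show ?thesis
      by (simp add: \<kappa>_def mult_ac)
  qed
  \<comment> \<open>The pairing of T e with X^{-n} is computed twice: by adjointness, and by the
    eigenvalue equation followed by invariance under pi.\<close>
  have "v * P + (v - inverse v) * N = M (C \<kappa> * (flip e * X (- int n)))"
    unfolding T_minus[symmetric] M_T[symmetric] eig \<kappa>_def by (simp only: mult.assoc)
  also have "\<dots> = \<kappa> * M (flip (flip e * X (- int n)))"
    by (simp add: M_C_mult M_flip)
  also have "\<dots> = \<kappa> * u powi (- 2 * int n) * P"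
  proof -
    have "flip (flip e * X (- int n)) = C (u powi (- 2 * int n)) * (e * X (int n))"
      by (simp add: flip_mult flip_flip flip_single mult.left_commute mult_single)
    then show ?thesis
      by (simp add: M_C_mult P_def)
  qed
  finally have P_eq: "v * P + (v - inverse v) * N = inverse (w * v) * P"
    by (simp only: \<kappa>)
  define D where "D = w * v\<^sup>2 - 1"
  have D: "D \<noteq> 0"
    using w2 by (simp add: D_def)
  have vv: "v * (v - inverse v) = v\<^sup>2 - 1"
    using v_nonzero by (simp add: right_diff_distrib power2_eq_square)
  have P: "P = - (w * (v\<^sup>2 - 1) * N) / D"
  proof -
    have "P = w * v * (inverse (w * v) * P)"
      using v_nonzero w0 by (simp only: mult.assoc[symmetric] right_inverse no_zero_divisors mult_1_left not_False_eq_True)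
    also have "\<dots> = w * v\<^sup>2 * P + w * (v * (v - inverse v)) * N"
      unfolding P_eq[symmetric] by (simp only: power2_eq_square distrib_left mult_ac)
    finally have "P = w * v\<^sup>2 * P + w * (v\<^sup>2 - 1) * N"
      by (simp only: vv)
    moreover have "P * D = w * v\<^sup>2 * P - P"
      by (simp add: D_def right_diff_distrib mult_ac)
    ultimately have "P * D = - (w * (v\<^sup>2 - 1) * N)"
      by (metis add_diff_cancel_left' minus_diff_eq)
    then show ?thesis
      by (simp only: nonzero_eq_divide_eq[OF D])
  qed
  define a where "a = raising_coeff n"
  have a: "a = (v - inverse v) / D"
    by (simp add: a_def raising_coeff_def w_def D_def)
  have va: "v * a = (v\<^sup>2 - 1) / D"
    by (simp add: a flip: vv)
  have g: "M (g * f) = v * (M (e * T f) + a * M (e * f))" for f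
  proof -
    have "g * f = C v * (T e * f + C a * (e * f))"
      by (simp add: g_def a_def algebra_simps)
    then show ?thesis
      by (simp add: M_C_mult M_add M_T)
  qed
  show "orthogonal (- int n) g"
    unfolding orthogonal_def
  proof (intro allI impI)
    fix m assume "mon_less m (- int n)"
    then consider "\<bar>m\<bar> < int n" | "m = int n"
      by (auto simp: mon_less_def)
    then show "M (g * X (- m)) = 0"
    proof cases
      case 1
      have "deg_le \<bar>m\<bar> (X (- m) :: int \<Rightarrow>\<^sub>0 'k)"
        by (auto simp: deg_le_def lookup_single when_def)
      from deg_le_T[OF this] have "M (e * T (X (- m))) = 0"
        using 1 unfolding deg_le_def by (intro low) (meson le_less_trans)
      moreover have "M (e * X (- m)) = 0"
        using 1 by (intro low) (auto simp: lookup_single when_def split: if_splits)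
      ultimately show ?thesis
        by (simp add: g)
    next
      case 2
      \<comment> \<open>This is the one new condition: X^n precedes X^{-n}, and e pairs with X^n to
        its norm N. The value of a that makes an eigenvector also cancels this pairing.\<close>
      have "v * P + (v - inverse v + a) * N = 0"
      proof -
        have "v - inverse v + a = (v - inverse v) * (D + 1) / D"
          using D by (simp add: a distrib_left add_divide_distrib)
        also have "\<dots> = w * v * (v * (v - inverse v)) / D"
          by (simp add: D_def power2_eq_square mult_ac)
        finally have "v - inverse v + a = w * v * (v\<^sup>2 - 1) / D"
          by (simp only: vv)
        then show ?thesis
          by (simp add: P mult_ac)
      qed
      then show ?thesis
        by (simp add: 2 g T_minus N_def[symmetric] algebra_simps)
    qed
  qed
  have "M (g * X (int n)) = N + v * a * P"
    using v_nonzero by (simp add: g T_plus P_def[symmetric] distrib_left)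
  also have "\<dots> = N * ((w - 1) * (w * v ^ 4 - 1) / (w * v\<^sup>2 - 1)\<^sup>2)"
  proof -
    have "D\<^sup>2 - w * (v\<^sup>2 - 1)\<^sup>2 = (w - 1) * (w * v ^ 4 - 1)"
      by (simp add: D_def algebra_simps power2_eq_square power4_eq_xxxx)
    moreover have "N + z / D * (- (w * z * N) / D) = N * ((D\<^sup>2 - w * z\<^sup>2) / D\<^sup>2)" for z
      using D by (simp add: diff_divide_distrib right_diff_distrib power2_eq_square mult_ac)
    then have "N + v * a * P = N * ((D\<^sup>2 - w * (v\<^sup>2 - 1)\<^sup>2) / D\<^sup>2)"
      by (simp only: va P)
    ultimately show ?thesis
      by (simp only: D_def)
  qed
  finally show "M (g * X (int n)) = N * ((w - 1) * (w * v ^ 4 - 1) / (w * v\<^sup>2 - 1)\<^sup>2)" .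
qed

text \<open>The nonvanishing of the norms is carried along the induction; it is what makes the form
  nondegenerate and the e_n unique.\<close>

lemma E_main_orthogonal:
  "orthogonal (int k) (E (int k)) \<and> M (E (int k) * X (- int k)) \<noteq> 0 \<and>
   orthogonal (- int k) (E (- int k)) \<and> M (E (- int k) * X (int k)) \<noteq> 0"
proof (induction k)
  case 0
  have "\<not> mon_less m 0" for m
    by (auto simp: mon_less_def)
  moreover have "M 1 = 1"
    using M_X[of 0] by (simp add: weight_def weight_nat_def)
  ultimately show ?case
    by (simp add: E_0 orthogonal_def)
next
  case (Suc k)
  let ?n = "int (Suc k)"
  note e = Suc.IH[THEN conjunct2, THEN conjunct2]
  have deg: "deg_le (int k) (E (- int k))"
    using deg_le_E[of "- int k"] by simp
  have orth: "orthogonal ?n (E ?n)"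
    unfolding E_pos using orthogonal_Pi_op(1)[OF _ deg] e by (intro orthogonal_C_mult) blast
  have "M (E ?n * X (- ?n)) = u ^ (2 * k) * M (Pi_op (E (- int k)) * X (- ?n))"
    unfolding E_pos mult.assoc by (rule M_C_mult)
  also have "\<dots> = M (E (- int k) * X (int k))"
    using orthogonal_Pi_op(2)[OF _ deg] e u_nonzero by simp
  finally have norm: "M (E ?n * X (- ?n)) \<noteq> 0"
    using e by simp
  have neg: "orthogonal (- ?n) (E (- ?n))" "M (E (- ?n) * X ?n) =
      M (E ?n * X (- ?n)) * ((u ^ (4 * Suc k) - 1) * (u ^ (4 * Suc k) * v ^ 4 - 1)
        / (u ^ (4 * Suc k) * v\<^sup>2 - 1)\<^sup>2)"
    unfolding E_neg by (rule orthogonal_T[OF zero_less_Suc orth T_E])+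
  moreover have "u ^ (4 * Suc k) \<noteq> 1" "u ^ (4 * Suc k) * v ^ 4 \<noteq> 1" "u ^ (4 * Suc k) * v\<^sup>2 \<noteq> 1"
    using u_power_neq_1[of "4 * Suc k"] u_v_power_neq_1[of "4 * Suc k"] by simp_all
  ultimately have "M (E (- ?n) * X ?n) \<noteq> 0"
    using norm by simp
  with orth norm neg(1) show ?case
    by blast
qed

lemma orthogonal_E: "orthogonal n (E n)"
  using E_main_orthogonal by (intro int_cases_abs[where P = "\<lambda>n. orthogonal n (E n)"]) blast

lemma norm_E_nonzero: "M (E n * X (- n)) \<noteq> 0"
  using E_main_orthogonal by (intro int_cases_abs[where P = "\<lambda>n. M (E n * X (- n)) \<noteq> 0"]) simp

text \<open>The position of an integer in the enumeration $0, 1, -1, 2, -2, \dots$ by \<open>mon_less\<close>.\<close>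

definition rank :: "int \<Rightarrow> nat" where
  "rank n = (if n > 0 then 2 * nat n - 1 else 2 * nat (- n))"

lemma mon_less_iff_rank: "mon_less m n \<longleftrightarrow> rank m < rank n"
  by (auto simp: mon_less_def rank_def)

lemma even_rank: "even (rank n) \<longleftrightarrow> n \<le> 0"
  by (simp add: rank_def)

lemma inj_rank: "rank m = rank n \<longleftrightarrow> m = n"
proof
  assume eq: "rank m = rank n"
  then have "m \<le> 0 \<longleftrightarrow> n \<le> 0"
    by (simp flip: even_rank)
  with eq show "m = n"
    by (auto simp: rank_def split: if_splits)
qed simp

lemma surj_rank: obtains n where "rank n = k"
proof (cases "even k")
  case True
  then show ?thesis
    by (intro that[of "- int (k div 2)"]) (auto simp: rank_def)
next
  case False
  then show ?thesis
    by (intro that[of "int ((k + 1) div 2)"]) (auto simp: rank_def elim!: oddE)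
qed

text \<open>Nondegeneracy on each initial segment of the order, by elimination: subtracting a
  multiple of the highest E_n shortens the segment, and the nonzero norm of E_n then forces the
  coefficient to vanish.\<close>

lemma M_nondegenerate:
  assumes "\<And>j. Poly_Mapping.lookup f j \<noteq> 0 \<Longrightarrow> rank j < k"
    and "\<And>j. rank j < k \<Longrightarrow> M (f * X (- j)) = 0"
  shows "f = 0"
  using assms
proof (induction k arbitrary: f)
  case 0
  then show ?case
    by (intro poly_mapping_eqI) auto
next
  case (Suc k)
  obtain n where n: "rank n = k"
    by (rule surj_rank)
  define c where "c = Poly_Mapping.lookup f n"
  have "f - C c * E n = 0"
  proof (rule Suc.IH)
    fix j assume j: "Poly_Mapping.lookup (f - C c * E n) j \<noteq> 0"
    then have "j \<noteq> n"
      by (auto simp: lookup_minus lookup_scale lookup_E c_def)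
    then have "rank j \<noteq> k"
      using n inj_rank by auto
    moreover have "Poly_Mapping.lookup f j \<noteq> 0 \<or> Poly_Mapping.lookup (E n) j \<noteq> 0"
      using j by (auto simp: lookup_minus lookup_scale)
    then have "rank j < Suc k"
      using Suc.prems(1) E_triangular[of n j] \<open>j \<noteq> n\<close> n by (auto simp: mon_less_iff_rank)
    ultimately show "rank j < k"
      by simp
  next
    fix j assume j: "rank j < k"
    then have "M (E n * X (- j)) = 0"
      using orthogonal_E[of n] n by (simp add: orthogonal_def mon_less_iff_rank)
    then show "M ((f - C c * E n) * X (- j)) = 0"
      using Suc.prems(2)[of j] j by (simp add: left_diff_distrib M_diff mult.assoc M_C_mult)
  qed
  then have f: "f = C c * E n"
    by simp
  have "M (f * X (- n)) = 0"
    using Suc.prems(2) n by simp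
  then have "c * M (E n * X (- n)) = 0"
    by (simp add: f mult.assoc M_C_mult)
  then show ?case
    using norm_E_nonzero by (simp add: f)
qed

text \<open>Two candidates share their leading term, so the difference lies in the segment to which
  it is orthogonal.\<close>

lemma E_unique:
  assumes "Poly_Mapping.lookup e n = 1"
    and "\<And>m. Poly_Mapping.lookup e m \<noteq> 0 \<Longrightarrow> m = n \<or> mon_less m n"
    and "\<And>m. mon_less m n \<Longrightarrow> M (e * X (- m)) = 0"
  shows "e = E n"
proof -
  have "e - E n = 0"
  proof (rule M_nondegenerate)
    fix j assume j: "Poly_Mapping.lookup (e - E n) j \<noteq> 0"
    then have "j \<noteq> n"
      using assms(1) by (auto simp: lookup_minus lookup_E)
    moreover have "Poly_Mapping.lookup e j \<noteq> 0 \<or> Poly_Mapping.lookup (E n) j \<noteq> 0"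
      using j by (auto simp: lookup_minus)
    ultimately show "rank j < rank n"
      using assms(2)[of j] E_triangular[of n j] by (auto simp: mon_less_iff_rank)
  next
    fix j assume "rank j < rank n"
    then show "M ((e - E n) * X (- j)) = 0"
      using assms(3)[of j] orthogonal_E[of n]
      by (simp add: left_diff_distrib M_diff mon_less_iff_rank orthogonal_def)
  qed
  then show ?thesis
    by simp
qed

section \<open>Evaluation and the nonvanishing of e_n at t^{-1/2}\<close>

definition ev :: "'k \<Rightarrow> (int \<Rightarrow>\<^sub>0 'k) \<Rightarrow> 'k" where
  "ev x = lext (\<lambda>c. c) (\<lambda>n. x powi n)"

lemma ev_add: "ev x (f + g) = ev x f + ev x g"
  by (simp add: ev_def id.lext_add)

lemma ev_diff: "ev x (f - g) = ev x f - ev x g"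
  by (simp add: ev_def id.lext_diff)

lemma ev_C_mult: "ev x (C c * f) = c * ev x f"
  by (simp add: ev_def id.lext_scale)

lemma ev_single: "ev x (Poly_Mapping.single n c) = c * x powi n"
  by (simp add: ev_def id.lext_single)

lemma ev_mult: "x \<noteq> 0 \<Longrightarrow> ev x (f * g) = ev x f * ev x g"
  unfolding ev_def by (rule id.lext_mult) (simp add: power_int_add)

lemma ev_1: "ev x 1 = 1"
  using ev_single[of x 0 1] by simp

text \<open>At X = v^{-1} the coefficient v X^2 - v^{-1} of \<open>reflect f\<close> in
  \<open>T_mult\<close> vanishes, so T acts on the value by a scalar.\<close>

lemma ev_T: "ev (inverse v) (T f) = v * ev (inverse v) f"
proof -
  let ?x = "inverse v"
  have x: "?x \<noteq> 0" "?x powi 2 - 1 \<noteq> 0"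
    using v_nonzero v_power_neq_1[of 2] by (simp_all add: power_inverse)
  have "(?x powi 2 - 1) * ev ?x (T f) = ev ?x ((X 2 - 1) * T f)"
    using x(1) by (simp add: ev_mult ev_diff ev_single ev_1)
  also have "\<dots> = (v * ?x powi 2 - ?x) * ev ?x (reflect f) - (v - ?x) * ev ?x f"
    unfolding T_mult using x(1) by (simp add: ev_mult ev_diff ev_single)
  also have "\<dots> = (?x powi 2 - 1) * (v * ev ?x f)"
    using v_nonzero by (simp add: power2_eq_square field_simps)
  finally show ?thesis
    using x(2) by simp
qed

text \<open>This justifies dividing by the value in the normalization. From E_{-k} to E_{k+1}, the
  eigenvalue equation evaluated at t^{-1/2} shows that pi E_{-k} does not vanish there.\<close>

lemma ev_E_nonzero_of_nat: "ev (inverse v) (E (int k)) \<noteq> 0 \<and> ev (inverse v) (E (- int k)) \<noteq> 0"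
proof (induction k)
  case 0
  then show ?case
    by (simp add: E_0 ev_1)
next
  case (Suc k)
  let ?x = "inverse v" and ?e = "E (- int k)" and ?f = "E (int (Suc k))"
  have "v * ev ?x ?e = eigenvalue (- int k) * ev ?x (flip ?e)"
    unfolding ev_T[symmetric] T_E ev_C_mult ..
  then have "ev ?x (flip ?e) \<noteq> 0"
    using Suc v_nonzero by auto
  then have f: "ev ?x ?f \<noteq> 0"
    unfolding E_pos ev_C_mult Pi_op_def using u_nonzero v_nonzero by (simp add: ev_mult ev_single)
  have w: "u ^ (4 * Suc k) * v\<^sup>2 - 1 \<noteq> 0" "u ^ (4 * Suc k) * v ^ 4 - 1 \<noteq> 0"
    using u_v_power_neq_1[of "4 * Suc k"] by simp_all
  \<comment> \<open>The factor by which the value changes from E_{k+1} to E_{-k-1}.\<close>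
  have "v * (v + raising_coeff (Suc k)) = (u ^ (4 * Suc k) * v ^ 4 - 1) / (u ^ (4 * Suc k) * v\<^sup>2 - 1)"
    unfolding raising_coeff_def using w(1) v_nonzero
    by (simp add: field_simps power2_eq_square power4_eq_xxxx)
  then have "v * (v + raising_coeff (Suc k)) \<noteq> 0"
    using w by simp
  moreover have "ev ?x (E (- int (Suc k))) = v * (v + raising_coeff (Suc k)) * ev ?x ?f"
    unfolding E_neg ev_C_mult ev_add ev_T by (simp add: algebra_simps)
  ultimately show ?case
    using f by simp
qed

lemma ev_E_nonzero: "ev (inverse v) (E n) \<noteq> 0"
  using ev_E_nonzero_of_nat by (intro int_cases_abs[where P = "\<lambda>n. ev (inverse v) (E n) \<noteq> 0"]) blast

text \<open>For $N > 0$ this is the span of $e_N$ and $e_{-N}$, but it is visibly stable under the bar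
  involution.\<close>

definition level :: "int \<Rightarrow> (int \<Rightarrow>\<^sub>0 'k) \<Rightarrow> bool" where
  "level N f \<longleftrightarrow> deg_le N f \<and> (\<forall>j. \<bar>j\<bar> < N \<longrightarrow> M (f * X j) = 0)"

lemma level_E: "level \<bar>n\<bar> (E n)"
proof -
  have "M (E n * X j) = 0" if "\<bar>j\<bar> < \<bar>n\<bar>" for j
  proof -
    have "mon_less (- j) n"
      using that by (simp add: mon_less_def)
    then have "M (E n * X (- (- j))) = 0"
      using orthogonal_E unfolding orthogonal_def by blast
    then show ?thesis
      by simp
  qed
  then show ?thesis
    by (simp add: level_def deg_le_E)
qed

lemma level_C_mult: "level N f \<Longrightarrow> level N (C c * f)"
  by (simp add: level_def deg_le_C_mult mult.assoc M_C_mult)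

text \<open>Self-adjointness moves T onto the monomial, whose degree T does not raise.\<close>

lemma level_T:
  assumes "level N f"
  shows "level N (T f)"
  unfolding level_def
proof (intro conjI allI impI)
  show "deg_le N (T f)"
    using assms by (simp add: level_def deg_le_T)
next
  fix j assume j: "\<bar>j\<bar> < N"
  have "deg_le \<bar>j\<bar> (X j :: int \<Rightarrow>\<^sub>0 'k)"
    by (auto simp: deg_le_def lookup_single when_def)
  then have T_deg: "deg_le \<bar>j\<bar> (T (X j :: int \<Rightarrow>\<^sub>0 'k))"
    by (rule deg_le_T)
  have "M (f * T (X j)) = 0"
  proof (rule M_mult_eq_0)
    fix i assume "Poly_Mapping.lookup (T (X j :: int \<Rightarrow>\<^sub>0 'k)) i \<noteq> 0"
    then have "\<bar>i\<bar> \<le> \<bar>j\<bar>"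
      using T_deg unfolding deg_le_def by blast
    with j have "\<bar>i\<bar> < N"
      by (rule order.strict_trans1[rotated])
    then show "M (f * X i) = 0"
      using assms unfolding level_def by blast
  qed
  then show "M (T f * X j) = 0"
    by (simp only: M_T)
qed

text \<open>Removing the two extreme coefficients leaves a polynomial that lies in the span of the
  lower monomials and is orthogonal to all of them.\<close>

lemma level_span:
  assumes "level (int (Suc k)) f"
  obtains a b where "f = C a * E (int (Suc k)) + C b * E (- int (Suc k))"
proof -
  let ?n = "int (Suc k)"
  \<comment> \<open>The exponent -n is treated before n because E_n has no term X^{-n}, while E_{-n}
    may have a term X^n.\<close>
  define b where "b = Poly_Mapping.lookup f (- ?n)"
  define a where "a = Poly_Mapping.lookup f ?n - b * Poly_Mapping.lookup (E (- ?n)) ?n"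
  define g where "g = f - (C a * E ?n + C b * E (- ?n))"
  have lev: "level ?n (E ?n)" "level ?n (E (- ?n))"
    using level_E[of ?n] level_E[of "- ?n"] by (simp_all only: abs_minus_cancel abs_of_nat)
  have lookup_g: "Poly_Mapping.lookup g j = Poly_Mapping.lookup f j
      - (a * Poly_Mapping.lookup (E ?n) j + b * Poly_Mapping.lookup (E (- ?n)) j)" for j
    by (simp add: g_def lookup_minus lookup_add lookup_scale)
  have rank_less: "rank j < rank ?n \<longleftrightarrow> \<bar>j\<bar> < ?n" for j
    unfolding mon_less_iff_rank[symmetric] by (auto simp: mon_less_def)
  have "g = 0"
  proof (rule M_nondegenerate)
    fix j assume j: "Poly_Mapping.lookup g j \<noteq> 0"
    have "Poly_Mapping.lookup g ?n = 0"
      unfolding lookup_g by (simp only: lookup_E a_def) simp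
    moreover have "Poly_Mapping.lookup g (- ?n) = 0"
      unfolding lookup_g using lookup_E[of "- ?n"] lookup_E_uminus[of ?n] by (simp add: b_def)
    moreover have "\<bar>j\<bar> \<le> ?n"
    proof (rule ccontr)
      assume "\<not> \<bar>j\<bar> \<le> ?n"
      then have zero: "Poly_Mapping.lookup h j = 0" if "level ?n h" for h
        using that deg_le_lookup_eq_0 unfolding level_def by (meson not_le)
      have "Poly_Mapping.lookup g j = 0"
        unfolding lookup_g zero[OF assms] zero[OF lev(1)] zero[OF lev(2)] by simp
      with j show False ..
    qed
    ultimately show "rank j < rank ?n"
      using j unfolding rank_less by (cases "j = ?n"; cases "j = - ?n") auto
  next
    fix j assume "rank j < rank ?n"
    then have "\<bar>- j\<bar> < ?n"
      by (simp only: rank_less abs_minus_cancel)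
    then have "M (f * X (- j)) = 0" "M (E ?n * X (- j)) = 0" "M (E (- ?n) * X (- j)) = 0"
      using lev assms unfolding level_def by blast+
    then show "M (g * X (- j)) = 0"
      by (simp add: g_def left_diff_distrib distrib_right M_diff M_add mult.assoc M_C_mult)
  qed
  then show ?thesis
    by (intro that[of a b]) (simp add: g_def)
qed

lemma level_0:
  assumes "level 0 f"
  obtains c where "f = C c"
proof
  show "f = C (Poly_Mapping.lookup f 0)"
  proof (rule poly_mapping_eqI)
    fix j
    show "Poly_Mapping.lookup f j = Poly_Mapping.lookup (C (Poly_Mapping.lookup f 0)) j"
      using assms deg_le_lookup_eq_0[of 0 f j] by (cases "j = 0") (auto simp: level_def lookup_single)
  qed
qed

lemma level_of_nat_cases:
  assumes "level (int k) f"
  obtains a b where "f = C a * E (int k) + C b * E (- int k)"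
proof (cases k)
  case 0
  then obtain c where "f = C c"
    using assms level_0 by auto
  then show ?thesis
    using 0 by (intro that[of c 0]) (simp add: E_0)
next
  case (Suc j)
  then show ?thesis
    using assms that level_span by blast
qed

subsection \<open>Gaussian functionals\<close>

text \<open>The claimed value of F on level k, with Gaussian factor q^{k^2/4} t^{k/2}. For fixed k
  the condition is linear in f, so it need only be checked on E_k and E_{-k}.\<close>

definition good :: "('k \<Rightarrow> 'r::field) \<Rightarrow> 'k \<Rightarrow> ((int \<Rightarrow>\<^sub>0 'k) \<Rightarrow> 'r) \<Rightarrow> nat \<Rightarrow> (int \<Rightarrow>\<^sub>0 'k) \<Rightarrow> bool" where
  "good \<iota> x F k f \<longleftrightarrow> F f = \<iota> (u ^ (k\<^sup>2) * v ^ k * ev x f) * F 1"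

text \<open>Since $X^{-1} = T X T$, an eigenvector $e$ of $\pi T$ satisfies $X^{-1} e = \kappa T \Pi e$. Hence
  the values $F(e_m)$ obey the recursion of the values of the $e_m$ at $\kappa^{-1}$, up to the
  Gaussian factors.\<close>

lemma functional_eq_evaluation:
  fixes \<iota> :: "'k \<Rightarrow> 'r::field"
  assumes "field_homomorphism \<iota>"
    and F_add: "\<And>f g. F (f + g) = F f + F g"
    and F_scale: "\<And>c f. F (C c * f) = \<iota> c * F f"
    and F_T: "\<And>f. F (T (Pi_op f)) = \<iota> (u * \<kappa>) * F f" and \<kappa>: "\<kappa> \<noteq> 0"
    and f: "level (int k) f"
  shows "F f = \<iota> (u ^ (k\<^sup>2) * v ^ k * ev (inverse \<kappa>) f) * F 1"
proof -
  interpret \<iota>: field_homomorphism \<iota> by fact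
  let ?x = "inverse \<kappa>"
  let ?good = "good \<iota> ?x F"
  have x: "?x \<noteq> 0"
    using \<kappa> by simp
  have good_add: "?good k (f + g)" if "?good k f" "?good k g" for k f g
    using that by (simp add: good_def F_add ev_add distrib_left distrib_right \<iota>.hom_add)
  have good_scale: "?good k (C c * f)" if "?good k f" for k c f
    using that by (simp add: good_def F_scale ev_C_mult \<iota>.hom_mult)
  have good_unscale: "?good k f" if "?good k (C c * f)" "c \<noteq> 0" for k c f
    using good_scale[OF that(1), of "inverse c"] that(2) by (simp add: mult_single flip: mult.assoc)
  \<comment> \<open>X^{-1} e = \<kappa>_m T Pi e, evaluated at X = \<kappa>^{-1}, where X^{-1} has
    the value \<kappa>.\<close>
  have key: "\<kappa> * ev ?x e = eigenvalue m * ev ?x (T (Pi_op e))" if "T e = C (eigenvalue m) * flip e" for e m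
  proof -
    have "X (- 1) * e = T (X 1 * T e)"
      by (simp only: T_X_T)
    also have "\<dots> = C (eigenvalue m) * T (Pi_op e)"
      unfolding that mult.left_commute[of "X 1"] T_C_mult Pi_op_def ..
    finally have "ev ?x (X (- 1) * e) = eigenvalue m * ev ?x (T (Pi_op e))"
      by (simp only: ev_C_mult)
    then show ?thesis
      using x by (simp add: ev_mult ev_single power_int_minus)
  qed
  have main: "?good k (E (int k)) \<and> ?good k (E (- int k))" for k
  proof (induction k)
    case 0
    then show ?case
      by (simp add: good_def E_0 ev_1 \<iota>.hom_one)
  next
    case (Suc k)
    let ?e = "E (- int k)" and ?f = "E (int (Suc k))"
    have g: "u ^ ((Suc k)\<^sup>2) * v ^ Suc k = u ^ (k\<^sup>2) * v ^ k * (u * (u ^ (2 * k) * v))"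
    proof -
      have "(Suc k)\<^sup>2 = k\<^sup>2 + 2 * k + 1"
        by (simp add: power2_eq_square)
      then show ?thesis
        by (simp only: power_add) (simp add: mult_ac)
    qed
    \<comment> \<open>E_{-k} is an eigenvector of pi T and not of T, so T E_{-k} is only known to be
      a combination of E_k and E_{-k}; both are covered by the induction hypothesis.\<close>
    have "level (int k) (T ?e)"
      using level_T level_E[of "- int k"] by simp
    then obtain a b where "T ?e = C a * E (int k) + C b * E (- int k)"
      by (rule level_of_nat_cases)
    then have good_T: "?good k (T ?e)"
      using Suc by (simp add: good_add good_scale)
    have Pi_f: "Pi_op ?f = C (u ^ (2 * k) * u\<^sup>2) * ?e"
      unfolding E_pos Pi_op_C_mult Pi_op_Pi_op by (simp add: mult_single flip: mult.assoc)
    have T_Pi_f: "T (Pi_op ?f) = C (u ^ (2 * k) * u\<^sup>2) * T ?e"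
      unfolding Pi_f T_C_mult ..
    \<comment> \<open>Pi E_{k+1} is a multiple of E_{-k}, so the functional relation at E_{k+1}
      leads back to level k.\<close>
    have "\<iota> (u * \<kappa>) * F ?f = \<iota> (u ^ (k\<^sup>2) * v ^ k * ev ?x (T (Pi_op ?f))) * F 1"
      using good_scale[OF good_T] unfolding F_T[symmetric] T_Pi_f good_def .
    also have "ev ?x (T (Pi_op ?f)) = (u ^ (2 * Suc k) * v) * (\<kappa> * ev ?x ?f)"
    proof -
      have pv: "p * v * (inverse p * inverse v * y) = y" if "p \<noteq> 0" for p y :: 'k
        using that v_nonzero by (simp add: field_simps)
      have "u ^ (2 * Suc k) \<noteq> 0"
        using u_nonzero by simp
      then show ?thesis
        unfolding key[OF T_E] eigenvalue_of_nat by (simp only: pv not_False_eq_True)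
    qed
    also have "u ^ (k\<^sup>2) * v ^ k * ((u ^ (2 * Suc k) * v) * (\<kappa> * ev ?x ?f)) =
        u * \<kappa> * (u ^ ((Suc k)\<^sup>2) * v ^ Suc k * ev ?x ?f)"
      unfolding g by (simp add: power2_eq_square mult_ac)
    finally have "?good (Suc k) ?f"
      unfolding good_def using u_nonzero \<kappa> by (simp add: \<iota>.hom_mult \<iota>.hom_eq_0_iff mult.assoc)
    moreover have "?good (Suc k) (T ?f)"
    proof -
      have Tf: "T ?f = C (u ^ (2 * k)) * T (Pi_op ?e)"
        unfolding E_pos T_C_mult ..
      \<comment> \<open>In the other direction T E_{k+1} is a multiple of T Pi E_{-k}, whose value
        follows from the relation at E_{-k}. Together with E_{k+1} it spans E_{-k-1}.\<close>
      have "F (T (Pi_op ?e)) = \<iota> (u * \<kappa>) * (\<iota> (u ^ (k\<^sup>2) * v ^ k * ev ?x ?e) * F 1)"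
        using Suc F_T by (simp add: good_def)
      also have "\<dots> = \<iota> (u ^ (k\<^sup>2) * v ^ k * u * (\<kappa> * ev ?x ?e)) * F 1"
        by (simp add: \<iota>.hom_mult mult_ac)
      also have "\<kappa> * ev ?x ?e = u ^ (2 * k) * v * ev ?x (T (Pi_op ?e))"
        unfolding key[OF T_E] eigenvalue_uminus_of_nat ..
      also have "u ^ (k\<^sup>2) * v ^ k * u * (u ^ (2 * k) * v * ev ?x (T (Pi_op ?e))) =
          u ^ ((Suc k)\<^sup>2) * v ^ Suc k * ev ?x (T (Pi_op ?e))"
        unfolding g by (simp only: mult_ac)
      finally have "?good (Suc k) (T (Pi_op ?e))"
        by (simp only: good_def)
      then show ?thesis
        unfolding Tf by (rule good_scale)
    qed
    ultimately have "?good (Suc k) (E (- int (Suc k)))"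
      unfolding E_neg by (intro good_scale good_add)
    with \<open>?good (Suc k) ?f\<close> show ?case
      by blast
  qed
  obtain a b where "f = C a * E (int k) + C b * E (- int k)"
    using f by (rule level_of_nat_cases)
  then have "?good k f"
    using main by (simp add: good_add good_scale)
  then show ?thesis
    by (simp add: good_def)
qed

text \<open>Here \<phi> n plays the role of <X^n times Gaussian times mu_k^0>. The first relation is
  the antisymmetry of the weight, which a factor symmetric under X -> X^{-1} preserves; the second
  says that pi multiplies the weight by u^{-1} X. Hence \<Phi>(Pi f) = u \<Phi>(f), and adjointness
  of T with the eigenvalue of E_n supplies the remaining factor.\<close>

lemma gaussian_functional:
  fixes \<iota> :: "'k \<Rightarrow> 'r::field" and \<phi> :: "int \<Rightarrow> 'r"
  assumes hom: "field_homomorphism \<iota>"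
    and sym: "\<And>n. \<phi> n - \<iota> (v\<^sup>2) * \<phi> (- n) = \<iota> (v\<^sup>2) * \<phi> (n + 2) - \<phi> (- n - 2)"
    and shift: "\<And>n. \<iota> (u powi (2 * n)) * \<phi> (- n) = \<iota> (inverse u) * \<phi> (n + 1)"
    and f: "level (int k) f"
  shows "lext \<iota> \<phi> (E n * f) =
    \<iota> (u ^ (k\<^sup>2) * v ^ k * ev (inverse (eigenvalue n)) f) * lext \<iota> \<phi> (E n)"
proof -
  interpret \<iota>: field_homomorphism \<iota> by fact
  define \<Phi> where "\<Phi> = lext \<iota> \<phi>"
  have flip: "\<Phi> (flip f) = \<iota> (inverse u) * \<Phi> (X 1 * f)" for f
  proof (induction f rule: poly_mapping_single_induct)
    case (single n c)
    show ?case
      using shift[of n]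
      by (simp add: \<Phi>_def flip_single mult_single \<iota>.lext_single \<iota>.hom_mult mult.assoc add.commute
          mult.left_commute[of "\<iota> (inverse u)"])
  qed (simp add: \<Phi>_def flip_add \<iota>.lext_add distrib_left)
  have Pi: "\<Phi> (Pi_op f) = \<iota> u * \<Phi> f" for f
  proof -
    have "flip (Pi_op f) = C (u\<^sup>2) * (X (- 1) * f)"
      by (rule flip_Pi_op)
    then have "\<Phi> (Pi_op f) = \<Phi> (flip (C (u\<^sup>2) * (X (- 1) * f)))"
      by (metis flip_flip)
    also have "\<dots> = \<iota> (inverse u) * \<Phi> (C (u\<^sup>2) * (X 1 * (X (- 1) * f)))"
      by (simp only: flip mult.left_commute)
    also have "X 1 * (X (- 1) * f) = f"
      by (simp add: mult_single flip: mult.assoc)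
    also have "\<iota> (inverse u) * \<Phi> (C (u\<^sup>2) * f) = \<iota> (inverse u * u\<^sup>2) * \<Phi> f"
      by (simp add: \<Phi>_def \<iota>.lext_scale \<iota>.hom_mult)
    also have "inverse u * u\<^sup>2 = u"
      using u_nonzero by (simp add: power2_eq_square flip: mult.assoc)
    finally show ?thesis .
  qed
  have "\<Phi> (E n * T (Pi_op f)) = \<iota> (u * eigenvalue n) * \<Phi> (E n * f)" for f
  proof -
    have "\<Phi> (E n * T (Pi_op f)) = \<Phi> (C (eigenvalue n) * Pi_op (E n * f))"
      using T_adjoint[of \<iota> \<phi>, OF hom sym, of "E n" "Pi_op f"]
      by (simp add: \<Phi>_def T_E Pi_op_def flip_mult mult_ac)
    then show ?thesis
      by (simp add: \<Phi>_def \<iota>.lext_scale Pi[unfolded \<Phi>_def] \<iota>.hom_mult)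
  qed
  moreover have "\<Phi> (E n * (f + g)) = \<Phi> (E n * f) + \<Phi> (E n * g)" for f g
    by (simp add: \<Phi>_def distrib_left \<iota>.lext_add)
  moreover have "\<Phi> (E n * (C c * f)) = \<iota> c * \<Phi> (E n * f)" for c f
    by (simp add: \<Phi>_def mult.left_commute[of "E n"] \<iota>.lext_scale)
  ultimately have "\<Phi> (E n * f) = \<iota> (u ^ (k\<^sup>2) * v ^ k * ev (inverse (eigenvalue n)) f) * \<Phi> (E n * 1)"
    using functional_eq_evaluation[OF hom, of "\<lambda>f. \<Phi> (E n * f)" "eigenvalue n" k f] f eigenvalue_nonzero
    by blast
  then show ?thesis
    by (simp add: \<Phi>_def)
qed

text \<open>The previous lemma is used twice: for f against E_n, and for E_n, as an element of level
  |n|, against E_0 = 1. The evaluation point for n = 0 is t^{-1/2}, exactly the normalizing point,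
  so the value of E_n cancels.\<close>

theorem gaussian_functional_E:
  fixes \<iota> :: "'k \<Rightarrow> 'r::field" and \<phi> :: "int \<Rightarrow> 'r"
  assumes hom: "field_homomorphism \<iota>"
    and sym: "\<And>n. \<phi> n - \<iota> (v\<^sup>2) * \<phi> (- n) = \<iota> (v\<^sup>2) * \<phi> (n + 2) - \<phi> (- n - 2)"
    and shift: "\<And>n. \<iota> (u powi (2 * n)) * \<phi> (- n) = \<iota> (inverse u) * \<phi> (n + 1)"
    and f: "level \<bar>m\<bar> f"
  shows "lext \<iota> \<phi> (C (inverse (ev (inverse v) (E n))) * E n * f) =
    \<iota> (u powi (m\<^sup>2 + n\<^sup>2) * v powi (\<bar>m\<bar> + \<bar>n\<bar>) * ev (inverse (eigenvalue n)) f) * \<phi> 0"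
proof -
  interpret \<iota>: field_homomorphism \<iota> by fact
  define c where "c = inverse (ev (inverse v) (E n))"
  have c: "c * ev (inverse v) (E n) = 1"
    using ev_E_nonzero by (simp add: c_def)
  define g where "g m = u ^ ((nat \<bar>m\<bar>)\<^sup>2) * v ^ nat \<bar>m\<bar>" for m
  have g: "g m = u powi (m\<^sup>2) * v powi \<bar>m\<bar>" for m
  proof -
    have "int ((nat \<bar>m\<bar>)\<^sup>2) = m\<^sup>2"
      by simp
    then show ?thesis
      unfolding g_def by (metis abs_ge_zero int_nat_eq power_int_of_nat)
  qed
  have "lext \<iota> \<phi> (E n * f) = \<iota> (g m * ev (inverse (eigenvalue n)) f) * lext \<iota> \<phi> (E n)"
    using gaussian_functional[OF hom sym shift, of "nat \<bar>m\<bar>" f n] f by (simp add: g_def)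
  moreover have "lext \<iota> \<phi> (E n) = \<iota> (g n * ev (inverse v) (E n)) * lext \<iota> \<phi> 1"
    using gaussian_functional[OF hom sym shift, of "nat \<bar>n\<bar>" "E n" 0] level_E[of n]
    by (simp add: g_def E_0 eigenvalue_def)
  moreover have "lext \<iota> \<phi> 1 = \<phi> 0"
    using \<iota>.lext_single[of \<phi> 0 1] by (simp add: \<iota>.hom_one)
  moreover have "lext \<iota> \<phi> (C c * E n * f) = \<iota> c * lext \<iota> \<phi> (E n * f)"
    by (simp only: mult.assoc \<iota>.lext_scale)
  ultimately have "lext \<iota> \<phi> (C c * E n * f) =
      \<iota> (g m * g n * ev (inverse (eigenvalue n)) f * (c * ev (inverse v) (E n))) * \<phi> 0"
    by (simp only: \<iota>.hom_mult mult_ac)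
  also have "g m * g n = u powi (m\<^sup>2 + n\<^sup>2) * v powi (\<bar>m\<bar> + \<bar>n\<bar>)"
    using u_nonzero v_nonzero by (simp add: g power_int_add mult_ac)
  finally show ?thesis
    by (simp only: c c_def[symmetric] mult_1_right)
qed

end

section \<open>The bar involution and its compatibility with the weight\<close>

locale generic_bar = generic_parameters u v + bar: field_homomorphism bar
  for u v :: "'a::field" and bar :: "'a \<Rightarrow> 'a" +
  assumes bar_u: "bar u = inverse u" and bar_v: "bar v = inverse v"
begin

lemma C_bar_homomorphism: "ring_homomorphism (\<lambda>c. C (bar c))"
  by unfold_locales (simp_all add: bar.hom_add single_add bar.hom_mult mult_single bar.hom_one)

sublocale C_bar: ring_homomorphism "\<lambda>c. C (bar c)"
  by (rule C_bar_homomorphism)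

definition bar_poly :: "(int \<Rightarrow>\<^sub>0 'a) \<Rightarrow> int \<Rightarrow>\<^sub>0 'a" where
  "bar_poly = lext (\<lambda>c. C (bar c)) (\<lambda>n. X (- n))"

lemma bar_poly_single: "bar_poly (Poly_Mapping.single n c) = Poly_Mapping.single (- n) (bar c)"
  by (simp add: bar_poly_def C_bar.lext_single mult_single)

lemma bar_poly_add: "bar_poly (f + g) = bar_poly f + bar_poly g"
  by (simp add: bar_poly_def C_bar.lext_add)

lemma bar_poly_mult: "bar_poly (f * g) = bar_poly f * bar_poly g"
  unfolding bar_poly_def by (rule C_bar.lext_mult) (simp add: mult_single)

lemma lookup_bar_poly: "Poly_Mapping.lookup (bar_poly f) n = bar (Poly_Mapping.lookup f (- n))"
  by (induction f rule: poly_mapping_single_induct)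
    (auto simp: bar_poly_single bar_poly_add lookup_add bar.hom_add lookup_single when_def bar.hom_zero)

text \<open>Inverting q and t multiplies each factor (t - q^i)/(1 - t q^{i+1}) by q.\<close>

lemma bar_weight_nat: "bar (weight_nat m) = u ^ (4 * m) * weight_nat m"
proof (induction m)
  case 0
  then show ?case
    by (simp add: weight_nat_def bar.hom_one)
next
  case (Suc m)
  define x where "x = u ^ (4 * m)"
  have x: "x \<noteq> 0" "u ^ (4 * Suc m) = x * u ^ 4"
    using u_nonzero by (simp_all add: x_def power_add mult.commute)
  have nz: "1 - v\<^sup>2 * (x * u ^ 4) \<noteq> 0"
    using u_v_power_neq_1[of "4 * Suc m" 2] by (simp only: x(2) mult.commute[of "v\<^sup>2"]) simp
  have step: "weight_nat (Suc m) = weight_nat m * ((v\<^sup>2 - x) / (1 - v\<^sup>2 * (x * u ^ 4)))"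
    by (simp only: weight_nat_def prod.lessThan_Suc x x_def)
  have bar_x: "bar x = inverse x"
    by (simp add: x_def bar.hom_power bar_u power_inverse)
  define t where "t = v\<^sup>2"
  define q where "q = u ^ 4"
  have tq: "t \<noteq> 0" "q \<noteq> 0" "bar t = inverse t" "bar q = inverse q"
    using u_nonzero v_nonzero by (simp_all add: t_def q_def bar.hom_power bar_u bar_v power_inverse)
  have "(inverse t - inverse x) / (1 - inverse t * (inverse x * inverse q)) =
      q * ((t - x) / (1 - t * (x * q)))"
  proof -
    have "inverse t - inverse x = (x - t) / (t * x)"
      using tq x by (simp add: field_simps)
    moreover have "1 - inverse t * (inverse x * inverse q) = (t * (x * q) - 1) / (t * (x * q))"
      using tq x by (simp add: field_simps)
    moreover have "A / (t * x) / (B / (t * (x * q))) = q * (A / B)" for A B :: 'a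
      using tq x by (simp add: field_simps)
    ultimately have "(inverse t - inverse x) / (1 - inverse t * (inverse x * inverse q)) =
        q * ((x - t) / (t * (x * q) - 1))"
      by (simp only:)
    also have "(x - t) / (t * (x * q) - 1) = (t - x) / (1 - t * (x * q))"
      by (metis minus_diff_eq minus_divide_divide)
    finally show ?thesis .
  qed
  then have "bar ((t - x) / (1 - t * (x * q))) = q * ((t - x) / (1 - t * (x * q)))"
    by (simp add: bar.hom_divide bar.hom_diff bar.hom_mult bar.hom_one tq bar_x)
  then show ?case
    unfolding step bar.hom_mult Suc x(2) t_def[symmetric] q_def[symmetric] x_def[symmetric]
    by (simp only: mult_ac)
qed

text \<open>In other words, mu_k^0 is invariant under the bar involution.\<close>

lemma bar_weight: "bar (weight n) = weight (- n)"
proof (cases "even n")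
  case True
  then show ?thesis
  proof (cases rule: even_int_cases)
    case (1 m)
    then show ?thesis
      by (simp add: weight_even weight_even_uminus bar_weight_nat)
  next
    case (2 m)
    then show ?thesis
      using u_nonzero
      by (simp add: weight_even weight_even_uminus bar_weight_nat bar.hom_mult bar.hom_power bar_u
          power_inverse)
  qed
qed (simp add: weight_odd bar.hom_zero)

lemma M_bar_poly: "M (bar_poly f) = bar (M f)"
  by (induction f rule: poly_mapping_single_induct)
    (simp_all add: bar_poly_add M_add bar.hom_add,
     simp add: bar_poly_single M_def id.lext_single bar.hom_mult bar_weight)

text \<open>The bounds on exponents and the range of the orthogonality conditions are both symmetric
  in sign, unlike the order that defines a single e_n.\<close>

lemma level_bar_poly:
  assumes "level N f"
  shows "level N (bar_poly f)"
  unfolding level_def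
proof (intro conjI allI impI)
  show "deg_le N (bar_poly f)"
    unfolding deg_le_def lookup_bar_poly
  proof (intro allI impI)
    fix m assume "bar (Poly_Mapping.lookup f (- m)) \<noteq> 0"
    then have "Poly_Mapping.lookup f (- m) \<noteq> 0"
      by (auto simp: bar.hom_zero)
    then have "\<bar>- m\<bar> \<le> N \<and> even (- m - N)"
      using assms unfolding level_def deg_le_def by blast
    then show "\<bar>m\<bar> \<le> N \<and> even (m - N)"
      by presburger
  qed
next
  fix j assume "\<bar>j\<bar> < N"
  then have "\<bar>- j\<bar> < N"
    by simp
  then have "M (f * X (- j)) = 0"
    using assms unfolding level_def by blast
  then have "M (bar_poly (f * X (- j))) = 0"
    by (simp add: M_bar_poly bar.hom_zero)
  then show "M (bar_poly f * X j) = 0"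
    by (simp add: bar_poly_mult bar_poly_single bar.hom_one)
qed

end

section \<open>The rational function field and the series field\<close>

notation fls_nth (infixl \<open>$$\<close> 75)

context ring_homomorphism
begin

lemma poly_map_poly_pCons:
  "poly (map_poly hom (pCons a p)) x = hom a + x * poly (map_poly hom p) x"
  by (simp add: map_poly_pCons hom_zero)

lemma poly_map_poly_add:
  "poly (map_poly hom (p + q)) x = poly (map_poly hom p) x + poly (map_poly hom q) x"
  by (induction p q rule: poly_induct2)
    (simp_all add: poly_map_poly_pCons hom_add algebra_simps)

lemma poly_map_poly_smult:
  "poly (map_poly hom (smult c p)) x = hom c * poly (map_poly hom p) x"
  by (simp add: map_poly_smult hom_zero hom_mult)

lemma poly_map_poly_mult:
  "poly (map_poly hom (p * q)) x = poly (map_poly hom p) x * poly (map_poly hom q) x"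
  by (induction p)
    (simp_all add: poly_map_poly_pCons poly_map_poly_add poly_map_poly_smult algebra_simps hom_zero)

lemma poly_map_poly_homomorphism: "ring_homomorphism (\<lambda>p. poly (map_poly hom p) x)"
  by unfold_locales (simp_all add: poly_map_poly_add poly_map_poly_mult hom_one)

end

lemma ring_homomorphism_comp:
  assumes "ring_homomorphism f" "ring_homomorphism g"
  shows "ring_homomorphism (\<lambda>x. f (g x))"
proof -
  interpret f: ring_homomorphism f by fact
  interpret g: ring_homomorphism g by fact
  show ?thesis
    by unfold_locales (simp_all add: f.hom_add g.hom_add f.hom_mult g.hom_mult f.hom_one g.hom_one)
qed

lemma fls_const_homomorphism: "ring_homomorphism (fls_const :: 'a::comm_ring_1 \<Rightarrow> 'a fls)"
  by unfold_locales (simp_all add: fls_plus_const)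

lemma to_fract_homomorphism: "ring_homomorphism (to_fract :: 'a::idom \<Rightarrow> 'a fract)"
  by unfold_locales simp_all

lemma of_int_homomorphism: "ring_homomorphism (of_int :: int \<Rightarrow> 'a::comm_ring_1)"
  by unfold_locales simp_all

lemma int_poly_homomorphism: "ring_homomorphism (\<lambda>c. poly (map_poly of_int c) (y :: 'a::comm_ring_1))"
  by (rule ring_homomorphism.poly_map_poly_homomorphism[OF of_int_homomorphism])

lemma eval_int_poly2_homomorphism: "ring_homomorphism (eval_int_poly2 x y)"
  using ring_homomorphism.poly_map_poly_homomorphism[OF int_poly_homomorphism]
  unfolding eval_int_poly2_def .

lemma int_poly_homomorphism_unique:
  assumes "ring_homomorphism (h :: int poly \<Rightarrow> 'a::comm_ring_1)"
  shows "h c = poly (map_poly of_int c) (h [:0, 1:])"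
proof -
  interpret h: ring_homomorphism h by fact
  interpret of_int: ring_homomorphism "of_int :: int \<Rightarrow> 'a"
    by (rule of_int_homomorphism)
  have of_int: "h [:a:] = of_int a" for a
  proof -
    have nat: "h [:int n:] = of_nat n" for n
    proof (induction n)
      case (Suc n)
      have "[:int (Suc n):] = 1 + [:int n:]"
        by (simp add: one_pCons)
      then show ?case
        by (simp only: h.hom_add h.hom_one Suc of_nat_Suc)
    qed (simp add: h.hom_zero)
    show ?thesis
    proof (cases a)
      case (neg n)
      then have "[:a:] = - [:int (Suc n):]"
        by simp
      then show ?thesis
        by (simp only: h.hom_uminus nat neg) simp
    qed (simp add: nat)
  qed
  show ?thesis
  proof (induction c)
    case (pCons a p)
    have "pCons a p = [:a:] + [:0, 1:] * p"
      by simp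
    then have "h (pCons a p) = of_int a + h [:0, 1:] * h p"
      by (simp only: h.hom_add h.hom_mult of_int)
    then show ?case
      by (simp add: of_int.poly_map_poly_pCons pCons.IH)
  qed (simp add: h.hom_zero)
qed

lemma ring_homomorphism_int_poly:
  assumes "ring_homomorphism h"
  shows "h (poly (map_poly of_int c) y) = poly (map_poly of_int c) (h y)"
  using int_poly_homomorphism_unique[OF ring_homomorphism_comp[OF assms int_poly_homomorphism[of y]], of c]
  by (simp add: map_poly_pCons)

lemma eval_int_poly2_pCons:
  "eval_int_poly2 x y (pCons c p) = poly (map_poly of_int c) y + x * eval_int_poly2 x y p"
  unfolding eval_int_poly2_def
  by (rule ring_homomorphism.poly_map_poly_pCons[OF int_poly_homomorphism])

lemma ring_homomorphism_eval_int_poly2: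
  assumes "ring_homomorphism h"
  shows "h (eval_int_poly2 x y p) = eval_int_poly2 (h x) (h y) p"
proof (induction p)
  case 0
  then show ?case
    by (simp add: eval_int_poly2_def ring_homomorphism.hom_zero[OF assms])
next
  case (pCons c p)
  then show ?case
    by (simp add: eval_int_poly2_pCons ring_homomorphism.hom_add[OF assms]
        ring_homomorphism.hom_mult[OF assms] ring_homomorphism_int_poly[OF assms])
qed

lemma eval_ratfun_to_fract:
  "eval_ratfun x y (to_fract p) = eval_int_poly2 x y p"
  by (simp add: eval_ratfun_def ring_homomorphism.hom_one[OF eval_int_poly2_homomorphism])

text \<open>Evaluation is defined through lowest terms. If no nonzero polynomial vanishes at the
  point, cross-multiplication shows that every other representation gives the same value; this is
  what makes it a homomorphism.\<close>

lemma eval_ratfun_Fract: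
  assumes inj: "\<And>p. eval_int_poly2 x y p = 0 \<Longrightarrow> p = 0" and b: "b \<noteq> 0"
  shows "eval_ratfun x y (Fract a b) = eval_int_poly2 x y a / eval_int_poly2 x y b"
proof -
  interpret h: ring_homomorphism "eval_int_poly2 x y"
    by (rule eval_int_poly2_homomorphism)
  obtain a' b' where ab: "quot_of_fract (Fract a b) = (a', b')"
    by fastforce
  have b': "b' \<noteq> 0"
    using quot_of_fract_in_normalized_fracts[of "Fract a b"] not_normalized_fracts_0_denom
    unfolding ab by metis
  have "Fract a b = Fract a' b'"
    using quot_to_fract_quot_of_fract[of "Fract a b"] unfolding ab quot_to_fract_def by simp
  then have "a * b' = a' * b"
    using b b' by (simp add: eq_fract)
  then have "eval_int_poly2 x y a * eval_int_poly2 x y b' = eval_int_poly2 x y a' * eval_int_poly2 x y b"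
    by (metis h.hom_mult)
  moreover have "eval_int_poly2 x y b \<noteq> 0" "eval_int_poly2 x y b' \<noteq> 0"
    using inj b b' by blast+
  ultimately show ?thesis
    by (simp add: eval_ratfun_def ab frac_eq_eq)
qed

lemma eval_ratfun_homomorphism:
  assumes inj: "\<And>p. eval_int_poly2 x y p = 0 \<Longrightarrow> p = 0"
  shows "field_homomorphism (eval_ratfun x y)"
proof -
  interpret h: ring_homomorphism "eval_int_poly2 x y"
    by (rule eval_int_poly2_homomorphism)
  note Fract = eval_ratfun_Fract[OF inj]
  have nz: "eval_int_poly2 x y b \<noteq> 0" if "b \<noteq> 0" for b
    using inj that by blast
  show ?thesis
  proof
    fix r s :: ratfun
    obtain a b where r: "r = Fract a b" "b \<noteq> 0"
      by (cases r) auto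
    obtain c d where s: "s = Fract c d" "d \<noteq> 0"
      by (cases s) auto
    show "eval_ratfun x y (r + s) = eval_ratfun x y r + eval_ratfun x y s"
      using r(2) s(2) nz[of b] nz[of d]
      by (simp add: r(1) s(1) Fract h.hom_add h.hom_mult add_frac_eq)
    show "eval_ratfun x y (r * s) = eval_ratfun x y r * eval_ratfun x y s"
      using r(2) s(2) by (simp add: r(1) s(1) Fract h.hom_mult)
  next
    show "eval_ratfun x y 1 = 1"
      using eval_ratfun_to_fract[of x y 1] by (simp add: h.hom_one)
  qed
qed

lemma fls_nth_X_powi_mult: "(fls_X powi s * f) $$ j = (f :: 'b::field fls) $$ (j - s)"
  unfolding fls_X_power_int fls_X_intpow_times_conv_shift by simp

text \<open>Substituting a power of the formal variable keeps the coefficients of p visible. The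
  cases s = 1 and s = -1 give injectivity of the expansion into series and of bar.\<close>

lemma fls_nth_poly_const:
  assumes k: "ring_homomorphism (k :: 'a::comm_ring_1 \<Rightarrow> 'b::field)"
    and s: "s \<noteq> 0"
  shows "poly (map_poly (\<lambda>c. fls_const (k c)) p) (fls_X powi s) $$ (s * j) =
    (if j \<ge> 0 then k (coeff p (nat j)) else 0)"
proof (induction p arbitrary: j)
  case 0
  then show ?case
    using k by (simp add: ring_homomorphism.hom_zero)
next
  case (pCons a p)
  have "poly (map_poly (\<lambda>c. fls_const (k c)) (pCons a p)) (fls_X powi s) $$ (s * j) =
      (if j = 0 then k a else 0) + poly (map_poly (\<lambda>c. fls_const (k c)) p) (fls_X powi s) $$ (s * j - s)"
    using s by (subst map_poly_pCons)
      (simp_all add: ring_homomorphism.hom_zero[OF k] fls_nth_X_powi_mult del: fls_X_power_int)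
  moreover have "s * j - s = s * (j - 1)"
    by (simp add: algebra_simps)
  ultimately have *: "poly (map_poly (\<lambda>c. fls_const (k c)) (pCons a p)) (fls_X powi s) $$ (s * j) =
      (if j = 0 then k a else 0) + (if j - 1 \<ge> 0 then k (coeff p (nat (j - 1))) else 0)"
    by (simp only: pCons.IH)
  consider "j < 0" | "j = 0" | "j > 0"
    by linarith
  then show ?case
  proof cases
    case 1
    then show ?thesis
      unfolding * by simp
  next
    case 2
    then show ?thesis
      unfolding * by simp
  next
    case 3
    then have "nat j = Suc (nat (j - 1))"
      by simp
    with 3 show ?thesis
      unfolding * by (simp only: coeff_pCons_Suc) simp
  qed
qed

lemma t_half_series_int_poly:
  "poly (map_poly of_int c) t_half_series = fls_const (fls_const (to_fract c))"
  using int_poly_homomorphism_unique[OF ring_homomorphism_comp[OF fls_const_homomorphism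
      ring_homomorphism_comp[OF fls_const_homomorphism to_fract_homomorphism]], of c]
  by (simp add: t_half_series_def)

lemma eval_series_injective:
  assumes "eval_int_poly2 q_quarter_series t_half_series p = 0"
  shows "p = 0"
proof (rule poly_eqI)
  fix i
  have "poly (map_poly (\<lambda>c. fls_const (fls_const (to_fract c) :: int poly fract fls)) p) fls_X $$ int i
      = fls_const (to_fract (coeff p i))"
    using fls_nth_poly_const[OF ring_homomorphism_comp[OF fls_const_homomorphism to_fract_homomorphism],
        of 1 p "int i"]
    by (simp del: fls_X_power_int)
  then show "coeff p i = coeff 0 i"
    using assms by (simp add: eval_int_poly2_def t_half_series_int_poly q_quarter_series_def)
qed

interpretation to_series: field_homomorphism to_series
  unfolding to_series_def by (rule eval_ratfun_homomorphism) (rule eval_series_injective)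

lemma to_series_to_fract: "to_series (to_fract p) = eval_int_poly2 q_quarter_series t_half_series p"
  unfolding to_series_def by (rule eval_ratfun_to_fract)

lemma to_series_q_quarter: "to_series q_quarter = q_quarter_series"
  by (simp add: q_quarter_def to_series_to_fract eval_int_poly2_def map_poly_pCons)

lemma to_series_t_half: "to_series t_half = t_half_series"
  by (simp add: t_half_def to_series_to_fract eval_int_poly2_def map_poly_pCons)

text \<open>A root at 1/y is a root at y of the reversed polynomial, and y itself is
  transcendental.\<close>

lemma int_poly_inverse_nonzero:
  assumes "poly (map_poly of_int c) (inverse (to_fract ([:0, 1:] :: int poly))) = 0"
  shows "c = 0"
proof -
  let ?y = "to_fract ([:0, 1:] :: int poly)"
  have to_fract: "poly (map_poly of_int c) ?y = to_fract c" for c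
    using int_poly_homomorphism_unique[OF to_fract_homomorphism, of c] by simp
  have "degree (map_poly of_int c :: int poly fract poly) = degree c"
    by (rule degree_map_poly) simp
  then have "reflect_poly (map_poly of_int c :: int poly fract poly) = map_poly of_int (reflect_poly c)"
    by (intro poly_eqI) (simp add: coeff_reflect_poly coeff_map_poly)
  moreover have "poly (reflect_poly (map_poly of_int c)) ?y = 0"
    using assms by (simp add: poly_reflect_poly_nz)
  ultimately have "reflect_poly c = 0"
    by (simp add: to_fract)
  then show ?thesis
    by simp
qed

text \<open>The value is sent into the field of series, where u^{-1} is the inverse of the formal
  variable; the coefficient of u^{-i} there recovers the i-th coefficient of p at v^{-1}.\<close>

lemma eval_bar_injective:
  assumes "eval_int_poly2 (inverse q_quarter) (inverse t_half) p = 0"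
  shows "p = 0"
proof (rule poly_eqI)
  fix i
  let ?k = "\<lambda>c. poly (map_poly of_int c) (inverse (to_fract ([:0, 1:] :: int poly)))"
  have "poly (map_poly of_int c) (inverse t_half_series) = fls_const (fls_const (?k c))" for c
  proof -
    have "inverse t_half_series = fls_const (fls_const (inverse (to_fract [:0, 1:])))"
      by (simp add: t_half_series_def fls_inverse_const)
    then show ?thesis
      using ring_homomorphism_int_poly[OF ring_homomorphism_comp[OF fls_const_homomorphism fls_const_homomorphism],
          of c "inverse (to_fract ([:0, 1:] :: int poly))"]
      by simp
  qed
  moreover have "to_series (eval_int_poly2 (inverse q_quarter) (inverse t_half) p) = 0"
    using assms by (simp add: to_series.hom_zero)
  then have "eval_int_poly2 (inverse q_quarter_series) (inverse t_half_series) p = 0"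
    by (simp only: ring_homomorphism_eval_int_poly2[OF to_series.ring_homomorphism_axioms]
        to_series.hom_inverse to_series_q_quarter to_series_t_half)
  ultimately have "poly (map_poly (\<lambda>c. fls_const (fls_const (?k c))) p) (fls_X powi - 1) = 0"
    by (simp add: eval_int_poly2_def q_quarter_series_def power_int_minus del: fls_X_power_int)
  moreover have "poly (map_poly (\<lambda>c. fls_const (fls_const (?k c))) p) (fls_X powi - 1) $$ (- 1 * int i)
      = fls_const (?k (coeff p i))"
    by (subst fls_nth_poly_const[OF ring_homomorphism_comp[OF fls_const_homomorphism int_poly_homomorphism]])
      (simp_all del: fls_X_power_int)
  ultimately show "coeff p i = coeff 0 i"
    using int_poly_inverse_nonzero by simp
qed

interpretation ratfun_bar: field_homomorphism ratfun_bar
  unfolding ratfun_bar_def by (rule eval_ratfun_homomorphism) (rule eval_bar_injective)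

lemma ratfun_bar_q_quarter: "ratfun_bar q_quarter = inverse q_quarter"
  by (simp add: ratfun_bar_def q_quarter_def eval_ratfun_to_fract)
    (simp add: eval_int_poly2_def map_poly_pCons)

lemma ratfun_bar_t_half: "ratfun_bar t_half = inverse t_half"
  by (simp add: ratfun_bar_def t_half_def eval_ratfun_to_fract)
    (simp add: eval_int_poly2_def map_poly_pCons)

lemma t_half_series_powi:
  "t_half_series powi j = fls_const (fls_const (to_fract [:0, 1:] powi j))"
  by (simp add: t_half_series_def power_int_def fls_const_power fls_inverse_const)

text \<open>Comparing powers of the outer variable u in the series field gives i = 0; then the
  degree in v gives j = 0.\<close>

lemma q_t_independent:
  assumes "q_quarter powi i * t_half powi j = 1"
  shows "i = 0 \<and> j = 0"
proof -
  let ?y = "to_fract ([:0, 1:] :: int poly)"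
  have "to_series (q_quarter powi i * t_half powi j) = 1"
    using assms by (simp add: to_series.hom_one)
  then have eq: "fls_X powi i * fls_const (fls_const (?y powi j)) = (1 :: series)"
    by (simp add: to_series.hom_mult to_series.hom_powi to_series_q_quarter to_series_t_half
        q_quarter_series_def t_half_series_powi)
  have "(fls_X powi i * fls_const (fls_const (?y powi j)) :: series) $$ i = fls_const (?y powi j)"
    by (simp only: fls_nth_X_powi_mult) simp
  then have "(1 :: series) $$ i = fls_const (?y powi j)"
    by (simp only: eq)
  moreover have "?y powi j \<noteq> 0"
    by (simp add: power_int_not_zero)
  ultimately have i: "i = 0"
    by (cases "i = 0") auto
  with \<open>(1 :: series) $$ i = fls_const (?y powi j)\<close> have y: "?y powi j = 1"
    by (metis fls_const_eq_1_iff fls_one_nth)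
  have "\<not> ?y ^ n = 1" if "n > 0" for n
  proof
    assume "?y ^ n = 1"
    then have "to_fract ([:0, 1:] ^ n) = to_fract (1 :: int poly)"
      by (simp add: ring_homomorphism.hom_power[OF to_fract_homomorphism])
    then have "([:0, 1:] ^ n :: int poly) = 1"
      by (simp only: to_fract_eq_iff)
    then have "degree ([:0, 1:] ^ n :: int poly) = 0"
      by simp
    then show False
      using that by (simp add: degree_power_eq)
  qed
  then have pow: "n = 0" if "?y ^ n = 1" for n
    using that by blast
  have "j = 0"
  proof (cases "j \<ge> 0")
    case True
    then have "?y ^ nat j = 1"
      using y unfolding power_int_def by simp
    with pow[of "nat j"] True show ?thesis
      by simp
  next
    case False
    then have "inverse ?y ^ nat (- j) = 1"
      using y unfolding power_int_def by simp
    then have "?y ^ nat (- j) = 1"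
      by (simp only: power_inverse inverse_eq_1_iff)
    with pow[of "nat (- j)"] False show ?thesis
      by simp
  qed
  with i show ?thesis
    by simp
qed

interpretation ratfun: generic_bar q_quarter t_half ratfun_bar
proof
  show "i = 0 \<and> j = 0" if "q_quarter powi i * t_half powi j = 1" for i j
    using that by (rule q_t_independent)
qed (simp_all add: ratfun_bar_q_quarter ratfun_bar_t_half, simp_all add: q_quarter_def t_half_def)

section \<open>Iterated Laurent series\<close>

lemma finite_fls_mult_support: "finite {b. f $$ b \<noteq> 0 \<and> g $$ (n - b) \<noteq> 0}"
proof (rule finite_subset)
  show "{b. f $$ b \<noteq> 0 \<and> g $$ (n - b) \<noteq> 0} \<subseteq> {fls_subdegree f..n - fls_subdegree g}"
    using fls_subdegree_leI[of f] fls_subdegree_leI[of g] by force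
qed simp

lemma fls_mult_nth_superset:
  fixes f g :: "'a::semiring_0 fls"
  assumes "finite S" "{b. f $$ b \<noteq> 0 \<and> g $$ (n - b) \<noteq> 0} \<subseteq> S"
  shows "(f * g) $$ n = (\<Sum>b\<in>S. f $$ b * g $$ (n - b))"
proof -
  let ?T = "{b. f $$ b \<noteq> 0 \<and> g $$ (n - b) \<noteq> 0}"
  have "?T \<subseteq> {fls_subdegree f..n - fls_subdegree g}"
    using fls_subdegree_leI[of f] fls_subdegree_leI[of g] by force
  then have "(\<Sum>b=fls_subdegree f..n - fls_subdegree g. f $$ b * g $$ (n - b)) = (\<Sum>b\<in>?T. f $$ b * g $$ (n - b))"
    by (intro sum.mono_neutral_right) auto
  moreover have "(\<Sum>b\<in>?T. f $$ b * g $$ (n - b)) = (\<Sum>b\<in>S. f $$ b * g $$ (n - b))"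
    using assms by (intro sum.mono_neutral_left) auto
  ultimately show ?thesis
    by (simp only: fls_times_nth(2))
qed

abbreviation co :: "'a::zero fls fls \<Rightarrow> int \<Rightarrow> int \<Rightarrow> 'a" where
  "co f a i \<equiv> f $$ a $$ i"

lemma series_eqI: "(\<And>a i. co f a i = co g a i) \<Longrightarrow> f = g"
  by (intro fls_eqI)

definition mult_support :: "'a::zero fls fls \<Rightarrow> 'a fls fls \<Rightarrow> int \<Rightarrow> int \<Rightarrow> (int \<times> int) set" where
  "mult_support f g a i = {(b, j). co f b j \<noteq> 0 \<and> co g (a - b) (i - j) \<noteq> 0}"

text \<open>The iterated convolution in u and X becomes one finite sum over pairs of exponents. In
  this form it can be reindexed by substitutions that mix the two variables.\<close>

lemma co_mult:
  fixes f g :: "'a::field fls fls"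
  shows "finite (mult_support f g a i)"
    and "co (f * g) a i = (\<Sum>(b, j)\<in>mult_support f g a i. co f b j * co g (a - b) (i - j))"
proof -
  define B where "B = {b. f $$ b \<noteq> 0 \<and> g $$ (a - b) \<noteq> 0}"
  define J where "J b = {j. co f b j \<noteq> 0 \<and> co g (a - b) (i - j) \<noteq> 0}" for b
  have B: "finite B" and J: "finite (J b)" for b
    unfolding B_def J_def by (rule finite_fls_mult_support)+
  have S: "mult_support f g a i = Sigma B J"
    by (auto simp: mult_support_def B_def J_def)
  show "finite (mult_support f g a i)"
    unfolding S using B J by auto
  have "co (f * g) a i = (\<Sum>b\<in>B. f $$ b * g $$ (a - b)) $$ i"
    using fls_mult_nth_superset[of B f g a] B by (simp add: B_def)
  also have "\<dots> = (\<Sum>b\<in>B. (f $$ b * g $$ (a - b)) $$ i)"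
    by (induction B rule: infinite_finite_induct) simp_all
  also have "\<dots> = (\<Sum>b\<in>B. \<Sum>j\<in>J b. co f b j * co g (a - b) (i - j))"
    using J by (intro sum.cong refl fls_mult_nth_superset) (auto simp: J_def)
  also have "\<dots> = (\<Sum>(b, j)\<in>mult_support f g a i. co f b j * co g (a - b) (i - j))"
    unfolding S using B J by (intro sum.Sigma) auto
  finally show "co (f * g) a i = (\<Sum>(b, j)\<in>mult_support f g a i. co f b j * co g (a - b) (i - j))" .
qed

text \<open>The substitution $X \mapsto u^w X^e$ ($e = \pm 1$) does not act on all of the series field; the
  following relation says that it maps \<open>f\<close> to \<open>g\<close>, twisted by a sign \<open>\<sigma>\<close>.\<close>

definition transport :: "int \<Rightarrow> int \<Rightarrow> (int \<Rightarrow> 'a) \<Rightarrow> 'a::field fls fls \<Rightarrow> 'a fls fls \<Rightarrow> bool" where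
  "transport w e \<sigma> f g \<longleftrightarrow> (\<forall>a i. co g (a + w * i) (e * i) = \<sigma> i * co f a i)"

text \<open>(b, j) -> (b + w j, e j) is a bijection between the supports of the two products. Two
  separate signs are allowed so that an invariant factor can be combined with an antisymmetric
  one.\<close>

lemma transport_mult:
  assumes f: "transport w e \<sigma> f g" and f': "transport w e \<tau> f' g'" and e: "e * e = 1"
    and \<sigma>: "\<And>i j. \<rho> (i + j) = \<sigma> i * \<tau> j" and nz: "\<And>i. \<sigma> i \<noteq> 0" "\<And>i. \<tau> i \<noteq> 0"
  shows "transport w e \<rho> (f * f') (g * g')"
  unfolding transport_def
proof (intro allI)
  fix a i
  let ?S = "mult_support f f' a i" and ?S' = "mult_support g g' (a + w * i) (e * i)"
  define h where "h = (\<lambda>(b, j). (b + w * j, e * j))"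
  define h' where "h' = (\<lambda>(b, j). (b - w * (e * j), e * j))"
  have ee: "e * (e * j) = j" for j
    using e by (simp flip: mult.assoc)
  have g: "co g (b + w * j) (e * j) = \<sigma> j * co f b j" for b j
    using f by (simp add: transport_def)
  have g': "co g' (a + w * i - (b + w * j)) (e * i - e * j) = \<tau> (i - j) * co f' (a - b) (i - j)" for b j
  proof -
    have "a + w * i - (b + w * j) = (a - b) + w * (i - j)" "e * i - e * j = e * (i - j)"
      by (simp_all add: algebra_simps)
    then show ?thesis
      using f' by (simp only: transport_def)
  qed
  have h: "h x \<in> ?S' \<longleftrightarrow> x \<in> ?S" for x
    by (cases x) (simp add: h_def mult_support_def g g' nz)
  have hh': "h (h' x) = x" "h' (h x) = x" for x
    by (cases x; simp add: h_def h'_def ee)+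
  have "co (g * g') (a + w * i) (e * i) =
      (\<Sum>(b, j)\<in>?S'. co g b j * co g' (a + w * i - b) (e * i - j))"
    by (rule co_mult)
  also have "\<dots> = (\<Sum>(b, j)\<in>?S. \<rho> i * (co f b j * co f' (a - b) (i - j)))"
  proof (rule sum.reindex_bij_witness[of _ h h'])
    fix x assume "x \<in> ?S"
    then show "h x \<in> ?S'"
      by (simp add: h)
  next
    fix x assume "x \<in> ?S'"
    then show "h' x \<in> ?S"
      using h[of "h' x"] by (simp add: hh')
  next
    fix x
    obtain b j where h'x: "h' x = (b, j)"
      by fastforce
    have x: "x = (b + w * j, e * j)"
      using hh'(1)[of x] unfolding h'x by (simp add: h_def)
    have "\<rho> i = \<sigma> j * \<tau> (i - j)"
      using \<sigma>[of j "i - j"] by simp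
    then show "(case h' x of (b, j) \<Rightarrow> \<rho> i * (co f b j * co f' (a - b) (i - j))) =
        (case x of (b, j) \<Rightarrow> co g b j * co g' (a + w * i - b) (e * i - j))"
      unfolding h'x unfolding x prod.case g g' by (simp add: mult_ac)
  qed (simp_all add: hh')
  also have "\<dots> = \<rho> i * co (f * f') a i"
    unfolding co_mult(2)[of f f'] by (simp add: sum_distrib_left case_prod_unfold)
  finally show "co (g * g') (a + w * i) (e * i) = \<rho> i * co (f * f') a i" .
qed

lemma transport_diff:
  "transport w e \<sigma> f g \<Longrightarrow> transport w e \<sigma> f' g' \<Longrightarrow> transport w e \<sigma> (f - f') (g - g')"
  by (simp add: transport_def right_diff_distrib)

definition monomial :: "'a::field \<Rightarrow> int \<Rightarrow> int \<Rightarrow> 'a fls fls" where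
  "monomial c \<alpha> \<beta> = fls_X powi \<alpha> * fls_const (fls_X powi \<beta> * fls_const c)"

lemma co_monomial_mult: "co (monomial c \<alpha> \<beta> * f) a i = c * co f (a - \<alpha>) (i - \<beta>)"
  unfolding monomial_def mult.assoc fls_nth_X_powi_mult fls_mult_const_nth
  by (simp only: fls_nth_X_powi_mult fls_mult_const_nth)

lemma monomial_1: "monomial 1 0 0 = 1"
  by (simp add: monomial_def)

lemma co_1: "co 1 a i = (if a = 0 \<and> i = 0 then 1 else 0)"
  by simp

lemma co_monomial: "co (monomial c \<alpha> \<beta>) a i = (if a = \<alpha> \<and> i = \<beta> then c else 0)"
  using co_monomial_mult[of c \<alpha> \<beta> 1 a i] unfolding co_1 by auto

lemma transport_monomial:
  assumes "e * e = 1"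
  shows "transport w e \<sigma> (monomial c \<alpha> \<beta>) (monomial (\<sigma> \<beta> * c) (\<alpha> + w * \<beta>) (e * \<beta>))"
proof -
  have "e \<noteq> 0"
    using assms by auto
  then have "e * i = e * \<beta> \<longleftrightarrow> i = \<beta>" for i
    by simp
  then show ?thesis
    by (auto simp: transport_def co_monomial)
qed

text \<open>Lexicographic positivity with u dominating X: then every coefficient of the geometric
  series in c u^\<alpha> X^\<beta> is a finite sum. The case \<alpha> = 0 occurs for 1/(1 - t
  X^2).\<close>

definition small :: "int \<Rightarrow> int \<Rightarrow> bool" where
  "small \<alpha> \<beta> \<longleftrightarrow> \<alpha> > 0 \<or> \<alpha> = 0 \<and> \<beta> > 0"

lemma co_eventually_0:
  assumes "small \<alpha> \<beta>"
  shows "\<exists>N. \<forall>n\<ge>N. co f (a - int n * \<alpha>) (i - int n * \<beta>) = 0"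
proof (cases "\<alpha> > 0")
  case True
  show ?thesis
  proof (intro exI allI impI)
    fix n assume "n \<ge> nat (a - fls_subdegree f + 1)"
    then have "int n \<ge> a - fls_subdegree f + 1"
      by linarith
    moreover have "int n * 1 \<le> int n * \<alpha>"
      using True by (intro mult_left_mono) simp_all
    ultimately have "a - int n * \<alpha> < fls_subdegree f"
      by linarith
    then show "co f (a - int n * \<alpha>) (i - int n * \<beta>) = 0"
      by simp
  qed
next
  case False
  with assms have \<alpha>: "\<alpha> = 0" and \<beta>: "\<beta> > 0"
    by (auto simp: small_def)
  show ?thesis
  proof (intro exI allI impI)
    fix n assume "n \<ge> nat (i - fls_subdegree (f $$ a) + 1)"
    then have "int n \<ge> i - fls_subdegree (f $$ a) + 1"
      by linarith
    moreover have "int n * 1 \<le> int n * \<beta>"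
      using \<beta> by (intro mult_left_mono) simp_all
    ultimately have "i - int n * \<beta> < fls_subdegree (f $$ a)"
      by linarith
    then show "co f (a - int n * \<alpha>) (i - int n * \<beta>) = 0"
      by (simp add: \<alpha>)
  qed
qed

lemma one_minus_monomial_nonzero:
  assumes "small \<alpha> \<beta>"
  shows "1 - monomial c \<alpha> \<beta> \<noteq> 0"
proof
  assume "1 - monomial c \<alpha> \<beta> = 0"
  then have "co (1 - monomial c \<alpha> \<beta>) 0 0 = 0"
    by simp
  with assms show False
    by (auto simp: co_monomial small_def)
qed

text \<open>Iterate h = 1 + c u^\<alpha> X^\<beta> h; the remainder after n steps looks up h at
  exponents that eventually lie below its support. Stating the result for all large n avoids
  infinite sums and lets two expansions be compared at a common n.\<close>

lemma co_geometric_series: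
  assumes s: "small \<alpha> \<beta>"
  shows "\<exists>N. \<forall>n\<ge>N. co (inverse (1 - monomial c \<alpha> \<beta>)) a i =
    (\<Sum>k<n. if a = int k * \<alpha> \<and> i = int k * \<beta> then c ^ k else 0)"
proof -
  define h where "h = inverse (1 - monomial c \<alpha> \<beta>)"
  have "(1 - monomial c \<alpha> \<beta>) * h = 1"
    unfolding h_def using one_minus_monomial_nonzero[OF s] by (rule right_inverse)
  then have h: "1 + monomial c \<alpha> \<beta> * h = h"
    by (simp add: left_diff_distrib diff_eq_eq)
  have rec: "co h a i = (if a = 0 \<and> i = 0 then 1 else 0) + c * co h (a - \<alpha>) (i - \<beta>)" for a i
    by (subst h[symmetric]) (simp only: fls_plus_nth co_1 co_monomial_mult)
  have iter: "co h a i = (\<Sum>k<n. if a = int k * \<alpha> \<and> i = int k * \<beta> then c ^ k else 0) +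
      c ^ n * co h (a - int n * \<alpha>) (i - int n * \<beta>)" for n
  proof (induction n)
    case (Suc n)
    have "co h (a - int n * \<alpha>) (i - int n * \<beta>) =
        (if a = int n * \<alpha> \<and> i = int n * \<beta> then 1 else 0) +
        c * co h (a - int (Suc n) * \<alpha>) (i - int (Suc n) * \<beta>)"
      by (subst rec) (simp add: algebra_simps)
    then show ?case
      unfolding Suc.IH by (simp add: distrib_left)
  qed simp
  obtain N where N: "\<And>n. n \<ge> N \<Longrightarrow> co h (a - int n * \<alpha>) (i - int n * \<beta>) = 0"
    using co_eventually_0[OF s] by blast
  show ?thesis
  proof (intro exI allI impI)
    fix n assume "n \<ge> N"
    from N[OF this] show "co (inverse (1 - monomial c \<alpha> \<beta>)) a i =
        (\<Sum>k<n. if a = int k * \<alpha> \<and> i = int k * \<beta> then c ^ k else 0)"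
      using iter[of n] by (simp add: h_def)
  qed
qed

lemma transport_one_minus_monomial:
  assumes "e * e = 1" "\<sigma> 0 = 1"
  shows "transport w e \<sigma> (1 - monomial c \<alpha> \<beta>) (1 - monomial (\<sigma> \<beta> * c) (\<alpha> + w * \<beta>) (e * \<beta>))"
  using transport_diff[OF transport_monomial[OF assms(1), where c = 1 and \<alpha> = 0 and \<beta> = 0 and \<sigma> = \<sigma>]
      transport_monomial[OF assms(1), where \<sigma> = \<sigma>]] assms(2)
  by (simp add: monomial_1)

text \<open>Both the monomial and its image must be small. For 1/(1 - t X^2) this holds under X ->
  q^{1/2} X^{-1} but fails under X -> X^{-1}.\<close>

lemma transport_geometric_series:
  assumes s: "small \<alpha> \<beta>" "small (\<alpha> + w * \<beta>) (e * \<beta>)" and e: "e * e = 1"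
    and \<sigma>: "\<And>i j. \<sigma> (i + j) = \<sigma> i * \<sigma> j" "\<sigma> 0 = 1"
  shows "transport w e \<sigma> (inverse (1 - monomial c \<alpha> \<beta>))
    (inverse (1 - monomial (\<sigma> \<beta> * c) (\<alpha> + w * \<beta>) (e * \<beta>)))"
  unfolding transport_def
proof (intro allI)
  fix a i
  obtain N where N: "\<And>n. n \<ge> N \<Longrightarrow> co (inverse (1 - monomial c \<alpha> \<beta>)) a i =
    (\<Sum>k<n. if a = int k * \<alpha> \<and> i = int k * \<beta> then c ^ k else 0)"
    using co_geometric_series[OF s(1), of c a i] by blast
  obtain N' where N': "\<And>n. n \<ge> N' \<Longrightarrow>
      co (inverse (1 - monomial (\<sigma> \<beta> * c) (\<alpha> + w * \<beta>) (e * \<beta>))) (a + w * i) (e * i) =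
    (\<Sum>k<n. if a + w * i = int k * (\<alpha> + w * \<beta>) \<and> e * i = int k * (e * \<beta>) then (\<sigma> \<beta> * c) ^ k else 0)"
    using co_geometric_series[OF s(2), of "\<sigma> \<beta> * c" "a + w * i" "e * i"] by blast
  have \<sigma>_pow: "\<sigma> (int k * \<beta>) = \<sigma> \<beta> ^ k" for k
    by (induction k) (simp_all add: \<sigma> distrib_right)
  have e0: "e \<noteq> 0"
    using e by auto
  have iff: "a + w * i = int k * (\<alpha> + w * \<beta>) \<and> e * i = int k * (e * \<beta>) \<longleftrightarrow> a = int k * \<alpha> \<and> i = int k * \<beta>" for k
  proof -
    have "e * i = int k * (e * \<beta>) \<longleftrightarrow> i = int k * \<beta>"
      using e0 by (simp add: mult.left_commute)
    moreover have "a + w * (int k * \<beta>) = int k * (\<alpha> + w * \<beta>) \<longleftrightarrow> a = int k * \<alpha>"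
      by (simp add: distrib_left mult.left_commute)
    ultimately show ?thesis
      by auto
  qed
  have "(\<sigma> \<beta> * c) ^ k = \<sigma> i * c ^ k" if "i = int k * \<beta>" for k
    using that by (simp add: \<sigma>_pow power_mult_distrib)
  then show "co (inverse (1 - monomial (\<sigma> \<beta> * c) (\<alpha> + w * \<beta>) (e * \<beta>))) (a + w * i) (e * i) =
      \<sigma> i * co (inverse (1 - monomial c \<alpha> \<beta>)) a i"
    unfolding N[OF max.cobounded1[of N N']] N'[OF max.cobounded2[of N' N]] sum_distrib_left iff
    by (intro sum.cong) auto
qed

section \<open>Congruences modulo powers of u\<close>

definition vanish :: "int \<Rightarrow> 'a::zero fls \<Rightarrow> bool" where
  "vanish n f \<longleftrightarrow> (\<forall>a<n. f $$ a = 0)"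

lemma vanish_mult:
  fixes f g :: "'a::semiring_0 fls"
  assumes "vanish m f" "vanish n g"
  shows "vanish (m + n) (f * g)"
  unfolding vanish_def
proof (intro allI impI)
  fix a assume a: "a < m + n"
  have "f $$ b = 0 \<or> g $$ (a - b) = 0" for b
    using assms a unfolding vanish_def by (cases "b < m") auto
  then show "(f * g) $$ a = 0"
    using fls_mult_nth_superset[of "{}" f g a] by auto
qed

lemma vanish_mono: "vanish n f \<Longrightarrow> m \<le> n \<Longrightarrow> vanish m f"
  by (simp add: vanish_def)

lemma vanish_add: "vanish n f \<Longrightarrow> vanish n g \<Longrightarrow> vanish n (f + g :: 'a::monoid_add fls)"
  by (simp add: vanish_def)

lemma vanish_geometric_series:
  assumes "small \<alpha> \<beta>"
  shows "vanish 0 (inverse (1 - monomial c \<alpha> \<beta>))"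
  unfolding vanish_def
proof (intro allI impI fls_eqI)
  fix a i :: int assume a: "a < 0"
  obtain N where N: "\<And>n. n \<ge> N \<Longrightarrow> co (inverse (1 - monomial c \<alpha> \<beta>)) a i =
    (\<Sum>k<n. if a = int k * \<alpha> \<and> i = int k * \<beta> then c ^ k else 0)"
    using co_geometric_series[OF assms, of c a i] by blast
  have "a \<noteq> int k * \<alpha>" for k
  proof -
    have "int k * \<alpha> \<ge> 0"
      using assms by (auto simp: small_def)
    with a show ?thesis
      by linarith
  qed
  then show "co (inverse (1 - monomial c \<alpha> \<beta>)) a i = 0 $$ i"
    using N[of N] by simp
qed

definition one_mod :: "int \<Rightarrow> 'a::comm_ring_1 fls \<Rightarrow> bool" where
  "one_mod n f \<longleftrightarrow> vanish n (f - 1)"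

lemma one_mod_vanish:
  assumes "one_mod n f" "n \<ge> 0"
  shows "vanish 0 f"
  unfolding vanish_def
proof (intro allI impI)
  fix a :: int assume "a < 0"
  with assms have "(f - 1) $$ a = 0"
    unfolding one_mod_def vanish_def by simp
  with \<open>a < 0\<close> show "f $$ a = 0"
    by simp
qed

lemma one_mod_mult:
  assumes "one_mod n f" "one_mod n g" "n \<ge> 0"
  shows "one_mod n (f * g)"
proof -
  have eq: "f * g - 1 = (f - 1) * g + (g - 1)"
    by (simp add: algebra_simps)
  moreover have "vanish n ((f - 1) * g)"
    using vanish_mult[of n "f - 1" 0 g] assms one_mod_vanish by (auto simp: one_mod_def)
  ultimately show ?thesis
    using assms(2) unfolding one_mod_def eq by (simp only: vanish_add)
qed

lemma vanish_monomial: "vanish \<alpha> (monomial c \<alpha> \<beta>)"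
  unfolding vanish_def by (intro allI impI fls_eqI) (simp add: co_monomial)

lemma one_mod_one_minus_monomial: "one_mod \<alpha> (1 - monomial c \<alpha> \<beta>)"
  using vanish_monomial[of \<alpha> c \<beta>] by (simp add: one_mod_def vanish_def)

lemma one_mod_geometric_series:
  assumes "small \<alpha> \<beta>"
  shows "one_mod \<alpha> (inverse (1 - monomial c \<alpha> \<beta>))"
proof -
  define h where "h = inverse (1 - monomial c \<alpha> \<beta>)"
  have "(1 - monomial c \<alpha> \<beta>) * h = 1"
    unfolding h_def using one_minus_monomial_nonzero[OF assms] by (rule right_inverse)
  then have "h - 1 = monomial c \<alpha> \<beta> * h"
    by (simp add: algebra_simps)
  then show ?thesis
    using vanish_mult[OF vanish_monomial vanish_geometric_series[OF assms], of \<alpha> c \<beta> c]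
    by (simp add: one_mod_def h_def)
qed

section \<open>The infinite product\<close>

lemma transport_1_mult:
  assumes "transport w e (\<lambda>_. 1) f g" "transport w e (\<lambda>_. 1) f' g'" "e * e = 1"
  shows "transport w e (\<lambda>_. 1) (f * f') (g * g')"
  using assms by (rule transport_mult) simp_all

lemma transport_self_prod:
  assumes "\<And>j. j \<in> S \<Longrightarrow> transport w e \<sigma> (f j) (f j)" and e: "e * e = 1"
    and \<sigma>: "\<And>i j. \<sigma> (i + j) = \<sigma> i * \<sigma> j" "\<sigma> 0 = 1" "\<And>i. \<sigma> i \<noteq> 0"
  shows "transport w e \<sigma> (prod f S) (prod f S)"
  using assms(1)
proof (induction S rule: infinite_finite_induct)
  case (insert x S)
  then have "transport w e \<sigma> (f x * prod f S) (f x * prod f S)"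
    by (intro transport_mult[OF _ _ e, of w \<sigma> _ _ \<sigma>]) (simp_all add: \<sigma>)
  with insert show ?case
    by simp
qed (use e \<sigma>(2) in \<open>auto simp: transport_def\<close>)

text \<open>The denominator is kept as a product of two inverses, so that each one is a geometric
  series in a small monomial.\<close>

definition mu_factor :: "'a::field \<Rightarrow> nat \<Rightarrow> 'a fls fls" where
  "mu_factor t j = (1 - monomial 1 (4 * int j) 2) * (1 - monomial 1 (4 * int (Suc j)) (- 2)) *
     (inverse (1 - monomial t (4 * int j) 2) * inverse (1 - monomial t (4 * int (Suc j)) (- 2)))"

lemma small_mu: "small (4 * int j) 2" "small (4 * int (Suc j)) \<beta>"
  by (auto simp: small_def)

text \<open>X^2 and q X^{-2} are exchanged, hence so are the two halves of each factor.\<close>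

lemma transport_mu_factor_pi: "transport 2 (- 1) (\<lambda>_. 1) (mu_factor t j) (mu_factor t j)"
proof -
  let ?a = "1 - monomial 1 (4 * int j) 2" and ?b = "1 - monomial 1 (4 * int (Suc j)) (- 2)"
  let ?A = "inverse (1 - monomial t (4 * int j) 2)"
    and ?B = "inverse (1 - monomial t (4 * int (Suc j)) (- 2))"
  have exponents: "4 * int j + 2 * 2 = 4 * int (Suc j)" "4 * int (Suc j) + 2 * (- 2) = 4 * int j"
    "- 1 * 2 = (- 2 :: int)" "- 1 * (- 2) = (2 :: int)"
    by simp_all
  have "transport 2 (- 1) (\<lambda>_. 1) ?a ?b" "transport 2 (- 1) (\<lambda>_. 1) ?b ?a"
    using transport_one_minus_monomial[of "- 1" "\<lambda>_. 1" 2 1 "4 * int j" 2]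
      transport_one_minus_monomial[of "- 1" "\<lambda>_. 1" 2 1 "4 * int (Suc j)" "- 2"]
    unfolding exponents by simp_all
  moreover have "transport 2 (- 1) (\<lambda>_. 1) ?A ?B" "transport 2 (- 1) (\<lambda>_. 1) ?B ?A"
    using transport_geometric_series[of "4 * int j" 2 2 "- 1" "\<lambda>_. 1" t]
      transport_geometric_series[of "4 * int (Suc j)" "- 2" 2 "- 1" "\<lambda>_. 1" t]
    unfolding exponents by (simp_all add: small_mu del: of_nat_Suc)
  ultimately have "transport 2 (- 1) (\<lambda>_. 1) (?a * ?b * (?A * ?B)) (?b * ?a * (?B * ?A))"
    by (intro transport_1_mult) simp_all
  then show ?thesis
    by (simp only: mu_factor_def mult.commute[of ?a ?b] mult.commute[of ?A ?B])
qed

text \<open>The sign of the substitution X -> -X; invariance under it yields the vanishing of all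
  odd coefficients.\<close>

definition parity_sign :: "int \<Rightarrow> 'a::field" where
  "parity_sign i = (if even i then 1 else - 1)"

lemma parity_sign: "parity_sign (i + j) = parity_sign i * parity_sign j" "parity_sign 0 = 1"
  "parity_sign i \<noteq> 0"
  by (auto simp: parity_sign_def)

lemma transport_mu_factor_parity: "transport 0 1 parity_sign (mu_factor t j) (mu_factor t j)"
proof -
  have 1: "transport 0 1 parity_sign (1 - monomial 1 \<alpha> \<beta>) (1 - monomial 1 \<alpha> \<beta>)" if "even \<beta>" for \<alpha> \<beta>
    using transport_one_minus_monomial[of 1 parity_sign 0 1 \<alpha> \<beta>] that
    by (simp add: parity_sign_def)
  have 2: "transport 0 1 parity_sign (inverse (1 - monomial t \<alpha> \<beta>)) (inverse (1 - monomial t \<alpha> \<beta>))"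
    if "even \<beta>" "small \<alpha> \<beta>" for \<alpha> \<beta>
    using transport_geometric_series[of \<alpha> \<beta> 0 1 parity_sign t] that
    by (simp add: parity_sign(1)) (simp add: parity_sign_def)
  have mult: "transport 0 1 parity_sign (f * g) (f * g)"
    if "transport 0 1 parity_sign f f" "transport 0 1 parity_sign g g" for f g :: "'a fls fls"
    using that by (rule transport_mult) (simp_all add: parity_sign)
  show ?thesis
    unfolding mu_factor_def by (intro mult 1 2 small_mu) simp_all
qed

definition mu_partial :: "'a::field \<Rightarrow> nat \<Rightarrow> 'a fls fls" where
  "mu_partial t N = (\<Prod>j\<le>N. mu_factor t j)"

text \<open>The second half of factor j of mu, regrouped with the first half of factor j +
  1.\<close>

definition symmetric_factor :: "'a::field \<Rightarrow> nat \<Rightarrow> 'a fls fls" where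
  "symmetric_factor t j = (1 - monomial 1 (4 * int (Suc j)) 2) * (1 - monomial 1 (4 * int (Suc j)) (- 2)) *
     (inverse (1 - monomial t (4 * int (Suc j)) 2) * inverse (1 - monomial t (4 * int (Suc j)) (- 2)))"

lemma transport_symmetric_factor: "transport 0 (- 1) (\<lambda>_. 1) (symmetric_factor t j) (symmetric_factor t j)"
proof -
  define \<alpha> where "\<alpha> = 4 * int (Suc j)"
  let ?a = "1 - monomial 1 \<alpha> 2" and ?b = "1 - monomial 1 \<alpha> (- 2)"
  let ?A = "inverse (1 - monomial t \<alpha> 2)" and ?B = "inverse (1 - monomial t \<alpha> (- 2))"
  have small: "small \<alpha> 2" "small \<alpha> (- 2)"
    unfolding \<alpha>_def by (rule small_mu)+
  have "transport 0 (- 1) (\<lambda>_. 1) ?a ?b" "transport 0 (- 1) (\<lambda>_. 1) ?b ?a"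
    using transport_one_minus_monomial[of "- 1" "\<lambda>_. 1" 0 1 \<alpha> 2]
      transport_one_minus_monomial[of "- 1" "\<lambda>_. 1" 0 1 \<alpha> "- 2"] by simp_all
  moreover have "transport 0 (- 1) (\<lambda>_. 1) ?A ?B" "transport 0 (- 1) (\<lambda>_. 1) ?B ?A"
    using transport_geometric_series[of \<alpha> 2 0 "- 1" "\<lambda>_. 1" t]
      transport_geometric_series[of \<alpha> "- 2" 0 "- 1" "\<lambda>_. 1" t] small by simp_all
  ultimately have "transport 0 (- 1) (\<lambda>_. 1) (?a * ?b * (?A * ?B)) (?b * ?a * (?B * ?A))"
    by (intro transport_1_mult) simp_all
  then show ?thesis
    by (simp only: symmetric_factor_def \<alpha>_def mult.commute[of "1 - monomial 1 _ 2"]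
        mult.commute[of "inverse (1 - monomial t _ 2)"])
qed

text \<open>The product over $j \le N$ is symmetric under $X \mapsto X^{-1}$ up to its first and last factors.\<close>

lemma mu_partial_symmetric:
  "(1 - monomial t 0 2) * mu_partial t N = (1 - monomial 1 0 2) * (\<Prod>j<N. symmetric_factor t j) *
    ((1 - monomial 1 (4 * int (Suc N)) (- 2)) * inverse (1 - monomial t (4 * int (Suc N)) (- 2)))"
proof (induction N)
  case 0
  have "(1 - monomial t 0 2) * inverse (1 - monomial t 0 2) = 1"
    using one_minus_monomial_nonzero small_mu(1)[of 0] by (intro right_inverse) simp
  moreover have "A * (p * q * (A' * r)) = A * A' * (p * (q * r))" for A A' p q r :: "'a fls fls"
    by (simp add: mult_ac)
  ultimately show ?case
    unfolding mu_partial_def mu_factor_def by simp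
next
  case (Suc N)
  have "(1 - monomial t 0 2) * mu_partial t (Suc N) = (1 - monomial t 0 2) * mu_partial t N * mu_factor t (Suc N)"
    by (simp add: mu_partial_def mult_ac)
  then show ?case
    unfolding Suc mu_factor_def prod.lessThan_Suc symmetric_factor_def by (simp only: mult_ac)
qed

lemma one_mod_mu_factor: "one_mod (4 * int j) (mu_factor t j)"
proof -
  have "4 * int j \<le> 4 * int (Suc j)"
    by simp
  then have mono: "one_mod (4 * int j) f" if "one_mod (4 * int (Suc j)) f" for f :: "'a fls fls"
    using that unfolding one_mod_def by (rule vanish_mono[rotated])
  show ?thesis
    unfolding mu_factor_def
    by (intro one_mod_mult one_mod_one_minus_monomial one_mod_geometric_series small_mu
        mono[OF one_mod_one_minus_monomial] mono[OF one_mod_geometric_series]) simp_all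
qed

lemma vanish_mu_partial: "vanish 0 (mu_partial t N)"
proof (induction N)
  case 0
  then show ?case
    using one_mod_vanish[OF one_mod_mu_factor[of 0 t]] by (simp add: mu_partial_def)
next
  case (Suc N)
  then show ?case
    using vanish_mult[OF Suc one_mod_vanish[OF one_mod_mu_factor[of "Suc N" t]]]
    by (simp add: mu_partial_def mult.commute)
qed

lemma nth_eq_if_one_mod:
  fixes f g :: "'a::comm_ring_1 fls"
  assumes "vanish 0 f" "one_mod n g" "a < n"
  shows "(f * g) $$ a = f $$ a"
proof -
  have "vanish (0 + n) (f * (g - 1))"
    using assms by (intro vanish_mult) (simp_all add: one_mod_def)
  then have "(f * (g - 1)) $$ a = 0"
    using assms(3) by (simp add: vanish_def)
  then show ?thesis
    by (simp add: right_diff_distrib)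
qed

lemma mu_partial_stable:
  assumes "a < 4 * int (Suc N)" "N \<le> N'"
  shows "mu_partial t N' $$ a = mu_partial t N $$ a"
  using assms(2)
proof (induction N' rule: dec_induct)
  case (step k)
  have "mu_partial t (Suc k) = mu_partial t k * mu_factor t (Suc k)"
    by (simp add: mu_partial_def mult.commute)
  moreover have "a < 4 * int (Suc k)"
    using assms step by simp
  ultimately show ?case
    using step.IH by (simp only: nth_eq_if_one_mod[OF vanish_mu_partial one_mod_mu_factor])
qed simp

text \<open>A diagonal construction: since factor j is 1 modulo u^{4j}, the coefficient of u^n no
  longer changes after the n-th partial product.\<close>

definition mu_limit :: "'a::field \<Rightarrow> 'a fls fls" where
  "mu_limit t = fps_to_fls (Abs_fps (\<lambda>n. mu_partial t n $$ int n))"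

lemma mu_limit_nth:
  assumes "a \<le> int N"
  shows "mu_limit t $$ a = mu_partial t N $$ a"
proof (cases "a < 0")
  case True
  then show ?thesis
    using vanish_mu_partial[of t N] by (simp add: mu_limit_def vanish_def)
next
  case False
  then have "mu_limit t $$ a = mu_partial t (nat a) $$ a"
    by (simp add: mu_limit_def)
  also have "\<dots> = mu_partial t N $$ a"
    using False assms by (intro mu_partial_stable[symmetric]) auto
  finally show ?thesis .
qed

lemma dist_fls_le:
  fixes f g :: "'a::group_add fls"
  assumes "\<And>a. a < int n \<Longrightarrow> f $$ a = g $$ a"
  shows "dist f g \<le> inverse (2 ^ n)"
proof (cases "f = g")
  case False
  then have "fls_subdegree (f - g) \<ge> int n"
    using assms by (intro fls_subdegree_geI) auto
  then show ?thesis
    using False by (simp add: dist_fls_def power_increasing)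
qed simp

lemma inverse_power_2_less:
  assumes "(e::real) > 0"
  obtains n where "inverse (2 ^ n) < e"
  using assms real_arch_pow_inv[of e "1 / 2"] by (auto simp: power_one_over inverse_eq_divide)

lemma mu_partial_tendsto: "mu_partial t \<longlonglongrightarrow> mu_limit t"
proof (rule metric_LIMSEQ_I)
  fix e :: real assume "e > 0"
  then obtain n where n: "inverse (2 ^ n) < e"
    by (rule inverse_power_2_less)
  have "dist (mu_partial t N) (mu_limit t) < e" if "N \<ge> n" for N
  proof -
    have "dist (mu_partial t N) (mu_limit t) \<le> inverse (2 ^ n)"
      using that by (intro dist_fls_le mu_limit_nth[symmetric]) simp
    with n show ?thesis
      by simp
  qed
  then show "\<exists>no. \<forall>n\<ge>no. dist (mu_partial t n) (mu_limit t) < e"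
    by blast
qed

text \<open>Modulo u^4 the product is (1 - X^2)/(1 - t X^2). The resulting nonvanishing serves
  twice: for convergence of the infinite product and for dividing by the constant term.\<close>

lemma co_mu_limit_0: "co (mu_limit t) 0 0 = 1"
proof -
  let ?f = "mu_partial t 0"
  let ?g = "(1 - monomial 1 (4 * int (Suc 0)) (- 2)) * inverse (1 - monomial t (4 * int (Suc 0)) (- 2))"
  have 1: "one_mod (4 * int (Suc 0)) ?g"
    by (intro one_mod_mult one_mod_one_minus_monomial one_mod_geometric_series small_mu) simp
  have 2: "vanish 0 (1 - monomial (1::'a) 0 2)"
    by (rule one_mod_vanish[OF one_mod_one_minus_monomial]) simp
  have "((1 - monomial 1 0 2) * ?g) $$ 0 = (1 - monomial 1 0 2) $$ 0"
    by (rule nth_eq_if_one_mod[OF 2 1]) simp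
  then have "((1 - monomial t 0 2) * ?f) $$ 0 = (1 - monomial 1 0 2) $$ 0"
    unfolding mu_partial_symmetric lessThan_0 prod.empty mult_1_right .
  then have "co ((1 - monomial t 0 2) * ?f) 0 i = co (1 - monomial 1 0 2) 0 i" for i
    by simp
  then have rec: "co ?f 0 i - t * co ?f 0 (i - 2) = (if i = 0 then 1 else 0) - (if i = 2 then 1 else 0)" for i
    by (simp add: left_diff_distrib co_monomial_mult co_monomial)
  \<comment> \<open>The recursion moves the coefficient of X^{-2} to arbitrarily negative exponents,
    where a Laurent series has none.\<close>
  have iter: "co ?f 0 (- 2) = t ^ n * co ?f 0 (- 2 - 2 * int n)" for n
  proof (induction n)
    case (Suc n)
    have "co ?f 0 (- 2 - 2 * int n) = t * co ?f 0 (- 2 - 2 * int (Suc n))"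
      using rec[of "- 2 - 2 * int n"] by (simp add: algebra_simps)
    then show ?case
      unfolding Suc.IH by simp
  qed simp
  obtain n where "co ?f 0 (- 2 - 2 * int n) = 0"
    using co_eventually_0[of 0 2 ?f 0 "- 2"] by (auto simp: small_def mult.commute)
  then have "co ?f 0 (- 2) = 0"
    using iter[of n] by simp
  then show ?thesis
    using rec[of 0] mu_limit_nth[of 0 0 t] by simp
qed

lemma mu_limit_transport:
  assumes "\<And>j. transport w e \<sigma> (mu_factor t j) (mu_factor t j)" "e * e = 1"
    and "\<And>i j. \<sigma> (i + j) = \<sigma> i * \<sigma> j" "\<sigma> 0 = 1" "\<And>i. \<sigma> i \<noteq> 0"
  shows "transport w e \<sigma> (mu_limit t) (mu_limit t)"
  unfolding transport_def
proof (intro allI)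
  fix a i
  define N where "N = max (nat a) (nat (a + w * i))"
  have "transport w e \<sigma> (mu_partial t N) (mu_partial t N)"
    unfolding mu_partial_def by (rule transport_self_prod) (use assms in auto)
  moreover have "a \<le> int N" "a + w * i \<le> int N"
    by (simp_all add: N_def)
  ultimately show "co (mu_limit t) (a + w * i) (e * i) = \<sigma> i * co (mu_limit t) a i"
    by (simp add: mu_limit_nth transport_def)
qed

lemma mu_limit_pi: "transport 2 (- 1) (\<lambda>_. 1) (mu_limit t) (mu_limit t)"
  by (rule mu_limit_transport) (simp_all add: transport_mu_factor_pi)

lemma mu_limit_parity: "transport 0 1 parity_sign (mu_limit t) (mu_limit t)"
  by (rule mu_limit_transport) (simp_all add: transport_mu_factor_parity parity_sign)

text \<open>The factor X^{-1} - t X removes the denominator 1 - t X^2, and modulo any power of u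
  what remains is X^{-1} - X times a symmetric product.\<close>

lemma mu_limit_antisymmetric:
  "transport 0 (- 1) (\<lambda>_. - 1) ((monomial 1 0 (- 1) - monomial t 0 1) * mu_limit t)
    ((monomial 1 0 (- 1) - monomial t 0 1) * mu_limit t)"
  unfolding transport_def
proof (intro allI)
  fix a i
  define N where "N = nat a"
  have N: "a \<le> int N" "a < 4 * int (Suc N)"
    by (simp_all add: N_def)
  define P where "P = (\<Prod>j<N. symmetric_factor t j)"
  let ?g = "(1 - monomial 1 (4 * int (Suc N)) (- 2)) * inverse (1 - monomial t (4 * int (Suc N)) (- 2))"
  have P: "transport 0 (- 1) (\<lambda>_. 1) P P"
    unfolding P_def by (rule transport_self_prod) (simp_all add: transport_symmetric_factor)
  have "vanish 0 (symmetric_factor t j)" for j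
  proof -
    have "one_mod (4 * int (Suc j)) (symmetric_factor t j)"
      unfolding symmetric_factor_def
      by (intro one_mod_mult one_mod_one_minus_monomial one_mod_geometric_series small_mu) simp_all
    then show ?thesis
      by (rule one_mod_vanish) simp
  qed
  then have "vanish 0 (\<Prod>j<M. symmetric_factor t j)" for M
  proof (induction M)
    case (Suc M)
    then show ?case
      using vanish_mult[of 0 "\<Prod>j<M. symmetric_factor t j" 0 "symmetric_factor t M"] by simp
  qed (simp add: vanish_def)
  then have "vanish 0 P"
    unfolding P_def .
  moreover have "vanish 0 (1 - monomial (1::'a) 0 2)"
    by (rule one_mod_vanish[OF one_mod_one_minus_monomial]) simp
  ultimately have "vanish 0 ((1 - monomial 1 0 2) * P)"
    using vanish_mult[of 0 "1 - monomial 1 0 2" 0 P] by simp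
  moreover have "one_mod (4 * int (Suc N)) ?g"
    by (intro one_mod_mult one_mod_one_minus_monomial one_mod_geometric_series small_mu) simp
  ultimately have "((1 - monomial t 0 2) * mu_partial t N) $$ a = ((1 - monomial 1 0 2) * P) $$ a"
    unfolding mu_partial_symmetric P_def[symmetric] using N(2) by (intro nth_eq_if_one_mod)
  then have "co ((1 - monomial t 0 2) * mu_partial t N) a i = co ((1 - monomial 1 0 2) * P) a i" for i
    by simp
  then have eq: "co (mu_limit t) a i - t * co (mu_limit t) a (i - 2) = co P a i - co P a (i - 2)" for i
    using mu_limit_nth[OF N(1), of t] by (simp add: left_diff_distrib co_monomial_mult)
  have sym: "co P a (- i) = co P a i" for i
    using P by (simp add: transport_def)
  have \<kappa>: "co ((monomial 1 0 (- 1) - monomial t 0 1) * mu_limit t) a i =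
      co (mu_limit t) a (i + 1) - t * co (mu_limit t) a (i + 1 - 2)" for i
    by (simp add: left_diff_distrib co_monomial_mult)
  have "co P a (- i + 1) = co P a (i - 1)" "co P a (- i + 1 - 2) = co P a (i + 1)"
    using sym[of "i - 1"] sym[of "i + 1"] by (simp_all add: algebra_simps)
  then have "co P a (- i + 1) - co P a (- i + 1 - 2) = - (co P a (i + 1) - co P a (i + 1 - 2))"
    by simp
  then show "co ((monomial 1 0 (- 1) - monomial t 0 1) * mu_limit t) (a + 0 * i) (- 1 * i) =
      - 1 * co ((monomial 1 0 (- 1) - monomial t 0 1) * mu_limit t) a i"
    unfolding mult_zero_left add_0_right mult_minus1 \<kappa> eq .
qed

section \<open>The infinite product as an element of the series field\<close>

lemma fls_const_field_homomorphism: "field_homomorphism (fls_const :: 'a::field \<Rightarrow> 'a fls)"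
  by (intro field_homomorphism.intro fls_const_homomorphism)

lemma monomial_eq:
  "monomial c \<alpha> \<beta> = q_quarter_series powi \<alpha> * X_series powi \<beta> * fls_const (fls_const c)"
proof -
  have "fls_const (fls_X powi \<beta> * fls_const c) = fls_const fls_X powi \<beta> * fls_const (fls_const c)"
    using field_homomorphism.hom_powi[OF fls_const_field_homomorphism, of fls_X \<beta>]
      ring_homomorphism.hom_mult[OF fls_const_homomorphism] by metis
  then show ?thesis
    by (simp only: monomial_def q_quarter_series_def X_series_def mult.assoc)
qed

abbreviation t_coeff :: "int poly fract" where
  "t_coeff \<equiv> (to_fract [:0, 1:])\<^sup>2"

lemma t_series: "t_half_series ^ 2 = fls_const (fls_const t_coeff)"
  by (simp add: t_half_series_def fls_const_power)

lemma mu_eq_mu_limit: "mu = mu_limit t_coeff"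
proof -
  have q: "(q_quarter_series ^ 4) ^ k = q_quarter_series powi (4 * int k)" for k
    using power_int_of_nat[of q_quarter_series "4 * k"] by (simp add: power_mult)
  have factor: "mu_factor t_coeff j = ((1 - (q_quarter_series ^ 4) ^ j * X_series powi 2) *
        (1 - (q_quarter_series ^ 4) ^ (j + 1) * X_series powi (- 2))) /
      ((1 - t_half_series\<^sup>2 * (q_quarter_series ^ 4) ^ j * X_series powi 2) *
        (1 - t_half_series\<^sup>2 * (q_quarter_series ^ 4) ^ (j + 1) * X_series powi (- 2)))" for j
    unfolding mu_factor_def monomial_eq q t_series Suc_eq_plus1 divide_inverse inverse_mult_distrib
    by (simp only: mult.commute[of "fls_const (fls_const _)"] mult.assoc fls_const_1 mult_1_right)
  \<comment> \<open>\<open>has_prod\<close> demands a nonzero limit when no initial factors are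
    split off.\<close>
  have nonzero: "mu_limit t_coeff \<noteq> 0"
    using co_mu_limit_0[of t_coeff] by auto
  have "(\<lambda>n. \<Prod>i\<le>n. mu_factor t_coeff (i + 0)) \<longlonglongrightarrow> mu_limit t_coeff"
    using mu_partial_tendsto[of t_coeff] by (simp add: mu_partial_def[abs_def])
  with nonzero have "mu_factor t_coeff has_prod mu_limit t_coeff"
    unfolding has_prod_def raw_has_prod_def by blast
  then have "prodinf (mu_factor t_coeff) = mu_limit t_coeff"
    by (rule has_prod_unique[symmetric])
  moreover have "mu = prodinf (mu_factor t_coeff)"
    unfolding mu_def Let_def factor[abs_def] ..
  ultimately show ?thesis
    by simp
qed

section \<open>Constant terms and the coefficients of mu_k^0\<close>

lemma co_const_term: "co (const_term f) a i = (if i = 0 then co f a 0 else 0)"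
  by (simp add: const_term.rep_eq)

lemma const_term_add: "const_term (f + g) = const_term f + const_term (g :: 'a::field fls fls)"
  by (rule series_eqI) (simp add: co_const_term)

lemma const_term_const_mult:
  assumes "const_term c = c"
  shows "const_term (c * f) = c * const_term (f :: 'a::field fls fls)"
proof (rule series_eqI)
  fix a i
  have c: "c $$ b = fls_const (co c b 0)" for b
  proof (rule fls_eqI)
    fix i
    show "co c b i = fls_const (co c b 0) $$ i"
      using co_const_term[of c b i] unfolding assms by (cases "i = 0") simp_all
  qed
  have pointwise: "(c $$ b * g) $$ i = co c b 0 * g $$ i" for b g i
  proof -
    obtain k where "c $$ b = fls_const k"
      using c by blast
    then show ?thesis
      by simp
  qed
  have sum_nth: "(\<Sum>b\<in>B. h b) $$ i = (\<Sum>b\<in>B. h b $$ i)" for h :: "int \<Rightarrow> 'a fls" and B i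
    by (induction B rule: infinite_finite_induct) simp_all
  define B where "B = {b. c $$ b \<noteq> 0 \<and> f $$ (a - b) \<noteq> 0}"
  have B: "finite B" "{b. c $$ b \<noteq> 0 \<and> f $$ (a - b) \<noteq> 0} \<subseteq> B"
    "{b. c $$ b \<noteq> 0 \<and> const_term f $$ (a - b) \<noteq> 0} \<subseteq> B"
    using finite_fls_mult_support[of c f a] by (auto simp: B_def const_term.rep_eq)
  have "co (c * f) a 0 = (\<Sum>b\<in>B. co c b 0 * co f (a - b) 0)"
    unfolding fls_mult_nth_superset[OF B(1,2)] sum_nth pointwise ..
  moreover have "co (c * const_term f) a i = (\<Sum>b\<in>B. co c b 0 * co (const_term f) (a - b) i)"
    unfolding fls_mult_nth_superset[OF B(1,3)] sum_nth pointwise ..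
  ultimately show "co (const_term (c * f)) a i = co (c * const_term f) a i"
    by (simp add: co_const_term)
qed

lemma const_term_const_term: "const_term (const_term f) = const_term f"
  by (rule series_eqI) (simp add: co_const_term)

lemma const_term_fls_const_const: "const_term (fls_const (fls_const c)) = fls_const (fls_const c)"
  by (rule series_eqI) (simp add: co_const_term)

lemma const_term_1: "const_term 1 = (1 :: 'a::field fls fls)"
  using const_term_fls_const_const[of 1] by simp

lemma const_term_mult_closed:
  "const_term c = c \<Longrightarrow> const_term d = d \<Longrightarrow> const_term (c * d) = c * (d :: 'a::field fls fls)"
  by (simp add: const_term_const_mult)

lemma const_term_inverse_closed:
  assumes "const_term c = (c :: 'a::field fls fls)"
  shows "const_term (inverse c) = inverse c"
proof (cases "c = 0")
  case True
  then show ?thesis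
    using assms by simp
next
  case False
  then have "c * const_term (inverse c) = 1"
    using const_term_const_mult[OF assms, of "inverse c"] by (simp add: const_term_1)
  then show ?thesis
    by (metis inverse_unique)
qed

lemma const_term_q_quarter_series: "const_term q_quarter_series = q_quarter_series"
  by (rule series_eqI) (simp add: co_const_term q_quarter_series_def)

lemma const_term_eval_int_poly2:
  "const_term (eval_int_poly2 q_quarter_series t_half_series p) = eval_int_poly2 q_quarter_series t_half_series p"
proof (induction p)
  case 0
  show ?case
    by (rule series_eqI) (simp add: co_const_term eval_int_poly2_def)
next
  case (pCons c p)
  then show ?case
    unfolding eval_int_poly2_pCons t_half_series_int_poly
    by (simp only: const_term_add const_term_fls_const_const
        const_term_mult_closed[OF const_term_q_quarter_series])
qed

lemma const_term_to_series: "const_term (to_series r) = to_series r"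
  unfolding to_series_def eval_ratfun_def case_prod_unfold divide_inverse
  by (intro const_term_mult_closed const_term_inverse_closed const_term_eval_int_poly2)

lemma const_term_to_series_mult: "const_term (to_series r * f) = to_series r * const_term f"
  by (rule const_term_const_mult[OF const_term_to_series])

lemma transport_const:
  assumes "const_term c = c" "\<sigma> 0 = 1" "e \<noteq> 0"
  shows "transport w e \<sigma> c c"
proof -
  have "co c a i = 0" if "i \<noteq> 0" for a i
    using co_const_term[of c a i] that unfolding assms(1) by simp
  then have "co c (a + w * i) (e * i) = \<sigma> i * co c a i" for a i
    using assms(2,3) by (cases "i = 0") simp_all
  then show ?thesis
    unfolding transport_def by blast
qed

text \<open>The normalizing factor does not involve X, so all symmetries of mu pass to
  mu_k^0.\<close>

definition mu_const :: series where "mu_const = inverse (const_term mu)"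

lemma const_term_mu_const: "const_term mu_const = mu_const"
  unfolding mu_const_def by (intro const_term_inverse_closed const_term_const_term)

lemma mu0_eq: "mu0 = mu_const * mu"
  by (simp add: mu0_def mu_const_def divide_inverse)

lemma const_term_mu0: "const_term mu0 = 1"
proof -
  have "co (const_term mu) 0 0 = 1"
    by (simp add: co_const_term mu_eq_mu_limit co_mu_limit_0)
  then have "const_term mu \<noteq> 0"
    by auto
  then show ?thesis
    unfolding mu0_eq const_term_const_mult[OF const_term_mu_const] by (simp add: mu_const_def)
qed

lemma co_mu0_pi: "co mu0 (a + 2 * i) (- i) = co mu0 a i"
proof -
  have "transport 2 (- 1) (\<lambda>_. 1) mu0 mu0"
    unfolding mu0_eq mu_eq_mu_limit
    using transport_const[OF const_term_mu_const] mu_limit_pi by (intro transport_1_mult) simp_all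
  then show ?thesis
    by (simp add: transport_def)
qed

lemma co_mu0_odd:
  assumes "odd i"
  shows "co mu0 a i = 0"
proof -
  have "transport 0 1 parity_sign mu0 mu0"
    unfolding mu0_eq mu_eq_mu_limit
  proof (rule transport_mult[OF _ mu_limit_parity])
    show "transport 0 1 parity_sign mu_const mu_const"
      by (rule transport_const[OF const_term_mu_const]) (simp_all add: parity_sign)
  qed (simp_all add: parity_sign)
  then have "co mu0 (a + 0 * i) (1 * i) = parity_sign i * co mu0 a i"
    unfolding transport_def by blast
  then have "co mu0 a i = - co mu0 a i"
    using assms by (simp only: parity_sign_def if_False mult_minus1 mult_zero_left mult_1_left add_0_right)
  then show ?thesis
    by simp
qed

lemma co_mu0_symmetry:
  "co mu0 a (- j) - t_coeff * co mu0 a j = t_coeff * co mu0 a (- j - 2) - co mu0 a (j + 2)"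
proof -
  let ?f = "monomial 1 0 (- 1) - monomial t_coeff 0 1"
  have "transport 0 (- 1) (\<lambda>_. - 1) (mu_const * (?f * mu)) (mu_const * (?f * mu))"
    unfolding mu_eq_mu_limit
    by (rule transport_mult[OF transport_const[OF const_term_mu_const, of "\<lambda>_. 1"] mu_limit_antisymmetric])
      simp_all
  also have "mu_const * (?f * mu) = ?f * mu0"
    by (simp add: mu0_eq mult_ac)
  finally have antisym: "co (?f * mu0) a (- (j + 1)) = - co (?f * mu0) a (j + 1)"
    unfolding transport_def by (metis mult_minus1 mult_zero_left add.right_neutral)
  have "co (?f * mu0) a i = co mu0 a (i + 1) - t_coeff * co mu0 a (i - 1)" for i
    by (simp add: left_diff_distrib co_monomial_mult)
  then show ?thesis
    using antisym by (simp only:) (simp add: algebra_simps)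
qed

lemma co_q_quarter_powi_mult: "co (q_quarter_series powi k * f) a i = co f (a - k) i"
  by (simp only: q_quarter_series_def fls_nth_X_powi_mult)

lemma co_X_powi_mult: "co (X_series powi k * f) a i = co f a (i - k)"
  using co_monomial_mult[of 1 0 k f a i] by (simp add: monomial_eq)

lemma co_t_mult: "co (t_half_series\<^sup>2 * f) a i = t_coeff * co f a i"
  unfolding t_series fls_mult_const_nth ..

lemma X_series_nonzero: "X_series \<noteq> 0"
  by (simp add: X_series_def)

definition mu0_coeff :: "int \<Rightarrow> series" where
  "mu0_coeff n = const_term (X_series powi (- n) * mu0)"

lemma co_mu0_coeff: "co (mu0_coeff n) a i = (if i = 0 then co mu0 a n else 0)"
  by (simp add: mu0_coeff_def co_const_term co_X_powi_mult)

lemma mu0_coeff_uminus: "mu0_coeff (- n) = q_quarter_series powi (2 * n) * mu0_coeff n"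
proof (rule series_eqI)
  fix a i
  have "co mu0 a (- n) = co mu0 (a - 2 * n) n"
    using co_mu0_pi[of "a - 2 * n" n] by simp
  then show "co (mu0_coeff (- n)) a i = co (q_quarter_series powi (2 * n) * mu0_coeff n) a i"
    by (simp add: co_mu0_coeff co_q_quarter_powi_mult)
qed

lemma mu0_coeff_symmetry:
  "mu0_coeff (- n) - t_half_series\<^sup>2 * mu0_coeff n = t_half_series\<^sup>2 * mu0_coeff (- n - 2) - mu0_coeff (n + 2)"
proof (rule series_eqI)
  fix a i
  show "co (mu0_coeff (- n) - t_half_series\<^sup>2 * mu0_coeff n) a i =
      co (t_half_series\<^sup>2 * mu0_coeff (- n - 2) - mu0_coeff (n + 2)) a i"
    using co_mu0_symmetry[of a n] by (simp add: co_t_mult co_mu0_coeff)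
qed

lemma mu0_coeff_odd: "odd n \<Longrightarrow> mu0_coeff n = 0"
  by (rule series_eqI) (simp add: co_mu0_coeff co_mu0_odd)

text \<open>Both sequences satisfy the same two symmetries. Eliminating the negative indices leaves
  a recursion from n to n + 2 whose leading factor t u^{2(n+2)} - 1 is nonzero; both start from 1 at
  n = 0.\<close>

lemma mu0_coeff_eq_weight: "mu0_coeff n = to_series (ratfun.weight n)"
proof -
  have even: "mu0_coeff (2 * int m) = to_series (ratfun.weight (2 * int m))" for m
  proof (induction m)
    case 0
    show ?case
      using const_term_mu0 by (simp add: mu0_coeff_def ratfun.weight_def ratfun.weight_nat_def to_series.hom_one)
  next
    case (Suc m)
    define n where "n = 2 * int m"
    have n: "- n - 2 = - (n + 2)" "2 * int (Suc m) = n + 2"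
      by (simp_all add: n_def)
    let ?t = "t_half\<^sup>2" and ?w = "q_quarter powi (2 * (n + 2))"
    have 1: "(to_series ?t * to_series ?w - 1) * mu0_coeff (n + 2) =
        (to_series (q_quarter powi (2 * n)) - to_series ?t) * mu0_coeff n"
    proof -
      have "to_series (q_quarter powi (2 * n)) * mu0_coeff n - to_series ?t * mu0_coeff n =
          to_series ?t * (to_series ?w * mu0_coeff (n + 2)) - mu0_coeff (n + 2)"
        using mu0_coeff_symmetry[of n] unfolding n(1) mu0_coeff_uminus
        by (simp only: to_series.hom_power to_series.hom_powi to_series_t_half to_series_q_quarter)
      then show ?thesis
        by (simp add: algebra_simps)
    qed
    have "q_quarter powi (2 * n) * ratfun.weight n - ?t * ratfun.weight n =
        ?t * (?w * ratfun.weight (n + 2)) - ratfun.weight (n + 2)"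
      using ratfun.weight_symmetry[of n] unfolding n(1) ratfun.weight_uminus .
    then have "(?t * ?w - 1) * ratfun.weight (n + 2) = (q_quarter powi (2 * n) - ?t) * ratfun.weight n"
      by (simp add: algebra_simps)
    then have "to_series ((?t * ?w - 1) * ratfun.weight (n + 2)) =
        to_series ((q_quarter powi (2 * n) - ?t) * ratfun.weight n)"
      by (rule arg_cong)
    then have 2: "(to_series ?t * to_series ?w - 1) * to_series (ratfun.weight (n + 2)) =
        (to_series (q_quarter powi (2 * n)) - to_series ?t) * to_series (ratfun.weight n)"
      by (simp only: to_series.hom_mult to_series.hom_diff to_series.hom_one)
    have "?t * ?w - 1 \<noteq> 0"
    proof
      assume "?t * ?w - 1 = 0"
      then have "q_quarter powi (2 * (n + 2)) * t_half powi 2 = 1"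
        by (simp add: mult.commute)
      from q_t_independent[OF this] show False
        by simp
    qed
    then have "to_series ?t * to_series ?w - 1 \<noteq> 0"
      using to_series.hom_eq_0_iff[of "?t * ?w - 1"]
      by (simp only: to_series.hom_mult to_series.hom_diff to_series.hom_one not_False_eq_True)
    with 1 2 Suc show ?case
      unfolding n(2) n_def[symmetric] by (metis mult_left_cancel)
  qed
  show ?thesis
  proof (cases "even n")
    case True
    then show ?thesis
    proof (cases rule: ratfun.even_int_cases)
      case (1 m)
      then show ?thesis
        by (simp only: even)
    next
      case (2 m)
      show ?thesis
        unfolding 2 mu0_coeff_uminus ratfun.weight_uminus even to_series.hom_mult to_series.hom_powi
          to_series_q_quarter ..
    qed
  next
    case False
    then show ?thesis
      by (simp add: mu0_coeff_odd ratfun.weight_odd to_series.hom_zero)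
  qed
qed

section \<open>Transfer of the algebraic theory to the series field\<close>

lemma laurent_series_eq: "laurent_series = lext to_series (\<lambda>n. X_series powi n)"
  by (rule ext) (simp add: laurent_series_def lext_def)

lemma laurent_series_mult: "laurent_series (f * g) = laurent_series f * laurent_series g"
  unfolding laurent_series_eq
  by (rule to_series.lext_mult) (simp add: power_int_add X_series_nonzero)

lemma laurent_series_single: "laurent_series (Poly_Mapping.single n c) = to_series c * X_series powi n"
  by (simp add: laurent_series_eq to_series.lext_single)

lemma const_term_laurent_series:
  "const_term (laurent_series f * g) = lext to_series (\<lambda>n. const_term (X_series powi n * g)) f"
proof (induction f rule: poly_mapping_single_induct)
  case (single n c)
  show ?case
    by (simp add: laurent_series_single to_series.lext_single mult.assoc const_term_to_series_mult)
next
  case (add f g)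
  then show ?case
    by (simp add: laurent_series_eq to_series.lext_add distrib_right const_term_add)
qed

lemma const_term_laurent_mu0: "const_term (laurent_series f * mu0) = to_series (ratfun.M f)"
proof -
  have "const_term (X_series powi n * mu0) = to_series (ratfun.weight (- n))" for n
    using mu0_coeff_eq_weight[of "- n"] by (simp add: mu0_coeff_def)
  then have "const_term (laurent_series f * mu0) = lext to_series (\<lambda>n. to_series (ratfun.weight (- n))) f"
    by (simp add: const_term_laurent_series)
  also have "\<dots> = to_series (ratfun.M f)"
    by (simp add: lext_def ratfun.M_def to_series.hom_sum to_series.hom_mult)
  finally show ?thesis .
qed

text \<open>Constant terms against mu_k^0 are images of values of \<open>M\<close> under the
  injective map \<open>to_series\<close>, so orthogonality means the same on both sides, and
  uniqueness applies.\<close>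

lemma is_nonsym_poly_iff: "is_nonsym_poly n e \<longleftrightarrow> e = ratfun.E n"
proof -
  have "const_term (laurent_series e * X_series powi (- m) * mu0) = 0 \<longleftrightarrow> ratfun.M (e * X (- m)) = 0" for m e
  proof -
    have "laurent_series e * X_series powi (- m) = laurent_series (e * X (- m))"
      by (simp only: laurent_series_mult laurent_series_single to_series.hom_one mult_1_left)
    then show ?thesis
      by (simp only: const_term_laurent_mu0 to_series.hom_eq_0_iff)
  qed
  then have iff: "is_nonsym_poly n e \<longleftrightarrow> Poly_Mapping.lookup e n = 1 \<and>
      (\<forall>m. Poly_Mapping.lookup e m \<noteq> 0 \<longrightarrow> m = n \<or> mon_less m n) \<and>
      (\<forall>m. mon_less m n \<longrightarrow> ratfun.M (e * X (- m)) = 0)" for e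
    unfolding is_nonsym_poly_def by presburger
  show ?thesis
  proof
    assume "is_nonsym_poly n e"
    then show "e = ratfun.E n"
      unfolding iff by (intro ratfun.E_unique) blast+
  next
    assume "e = ratfun.E n"
    then show "is_nonsym_poly n e"
      unfolding iff using ratfun.lookup_E ratfun.E_triangular ratfun.orthogonal_E[unfolded ratfun.orthogonal_def]
      by blast
  qed
qed

lemma nonsym_poly_eq: "nonsym_poly n = ratfun.E n"
  unfolding nonsym_poly_def is_nonsym_poly_iff by (rule the_equality) simp_all

lemma laurent_eval_eq: "laurent_eval f x = ratfun.ev x f"
  by (simp add: laurent_eval_def ratfun.ev_def lext_def)

lemma laurent_bar_eq: "laurent_bar = ratfun.bar_poly"
  by (rule ext) (simp add: laurent_bar_def ratfun.bar_poly_def lext_def mult_single)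

lemma q_sharp_eq: "q_sharp n = inverse (ratfun.eigenvalue n)"
  by (simp add: q_sharp_def ratfun.eigenvalue_def power_int_minus)

section \<open>The Gaussian as a convergent series\<close>

definition gauss_series :: series where
  "gauss_series = fps_to_fls (Abs_fps (\<lambda>a. \<Sum>i\<in>{i. i\<^sup>2 = int a}. fls_X powi i))"

lemma abs_le_square: "\<bar>i\<bar> \<le> (i::int)\<^sup>2"
proof (cases "i = 0")
  case False
  then have "\<bar>i\<bar> * 1 \<le> \<bar>i\<bar> * \<bar>i\<bar>"
    by (intro mult_left_mono) auto
  then show ?thesis
    by (simp add: power2_eq_square)
qed simp

lemma finite_square_roots: "finite {i::int. i\<^sup>2 = a}"
proof (rule finite_subset)
  show "{i::int. i\<^sup>2 = a} \<subseteq> {- a..a}"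
  proof
    fix i assume "i \<in> {i::int. i\<^sup>2 = a}"
    then have "\<bar>i\<bar> \<le> a"
      using abs_le_square[of i] by simp
    then show "i \<in> {- a..a}"
      by auto
  qed
qed simp

lemma gauss_series_nth: "gauss_series $$ a = (\<Sum>i\<in>{i. i\<^sup>2 = a}. fls_X powi i)"
proof (cases "a < 0")
  case True
  have "i\<^sup>2 \<noteq> a" for i
    using True zero_le_power2[of i] by linarith
  with True show ?thesis
    by (simp add: gauss_series_def)
qed (simp add: gauss_series_def)

lemma co_gauss_series: "co gauss_series a i = (if a = i\<^sup>2 then 1 else 0)"
proof -
  have "(\<Sum>j\<in>S. fls_X powi j :: int poly fract fls) $$ i = (\<Sum>j\<in>S. (fls_X powi j :: int poly fract fls) $$ i)" for S
    by (induction S rule: infinite_finite_induct) simp_all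
  moreover have "(fls_X powi j :: int poly fract fls) $$ i = (if j = i then 1 else 0)" for j
    by auto
  ultimately have "co gauss_series a i = (\<Sum>j\<in>{j. j\<^sup>2 = a}. if j = i then 1 else 0)"
    by (simp only: gauss_series_nth)
  then show ?thesis
    using finite_square_roots[of a] by (simp add: eq_commute[of a])
qed

text \<open>Any finite partial sum containing the indices from -n to n agrees with the limit below
  u^n, because |i| \<le> i^2.\<close>

lemma gauss_eq: "gauss = gauss_series"
  unfolding gauss_def
proof (rule infsumI)
  show "((\<lambda>n. q_quarter_series powi n\<^sup>2 * X_series powi n) has_sum gauss_series) UNIV"
    unfolding has_sum_def
  proof (rule tendstoI)
    fix e :: real assume "e > 0"
    then obtain n where n: "inverse (2 ^ n) < e"
      by (rule inverse_power_2_less)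
    show "\<forall>\<^sub>F F in finite_subsets_at_top UNIV.
        dist (\<Sum>n\<in>F. q_quarter_series powi n\<^sup>2 * X_series powi n) gauss_series < e"
      unfolding eventually_finite_subsets_at_top
    proof (intro exI[of _ "{- int n..int n}"] conjI allI impI)
      fix F :: "int set" assume F: "finite F \<and> {- int n..int n} \<subseteq> F \<and> F \<subseteq> UNIV"
      have "(\<Sum>k\<in>F. q_quarter_series powi k\<^sup>2 * X_series powi k) $$ a = gauss_series $$ a" if a: "a < int n" for a
      proof (rule fls_eqI)
        fix i
        have "co (\<Sum>k\<in>S. q_quarter_series powi k\<^sup>2 * X_series powi k) a i =
            (\<Sum>k\<in>S. co (q_quarter_series powi k\<^sup>2 * X_series powi k) a i)" for S
          by (induction S rule: infinite_finite_induct) simp_all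
        moreover have "co (q_quarter_series powi k\<^sup>2 * X_series powi k) a i = (if k = i then if a = i\<^sup>2 then 1 else 0 else 0)" for k
          unfolding co_monomial[of "1 :: int poly fract" "k\<^sup>2" k a i, unfolded monomial_eq fls_const_1 mult_1_right] by auto
        ultimately have "co (\<Sum>k\<in>F. q_quarter_series powi k\<^sup>2 * X_series powi k) a i =
            (if i \<in> F then if a = i\<^sup>2 then 1 else 0 else 0)"
          using F by simp
        moreover have "i \<in> F" if "a = i\<^sup>2"
        proof -
          have "\<bar>i\<bar> < int n"
            using abs_le_square[of i] a that by linarith
          then have "i \<in> {- int n..int n}"
            by auto
          with F show ?thesis
            by blast
        qed
        ultimately show "co (\<Sum>k\<in>F. q_quarter_series powi k\<^sup>2 * X_series powi k) a i = co gauss_series a i"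
          by (auto simp: co_gauss_series)
      qed
      then have "dist (\<Sum>k\<in>F. q_quarter_series powi k\<^sup>2 * X_series powi k) gauss_series \<le> inverse (2 ^ n)"
        by (rule dist_fls_le)
      with n show "dist (\<Sum>k\<in>F. q_quarter_series powi k\<^sup>2 * X_series powi k) gauss_series < e"
        by simp
    qed simp_all
  qed
qed

section \<open>The Gaussian and the master formula\<close>

text \<open>The sequence \<phi> to which the abstract evaluation theorem is applied.\<close>

definition gauss_coeff :: "int \<Rightarrow> series" where
  "gauss_coeff n = const_term (X_series powi n * (gauss * mu0))"

text \<open>The set S may be any finite set containing the support, so that the two sides of an
  identity can be summed over matching ranges.\<close>

lemma co_gauss_coeff:
  assumes S: "finite S" "\<And>k. co mu0 (a - k\<^sup>2) (- n - k) \<noteq> 0 \<Longrightarrow> k \<in> S"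
  shows "co (gauss_coeff n) a 0 = (\<Sum>k\<in>S. co mu0 (a - k\<^sup>2) (- n - k))"
proof -
  let ?T = "mult_support gauss mu0 a (- n)"
  define h where "h k = (k\<^sup>2, k)" for k :: int
  have T: "x \<in> ?T \<longleftrightarrow> (\<exists>k. x = h k \<and> co mu0 (a - k\<^sup>2) (- n - k) \<noteq> 0)" for x
    by (cases x) (auto simp: mult_support_def h_def gauss_eq co_gauss_series split: if_splits)
  define S' where "S' = {k \<in> S. co mu0 (a - k\<^sup>2) (- n - k) \<noteq> 0}"
  have bij: "bij_betw h S' ?T"
  proof (rule bij_betw_imageI)
    show "inj_on h S'"
      by (auto simp: inj_on_def h_def)
    show "h ` S' = ?T"
      using S(2) by (auto simp: S'_def T)
  qed
  have "co (gauss_coeff n) a 0 = co (gauss * mu0) a (- n)"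
    by (simp add: gauss_coeff_def co_const_term co_X_powi_mult)
  also have "\<dots> = (\<Sum>(b, j)\<in>?T. co gauss b j * co mu0 (a - b) (- n - j))"
    by (rule co_mult)
  also have "\<dots> = (\<Sum>k\<in>S'. case h k of (b, j) \<Rightarrow> co gauss b j * co mu0 (a - b) (- n - j))"
    by (rule sum.reindex_bij_betw[OF bij, symmetric])
  also have "\<dots> = (\<Sum>k\<in>S'. co mu0 (a - k\<^sup>2) (- n - k))"
    by (simp add: h_def gauss_eq co_gauss_series)
  also have "\<dots> = (\<Sum>k\<in>S. co mu0 (a - k\<^sup>2) (- n - k))"
    using S(1) by (intro sum.mono_neutral_left) (auto simp: S'_def)
  finally show ?thesis .
qed

lemma co_mu0_square_support:
  assumes "co mu0 (a - k\<^sup>2) i \<noteq> 0" "a - fls_subdegree mu0 \<le> K"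
  shows "\<bar>k\<bar> \<le> K"
proof -
  have "mu0 $$ (a - k\<^sup>2) \<noteq> 0"
    using assms(1) by auto
  then have "fls_subdegree mu0 \<le> a - k\<^sup>2"
    by (rule fls_subdegree_leI)
  then show ?thesis
    using abs_le_square[of k] assms(2) by linarith
qed

lemma co_gauss_coeff_eq_0: "i \<noteq> 0 \<Longrightarrow> co (gauss_coeff n) a i = 0"
  by (simp add: gauss_coeff_def co_const_term)

text \<open>The interval may extend further to the left than to the right, as needed for the
  reindexing k -> -k - 1.\<close>

lemma co_gauss_coeff_interval:
  assumes "a - fls_subdegree mu0 \<le> K" "- K \<ge> L"
  shows "co (gauss_coeff n) a 0 = (\<Sum>k\<in>{L..K}. co mu0 (a - k\<^sup>2) (- n - k))"
proof (rule co_gauss_coeff)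
  fix k assume "co mu0 (a - k\<^sup>2) (- n - k) \<noteq> 0"
  then have "\<bar>k\<bar> \<le> K"
    using assms(1) by (rule co_mu0_square_support)
  with assms(2) show "k \<in> {L..K}"
    by auto
qed simp

text \<open>The Gaussian is even in its summation index. After k -> -k in two of the sums, the
  relation holds term by term by \<open>co_mu0_symmetry\<close> at n + k.\<close>

lemma gauss_coeff_symmetry:
  "gauss_coeff n - to_series (t_half\<^sup>2) * gauss_coeff (- n) =
    to_series (t_half\<^sup>2) * gauss_coeff (n + 2) - gauss_coeff (- n - 2)"
proof (rule series_eqI)
  fix a i
  define K where "K = a - fls_subdegree mu0"
  have S: "co (gauss_coeff n) a 0 = (\<Sum>k\<in>{- K..K}. co mu0 (a - k\<^sup>2) (- n - k))" for n
    by (rule co_gauss_coeff_interval) (simp_all add: K_def)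
  have S': "co (gauss_coeff n) a 0 = (\<Sum>k\<in>{- K..K}. co mu0 (a - k\<^sup>2) (- n + k))" for n
    unfolding S by (rule sum.reindex_bij_witness[of _ uminus uminus]) auto
  have "co (gauss_coeff n) a 0 - t_coeff * co (gauss_coeff (- n)) a 0 =
      (\<Sum>k\<in>{- K..K}. co mu0 (a - k\<^sup>2) (- (n + k)) - t_coeff * co mu0 (a - k\<^sup>2) (n + k))"
    unfolding S[of n] S'[of "- n"] by (simp add: sum_subtractf sum_distrib_left)
  also have "\<dots> = (\<Sum>k\<in>{- K..K}. t_coeff * co mu0 (a - k\<^sup>2) (- (n + k) - 2) - co mu0 (a - k\<^sup>2) (n + k + 2))"
    by (simp only: co_mu0_symmetry)
  also have "\<dots> = t_coeff * co (gauss_coeff (n + 2)) a 0 - co (gauss_coeff (- n - 2)) a 0"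
  proof -
    have "- (n + k) - 2 = - (n + 2) - k" "n + k + 2 = - (- n - 2) + k" for k
      by simp_all
    then show ?thesis
      unfolding S[of "n + 2"] S'[of "- n - 2"] by (simp only: sum_subtractf sum_distrib_left)
  qed
  finally show "co (gauss_coeff n - to_series (t_half\<^sup>2) * gauss_coeff (- n)) a i =
      co (to_series (t_half\<^sup>2) * gauss_coeff (n + 2) - gauss_coeff (- n - 2)) a i"
    unfolding to_series.hom_power to_series_t_half fls_minus_nth co_t_mult
    by (cases "i = 0") (simp_all add: co_gauss_coeff_eq_0)
qed

text \<open>Applying pi to the Gaussian completes a square: k^2 + 2k = (k + 1)^2 - 1. The -1 is the
  source of the factor u^{-1}.\<close>

lemma gauss_coeff_shift:
  "to_series (q_quarter powi (2 * n)) * gauss_coeff (- n) = to_series (inverse q_quarter) * gauss_coeff (n + 1)"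
proof (rule series_eqI)
  fix a i
  define K where "K = max (a - 2 * n - fls_subdegree mu0) (a + 1 - fls_subdegree mu0)"
  have "co (gauss_coeff (n + 1)) (a + 1) 0 = (\<Sum>k\<in>{- K - 1..K}. co mu0 (a + 1 - k\<^sup>2) (- (n + 1) - k))"
    by (rule co_gauss_coeff_interval) (simp_all add: K_def)
  also have "\<dots> = (\<Sum>k\<in>{- K - 1..K}. co mu0 (a - 2 * n - k\<^sup>2) (- (- n) - k))"
  proof (rule sum.reindex_bij_witness[of _ "\<lambda>k. - k - 1" "\<lambda>k. - k - 1"])
    fix k
    \<comment> \<open>The change of the u-exponent under k -> -k - 1 is twice the X-exponent n + 1 +
      k, which is precisely the shift absorbed by \<open>co_mu0_pi\<close>.\<close>
    have "a + 1 - k\<^sup>2 = (a - 2 * n - (- k - 1)\<^sup>2) + 2 * (n + 1 + k)" "- (n + 1) - k = - (n + 1 + k)"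
      "- (- n) - (- k - 1) = n + 1 + k"
      by (simp_all add: power2_eq_square algebra_simps)
    then show "co mu0 (a - 2 * n - (- k - 1)\<^sup>2) (- (- n) - (- k - 1)) = co mu0 (a + 1 - k\<^sup>2) (- (n + 1) - k)"
      by (simp only: co_mu0_pi)
  qed auto
  also have "\<dots> = co (gauss_coeff (- n)) (a - 2 * n) 0"
    by (rule co_gauss_coeff_interval[symmetric]) (simp_all add: K_def)
  finally have eq: "co (gauss_coeff (n + 1)) (a + 1) 0 = co (gauss_coeff (- n)) (a - 2 * n) 0" .
  have inv: "to_series (inverse q_quarter) = q_quarter_series powi - 1"
    by (simp add: to_series.hom_inverse to_series_q_quarter power_int_minus del: fls_X_power_int)
  show "co (to_series (q_quarter powi (2 * n)) * gauss_coeff (- n)) a i =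
      co (to_series (inverse q_quarter) * gauss_coeff (n + 1)) a i"
    unfolding inv to_series.hom_powi to_series_q_quarter co_q_quarter_powi_mult
    using eq by (cases "i = 0") (simp_all add: co_gauss_coeff_eq_0)
qed

lemma gauss_master:
  assumes f: "ratfun.level \<bar>m\<bar> f"
  shows "const_term (laurent_series (spherical_poly n) * laurent_series f * gauss * mu0) =
    to_series (q_quarter powi (m\<^sup>2 + n\<^sup>2) * t_half powi (\<bar>m\<bar> + \<bar>n\<bar>) * laurent_eval f (q_sharp n))
      * const_term (gauss * mu0)"
proof -
  have sph: "spherical_poly n = C (inverse (ratfun.ev (inverse t_half) (ratfun.E n))) * ratfun.E n"
    by (simp only: spherical_poly_def nonsym_poly_eq laurent_eval_eq)
  have "const_term (laurent_series (spherical_poly n) * laurent_series f * gauss * mu0) =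
      lext to_series gauss_coeff (spherical_poly n * f)"
    unfolding laurent_series_mult[symmetric] mult.assoc[of _ gauss mu0] const_term_laurent_series
      gauss_coeff_def[abs_def] ..
  also have "\<dots> = to_series (q_quarter powi (m\<^sup>2 + n\<^sup>2) * t_half powi (\<bar>m\<bar> + \<bar>n\<bar>) *
      ratfun.ev (inverse (ratfun.eigenvalue n)) f) * gauss_coeff 0"
    unfolding sph
    by (rule ratfun.gaussian_functional_E[OF to_series.field_homomorphism_axioms gauss_coeff_symmetry
          gauss_coeff_shift f])
  also have "gauss_coeff 0 = const_term (gauss * mu0)"
    by (simp add: gauss_coeff_def)
  finally show ?thesis
    by (simp only: laurent_eval_eq q_sharp_eq)
qed

theorem theorem7p1:
  fixes m n :: int
  shows "const_term (laurent_series (spherical_poly n) * laurent_series (spherical_poly m)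
             * gauss * mu0)
           = to_series (q_quarter powi (m\<^sup>2 + n\<^sup>2) * t_half powi (\<bar>m\<bar> + \<bar>n\<bar>)
               * laurent_eval (spherical_poly m) (q_sharp n))
             * const_term (gauss * mu0)
       \<and> const_term (laurent_series (spherical_poly n)
             * laurent_series (laurent_bar (spherical_poly m)) * gauss * mu0)
           = to_series (q_quarter powi (m\<^sup>2 + n\<^sup>2) * t_half powi (\<bar>m\<bar> + \<bar>n\<bar>)
               * laurent_eval (laurent_bar (spherical_poly m)) (q_sharp n))
             * const_term (gauss * mu0)"
proof -
  have "ratfun.level \<bar>m\<bar> (spherical_poly m)"
    unfolding spherical_poly_def nonsym_poly_eq by (intro ratfun.level_C_mult ratfun.level_E)
  then show ?thesis
    unfolding laurent_bar_eq by (intro conjI gauss_master ratfun.level_bar_poly)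
qed

end
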